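(* Let $H$ be a Horton set of size $n$ in $\mathbb{R}^2\subset\mathbb{R}\mathcal{P}^2$. Then $H$ has $\Theta(n^2)$ projective $k$-holes for every $k\in\{3,\dots,7\}$. Moreover, if $H$ is the canonical Horton set of size $n=2^z$ ($z$ a positive integer), then the number of projective $3$-holes in $H$ equals $$4.25\cdot 2^{2z}+2^z\left(-\tfrac{3z^2}{2}-\tfrac{z}{2}-5.5\right)-4z+2=4.25n^2-1.5\,n\log_2^2 n-\Theta(n\log n).$$
   Context: All finite point sets are in general position (no three on a line). A Euclidean plane $\rho\subset\mathbb{R}\mathcal{P}^2$ is the set obtained by removing a projective line. A subset $X\subset\mathbb{R}\mathcal{P}^2$ is semiconvex if any two points of $X$ can be joined by a (projective) line segment contained in $X$; it is convex if it is semiconvex and contained in some Euclidean plane. A projective convex hull of $Y$ is an inclusion-wise minimal convex subset of $\mathbb{R}\mathcal{P}^2$ containing $Y$ (not necessarily unique). For a finite set $P\subset\mathbb{R}\mathcal{P}^2$, a projective $k$-gon determined by $P$ is a projective convex hull of a set $G$ of $k$ points of $P$ which contains all points of $G$ on its boundary; equivalently, a subset of $\mathbb{R}\mathcal{P}^2$ that is a convex polygon with $k$ vertices, all in $P$, in some Euclidean plane $\rho\subset\mathbb{R}\mathcal{P}^2$. A projective $k$-hole in $P$ ($k\ge3$) is a projective $k$-gon determined by $P$ with no point of $P$ in its interior. Projective holes are counted as subsets of $\mathbb{R}\mathcal{P}^2$ (one set of $3$ or $4$ points may determine several). For finite $X,Y\subset\mathbb{R}^2$, $X$ lies deep below $Y$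 (and $Y$ lies high above $X$) if each point of $X$ lies below every line through two points of $Y$ and each point of $Y$ lies above every line through two points of $X$. Let $H=\{p_1,\dots,p_n\}\subset\mathbb{R}^2$ have distinct $x$-coordinates, with $p_1,\dots,p_n$ sorted by increasing $x$-coordinate; let $H_0$ be the set of $p_i$ with $i$ odd and $H_1$ the set of $p_i$ with $i$ even. $H$ is Horton if $|H|\le1$, or if $|H|\ge2$, $H_0$ and $H_1$ are both Horton, and $H_0$ lies deep below or high above $H_1$. For a Horton set $H$ with $|H|\ge2$, the two sets $H_0,H_1$ are denoted $U(H)$ and $L(H)$ so that $U(H)$ lies high above $L(H)$. The sets $H$, $U(H)$, $L(H)$, $U(U(H))$, $L(U(H))$, $U(L(H))$, $L(L(H))$, etc. are the layers of $H$. A canonical Horton set is a Horton set such that, for each layer $X$ (with $|X|\ge 2$), the leftmost point of $X$ lies in $L(X)$ (for $|X|=2$, where the deep-below condition is vacuous, the labels $L,U$ are chosen accordingly); up to order type it is unique for a given size. Asymptotic notation is for $n\to\infty$. *)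

theory Defs
  imports "HOL-Analysis.Analysis" "HOL-Library.Landau_Symbols"
begin

typedef rp2 = "{S :: (real^3) set. subspace S \<and> dim S = 1}"
proof -
  have "axis 1 1 \<noteq> (0 :: real^3)" by simp
  then have "dim (span {axis 1 1 :: real^3}) = 1" by simp
  then show ?thesis using subspace_span by blast
qed

(* Meaningful only for v \<noteq> 0: the point with homogeneous coordinates v. *)
definition rp2_of :: "real^3 \<Rightarrow> rp2" where
  "rp2_of v = Abs_rp2 (span {v})"

(* The quotient topology of R^3 - {0}; as R^3 - {0} is open in R^3, openness of the preimage
   may be tested in R^3. *)
instantiation rp2 :: topological_space
begin

definition open_rp2 :: "rp2 set \<Rightarrow> bool" where
  "open_rp2 U \<longleftrightarrow> open {v. v \<noteq> 0 \<and> rp2_of v \<in> U}"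

instance
proof
  have "{v :: real^3. v \<noteq> 0 \<and> rp2_of v \<in> UNIV} = - {0}" by auto
  then show "open (UNIV :: rp2 set)"
    unfolding open_rp2_def by (simp add: open_Compl)
next
  fix S T :: "rp2 set"
  assume "open S" "open T"
  moreover have "{v. v \<noteq> 0 \<and> rp2_of v \<in> S \<inter> T}
      = {v. v \<noteq> 0 \<and> rp2_of v \<in> S} \<inter> {v. v \<noteq> 0 \<and> rp2_of v \<in> T}" by auto
  ultimately show "open (S \<inter> T)"
    unfolding open_rp2_def by (simp add: open_Int)
next
  fix K :: "rp2 set set"
  assume "\<forall>S\<in>K. open S"
  moreover have "{v. v \<noteq> 0 \<and> rp2_of v \<in> \<Union>K} = (\<Union>S\<in>K. {v. v \<noteq> 0 \<and> rp2_of v \<in> S})" by auto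
  ultimately show "open (\<Union>K)"
    unfolding open_rp2_def by (simp add: open_UN)
qed

end

definition rp2_line :: "rp2 set \<Rightarrow> bool" where
  "rp2_line l \<longleftrightarrow> (\<exists>W. subspace W \<and> dim W = 2 \<and> l = {p. Rep_rp2 p \<subseteq> W})"

definition rp2_plane :: "rp2 set \<Rightarrow> bool" where
  "rp2_plane \<rho> \<longleftrightarrow> (\<exists>l. rp2_line l \<and> \<rho> = - l)"

(* Two distinct points p, q are joined by exactly two segments, obtained by taking
   representatives of p and q on the same or on opposite sides of the origin; the only segment
   from p to itself is {p}. *)
definition rp2_segment :: "rp2 \<Rightarrow> rp2 \<Rightarrow> rp2 set \<Rightarrow> bool" where
  "rp2_segment p q S \<longleftrightarrow>
     (\<exists>u v. p = rp2_of u \<and> q = rp2_of v \<and> 0 \<notin> closed_segment u v \<and>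
            S = rp2_of ` closed_segment u v)"

definition rp2_semiconvex :: "rp2 set \<Rightarrow> bool" where
  "rp2_semiconvex X \<longleftrightarrow> (\<forall>p\<in>X. \<forall>q\<in>X. \<exists>S. rp2_segment p q S \<and> S \<subseteq> X)"

definition rp2_convex :: "rp2 set \<Rightarrow> bool" where
  "rp2_convex X \<longleftrightarrow> rp2_semiconvex X \<and> (\<exists>\<rho>. rp2_plane \<rho> \<and> X \<subseteq> \<rho>)"

definition rp2_convex_hull :: "rp2 set \<Rightarrow> rp2 set \<Rightarrow> bool" where
  "rp2_convex_hull Y C \<longleftrightarrow>
     rp2_convex C \<and> Y \<subseteq> C \<and> (\<forall>D. rp2_convex D \<and> Y \<subseteq> D \<and> D \<subseteq> C \<longrightarrow> D = C)"

(* To be used for finite P in general position. *)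
definition proj_gon :: "nat \<Rightarrow> rp2 set \<Rightarrow> rp2 set \<Rightarrow> bool" where
  "proj_gon k P C \<longleftrightarrow>
     (\<exists>G. G \<subseteq> P \<and> card G = k \<and> rp2_convex_hull G C \<and> G \<subseteq> frontier C)"

definition proj_holes :: "nat \<Rightarrow> rp2 set \<Rightarrow> rp2 set set" where
  "proj_holes k P = {C. proj_gon k P C \<and> interior C \<inter> P = {}}"

definition rp2_embed :: "real^2 \<Rightarrow> rp2" where
  "rp2_embed p = rp2_of (vector [p$1, p$2, 1])"

(* Used only for a$1 \<noteq> b$1: the height at abscissa x of the line through a and b. *)
definition line_height :: "real^2 \<Rightarrow> real^2 \<Rightarrow> real \<Rightarrow> real" where
  "line_height a b x = a$2 + (b$2 - a$2) / (b$1 - a$1) * (x - a$1)"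

definition deep_below :: "(real^2) set \<Rightarrow> (real^2) set \<Rightarrow> bool" where
  "deep_below X Y \<longleftrightarrow>
     (\<forall>p\<in>X. \<forall>a\<in>Y. \<forall>b\<in>Y. a \<noteq> b \<longrightarrow> p$2 < line_height a b (p$1)) \<and>
     (\<forall>q\<in>Y. \<forall>a\<in>X. \<forall>b\<in>X. a \<noteq> b \<longrightarrow> q$2 > line_height a b (q$1))"

(* Positions are counted from 1, so the i-th point from the left has i - 1 points to its left:
   H_0 (odd i) consists of the points with an even number of points to their left. *)
definition horton0 :: "(real^2) set \<Rightarrow> (real^2) set" where
  "horton0 H = {p\<in>H. even (card {q\<in>H. q$1 < p$1})}"

definition horton1 :: "(real^2) set \<Rightarrow> (real^2) set" where
  "horton1 H = {p\<in>H. odd (card {q\<in>H. q$1 < p$1})}"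

inductive horton :: "(real^2) set \<Rightarrow> bool" where
  "finite H \<Longrightarrow> card H \<le> 1 \<Longrightarrow> horton H"
| "finite H \<Longrightarrow> inj_on (\<lambda>p. p$1) H \<Longrightarrow> card H \<ge> 2 \<Longrightarrow>
   horton (horton0 H) \<Longrightarrow> horton (horton1 H) \<Longrightarrow>
   deep_below (horton0 H) (horton1 H) \<or> deep_below (horton1 H) (horton0 H) \<Longrightarrow> horton H"

(* For a Horton set of size at least 3 exactly one of H_0, H_1 lies deep below the other. For size 2
   both do, vacuously; horton_L is then {p_1}, so that the leftmost point gets the label L. *)
definition horton_L :: "(real^2) set \<Rightarrow> (real^2) set" where
  "horton_L H = (if deep_below (horton0 H) (horton1 H) then horton0 H else horton1 H)"

definition horton_U :: "(real^2) set \<Rightarrow> (real^2) set" where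
  "horton_U H = (if deep_below (horton0 H) (horton1 H) then horton1 H else horton0 H)"

inductive_set layers :: "(real^2) set \<Rightarrow> (real^2) set set" for H where
  "H \<in> layers H"
| "X \<in> layers H \<Longrightarrow> card X \<ge> 2 \<Longrightarrow> horton_U X \<in> layers H"
| "X \<in> layers H \<Longrightarrow> card X \<ge> 2 \<Longrightarrow> horton_L X \<in> layers H"

definition canonical_horton :: "(real^2) set \<Rightarrow> bool" where
  "canonical_horton H \<longleftrightarrow> horton H \<and>
     (\<forall>X\<in>layers H. card X \<ge> 2 \<longrightarrow> (\<forall>p\<in>X. (\<forall>q\<in>X. p$1 \<le> q$1) \<longrightarrow> p \<in> horton_L X))"

(* Horton sets are automatically in general position. *)

lemma line_height_collinear:
  assumes "collinear {a, b, c}" "a$1 \<noteq> b$1"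
  shows "c$2 = line_height a b (c$1)"
proof -
  have "collinear {a, c, b}" using assms(1) by (simp add: insert_commute)
  then obtain u where u: "c = u *\<^sub>R a + (1 - u) *\<^sub>R b"
    using assms(2) by (auto simp: collinear_3_expand)
  have "c$1 - a$1 = (1 - u) * (b$1 - a$1)" "c$2 - a$2 = (1 - u) * (b$2 - a$2)"
    unfolding u by (simp_all add: algebra_simps)
  then show ?thesis using assms(2) unfolding line_height_def by (simp add: mult.commute diff_eq_eq)
qed

lemma horton_general_position:
  assumes "horton H" "a \<in> H" "b \<in> H" "c \<in> H" "a \<noteq> b" "a \<noteq> c" "b \<noteq> c"
  shows "\<not> collinear {a, b, c}"
  using assms
proof (induction arbitrary: a b c rule: horton.induct)
  case (1 H)
  then have "\<forall>x\<in>H. \<forall>y\<in>H. x = y" by (metis One_nat_def card_le_Suc0_iff_eq)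
  with "1.prems" show ?case by blast
next
  case (2 H)
  have split: "x \<in> horton0 H \<or> x \<in> horton1 H" if "x \<in> H" for x
    using that unfolding horton0_def horton1_def by blast
  have mix: "\<not> collinear {x, y, z}"
    if "x \<noteq> y" "x \<in> H" "y \<in> H" and
       "x \<in> horton0 H \<and> y \<in> horton0 H \<and> z \<in> horton1 H \<or>
        x \<in> horton1 H \<and> y \<in> horton1 H \<and> z \<in> horton0 H" for x y z
  proof
    assume "collinear {x, y, z}"
    moreover have "x$1 \<noteq> y$1" using that "2.hyps"(2) by (auto dest: inj_onD)
    ultimately have "z$2 = line_height x y (z$1)" by (rule line_height_collinear)
    then show False using that "2.hyps"(6) unfolding deep_below_def by fastforce
  qed
  have perm: "{a, b, c} = {a, c, b}" "{a, b, c} = {b, c, a}" by auto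
  consider "a \<in> horton0 H" "b \<in> horton0 H" "c \<in> horton0 H"
    | "a \<in> horton1 H" "b \<in> horton1 H" "c \<in> horton1 H"
    | "\<not> collinear {a, b, c}" | "\<not> collinear {a, c, b}" | "\<not> collinear {b, c, a}"
    using split[OF "2.prems"(1)] split[OF "2.prems"(2)] split[OF "2.prems"(3)]
      mix[of a b c] mix[of a c b] mix[of b c a] "2.prems" by argo
  then show ?case
  proof cases
    case 1
    then show ?thesis using "2.IH"(1) "2.prems" by blast
  next
    case 2
    then show ?thesis using "2.IH"(2) "2.prems" by blast
  next
    case 3
    then show ?thesis .
  next
    case 4
    then show ?thesis using perm(1) by simp
  next
    case 5
    then show ?thesis using perm(2) by simp
  qed
qed

end

theory Submission
  imports Defs
begin

text \<open>
A projective polygon with vertex set \<open>G\<close> is determined by \<open>G\<close> and a choice of a sign for the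
homogeneous vector of each vertex, up to a common sign: the polygon is the image of the convex cone
spanned by the signed vectors. Conversely, by Caratheodory's theorem for cones, signed points are in
convex position and span a hole iff each of the triangles spanned by three of them contains no other
point of the set (\<open>proj_holes_eq_regions\<close>, \<open>region_eqD\<close>). As a point lies in one of the four triangles
of three points according to the signs of determinants, the theorem becomes a statement about the
chirotope of the point set, that is, about the orientations of its triples.

Number a Horton set from left to right. Its two classes are the even and the odd numbers, and the
orientation of a triple that meets both classes depends only on the horizontal order and on which
class is the upper one. This has two consequences. First, a triangle with all vertices in one class either contains no point of the
other class or all of them, and the latter happens exactly for the triangle that contains the
vertical direction (\<open>mono_in_cell_iff\<close>). Second, for a triangle with vertices \<open>p < q\<close> in one class and
\<open>r\<close> in the other one the position of \<open>r\<close> is almost irrelevant (\<open>mixed_empty_triangle_iff\<close>): if \<open>p\<close> and \<open>q\<close> have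
the same sign, the triangle is empty iff on a certain side of the line \<open>pq\<close> there is no point of their
class between them (a free pair); if the signs differ, then a wedge on the other segment between \<open>p\<close> and
\<open>q\<close> has to be free, and \<open>r\<close> has to be the first or the last point of its class. Which pairs are free
is again decided by the classes of the class: a free pair consists of two neighbours, or it is
free within the class on the relevant side. In particular there are only linearly many free pairs, and only
linearly many sets of pairwise free points.

For the upper bound, consider a hole with vertices in both classes. The vertices of one sign in one
class are pairwise free, so there are linearly many choices for each of the four parts of the hole.
If one class carries both signs, then the vertices in the other class are among its first and its
last point, so at most two parts are not restricted to boundedly many choices. Hence there are
quadratically many holes that meet both classes, and the other holes are holes of a class; the
recursion gives a quadratic total (\<open>card_signed_holes_le\<close>).

For the lower bound, take the first point of one class as apex with a positive sign, at most three
consecutive points in one class of the other class with positive signs and, further to the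
right, at most three consecutive points in its remaining class with negative signs. The sides can be
chosen such that all triangles at the apex are empty, and these triangles decide about all others
(\<open>empty_triangle_by_fan\<close>). There are quadratically many such holes, with up to seven vertices
(\<open>many_fan_holes\<close>).

For canonical Horton sets with \<open>2 ^ z\<close> points all the quantities can be computed. On each side there are
\<open>2 ^ (z + 1) - z - 2\<close> free pairs (\<open>canonical_free_pairs\<close>), the numbers of pairs with a free wedge for
the two sides add up to \<open>4 ^ (z - 1) + 2 * z - 1\<close> (\<open>canonical_wedge_pairs\<close>), and the triangles of a
class that are lost in the whole set are the vertical ones, whose number is given by the distances
in free pairs. The resulting recursion has the stated solution (\<open>canonical_holes3_count\<close>).
\<close>

section \<open>Signed point sets and the cones they span\<close>

definition det3 :: "real^3 \<Rightarrow> real^3 \<Rightarrow> real^3 \<Rightarrow> real" where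
  "det3 u v w = u \<bullet> cross3 v w"

lemma det3_linear:
  "det3 (a + b) v w = det3 a v w + det3 b v w" "det3 u (a + b) w = det3 u a w + det3 u b w"
  "det3 u v (a + b) = det3 u v a + det3 u v b"
  "det3 (r *\<^sub>R a) v w = r * det3 a v w" "det3 u (r *\<^sub>R a) w = r * det3 u a w"
  "det3 u v (r *\<^sub>R a) = r * det3 u v a"
  by (simp_all add: det3_def inner_add_left cross_add_left cross_add_right inner_add_right
      cross_mult_left cross_mult_right)

lemma det3_expand:
  "det3 u v w = u$1 * (v$2 * w$3 - v$3 * w$2) + u$2 * (v$3 * w$1 - v$1 * w$3)
     + u$3 * (v$1 * w$2 - v$2 * w$1)"
  by (simp add: det3_def cross3_def inner_vec_def sum_3 vector_3)

lemma det3_swap: "det3 v u w = - det3 u v w" "det3 u w v = - det3 u v w"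
  by (simp_all add: det3_expand algebra_simps)

lemma det3_same [simp]: "det3 u u w = 0" "det3 u w w = 0" "det3 u w u = 0"
  by (simp_all add: det3_expand algebra_simps)

lemma det3_zero [simp]: "det3 0 v w = 0" "det3 u 0 w = 0" "det3 u v 0 = 0"
  by (simp_all add: det3_expand)

lemma cramer3:
  "det3 a b c *\<^sub>R p = det3 p b c *\<^sub>R a + det3 a p c *\<^sub>R b + det3 a b p *\<^sub>R c"
  by (simp add: vec_eq_iff forall_3 det3_expand algebra_simps)

type_synonym 'i chirotope = "'i \<Rightarrow> 'i \<Rightarrow> 'i \<Rightarrow> bool"

text \<open>The lines through three points cut the projective plane into four triangles, one for each choice
of signs of the three homogeneous vectors up to a common sign. If \<^term>\<open>cc\<close> gives the signs of the
determinants, Cramer's rule says that \<^term>\<open>p\<close> lies in the triangle with signs \<^term>\<open>e\<close> iff the three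
comparisons below agree.\<close>

definition in_cell :: "'i chirotope \<Rightarrow> ('i \<Rightarrow> bool) \<Rightarrow> 'i \<Rightarrow> 'i \<Rightarrow> 'i \<Rightarrow> 'i \<Rightarrow> bool" where
  "in_cell cc e a b c p \<longleftrightarrow>
     (e a = cc p b c) = (e b = cc a p c) \<and> (e b = cc a p c) = (e c = cc a b p)"

definition empty_triangle :: "'i set \<Rightarrow> 'i chirotope \<Rightarrow> ('i \<Rightarrow> bool) \<Rightarrow> 'i \<Rightarrow> 'i \<Rightarrow> 'i \<Rightarrow> bool" where
  "empty_triangle I cc e a b c \<longleftrightarrow> (\<forall>p\<in>I - {a, b, c}. \<not> in_cell cc e a b c p)"

text \<open>A pair \<open>(A, B)\<close> encodes the vertex set \<open>A \<union> B\<close> with positive signs on \<open>A\<close> and negative signs on \<open>B\<close>;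
\<open>(A, B)\<close> and \<open>(B, A)\<close> describe the same region of the projective plane. The triangles have to be
empty of the other vertices as well: this is what forces the signed vertices into convex position.\<close>

definition signed_holes :: "nat \<Rightarrow> 'i set \<Rightarrow> 'i chirotope \<Rightarrow> ('i set \<times> 'i set) set" where
  "signed_holes k I cc = {(A, B). A \<union> B \<subseteq> I \<and> A \<inter> B = {} \<and> card (A \<union> B) = k \<and>
     (\<forall>a\<in>A\<union>B. \<forall>b\<in>A\<union>B. \<forall>c\<in>A\<union>B. a \<noteq> b \<longrightarrow> a \<noteq> c \<longrightarrow> b \<noteq> c \<longrightarrow> empty_triangle I cc (\<lambda>i. i \<in> A) a b c)}"

definition sgn_of :: "bool \<Rightarrow> real" where "sgn_of b = (if b then 1 else - 1)"

lemma sgn_of_simps [simp]: "sgn_of True = 1" "sgn_of False = -1" "sgn_of b \<noteq> 0" "sgn_of b * sgn_of b = 1"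
  by (auto simp: sgn_of_def)

lemma sign_product:
  assumes "(r > 0) = (x * q > 0)" "q \<noteq> 0" "x * sgn_of e > 0"
  shows "(e = (r > 0)) = (q > 0)"
  using assms by (cases e) (auto simp: zero_less_mult_iff)

definition cone_of :: "'i set \<Rightarrow> ('i \<Rightarrow> real^3) \<Rightarrow> (real^3) set" where
  "cone_of G v = {x. \<exists>c. (\<forall>g\<in>G. 0 \<le> c g) \<and> x = (\<Sum>g\<in>G. c g *\<^sub>R v g)}"

text \<open>Homogeneous vectors are used instead of points of a chart, because the signs in front of the
vectors carry the choice of the Euclidean plane in which a set is convex.\<close>

locale general_position =
  fixes I :: "'i set" and w :: "'i \<Rightarrow> real^3"
  assumes finite_I: "finite I"
    and cross_nz: "i \<in> I \<Longrightarrow> j \<in> I \<Longrightarrow> i \<noteq> j \<Longrightarrow> cross3 (w i) (w j) \<noteq> 0"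
    and w_nz: "i \<in> I \<Longrightarrow> w i \<noteq> 0"
    and det_nz: "i \<in> I \<Longrightarrow> j \<in> I \<Longrightarrow> k \<in> I \<Longrightarrow> i \<noteq> j \<Longrightarrow> i \<noteq> k \<Longrightarrow> j \<noteq> k \<Longrightarrow>
      det3 (w i) (w j) (w k) \<noteq> 0"
begin

definition ccw :: "'i \<Rightarrow> 'i \<Rightarrow> 'i \<Rightarrow> bool" where
  "ccw i j k \<longleftrightarrow> det3 (w i) (w j) (w k) > 0"

lemma four_vector_relation:
  assumes "a \<in> I" "b \<in> I" "c \<in> I" "d \<in> I" "distinct [a, b, c, d]" and "finite T" "{a, b, c, d} \<subseteq> T"
  obtains l where "(\<Sum>g\<in>T. l g *\<^sub>R w g) = 0" "l a \<noteq> 0" "\<And>g. g \<notin> {a, b, c, d} \<Longrightarrow> l g = 0"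
proof -
  define l where "l g = (if g = a then det3 (w d) (w b) (w c) else if g = b then det3 (w a) (w d) (w c)
     else if g = c then det3 (w a) (w b) (w d) else if g = d then - det3 (w a) (w b) (w c) else 0)" for g
  have "(\<Sum>g\<in>T. l g *\<^sub>R w g) = (\<Sum>g\<in>{a, b, c, d}. l g *\<^sub>R w g)"
    using assms by (intro sum.mono_neutral_right) (simp_all add: l_def)
  also have "\<dots> = 0"
    using assms(5) cramer3[of "w a" "w b" "w c" "w d"] by (auto simp: l_def)
  finally have "(\<Sum>g\<in>T. l g *\<^sub>R w g) = 0" .
  moreover have "l a \<noteq> 0" using assms det_nz by (auto simp: l_def)
  moreover have "l g = 0" if "g \<notin> {a, b, c, d}" for g using that by (auto simp: l_def)
  ultimately show ?thesis using that by blast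
qed

text \<open>As long as at least four coefficients are nonzero, a multiple of a linear relation between four of
the vectors can be subtracted such that one coefficient vanishes and no other one changes its sign.
The process stops with exactly three vectors, since by general position the target is not a
combination of fewer. The coefficients may have any signs, so that the lemma covers every choice of
signs of the vectors.\<close>

lemma conic_caratheodory:
  assumes "p \<in> I" "T \<subseteq> I - {p}" "s \<noteq> 0" "s *\<^sub>R w p = (\<Sum>g\<in>T. c g *\<^sub>R w g)"
  shows "\<exists>a\<in>T. \<exists>b\<in>T. \<exists>d\<in>T. \<exists>x y z. a \<noteq> b \<and> a \<noteq> d \<and> b \<noteq> d \<and>
     x * c a > 0 \<and> y * c b > 0 \<and> z * c d > 0 \<and> s *\<^sub>R w p = x *\<^sub>R w a + y *\<^sub>R w b + z *\<^sub>R w d"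
  using assms
proof (induction "card T" arbitrary: T c rule: less_induct)
  case less
  have fT: "finite T" using less.prems(2) finite_I finite_subset by blast
  have sub: "a \<in> I" "a \<noteq> p" if "a \<in> T" for a using less.prems(2) that by auto
  show ?case
  proof (cases "\<exists>g\<in>T. c g = 0")
    case True
    then obtain g where g: "g \<in> T" "c g = 0" by blast
    have "s *\<^sub>R w p = (\<Sum>g\<in>T - {g}. c g *\<^sub>R w g)"
      using less.prems(4) g fT by (simp add: sum.remove[of T g])
    moreover have "card (T - {g}) < card T" using g fT by (metis card_Diff1_less)
    ultimately show ?thesis using less.hyps[of "T - {g}" c] less.prems by blast
  next
    case nz: False
    consider "card T = 0" | "card T = 1" | "card T = 2" | "card T = 3" | "card T \<ge> 4" by linarith
    then show ?thesis
    proof cases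
      case 1
      then show ?thesis using fT less.prems w_nz[of p] by simp
    next
      case 2
      then obtain a where a: "T = {a}" by (auto simp: card_Suc_eq)
      then have "s *\<^sub>R w p = c a *\<^sub>R w a" using less.prems(4) by simp
      then have "s *\<^sub>R cross3 (w p) (w a) = cross3 (c a *\<^sub>R w a) (w a)" by (metis cross_mult_left)
      then have "s *\<^sub>R cross3 (w p) (w a) = 0" by (simp add: cross_mult_left)
      then show ?thesis using cross_nz[of p a] less.prems sub a by auto
    next
      case 3
      then obtain a b where ab: "T = {a, b}" "a \<noteq> b" by (auto simp: card_2_iff)
      have "s * det3 (w p) (w a) (w b) = det3 (s *\<^sub>R w p) (w a) (w b)" by (simp add: det3_linear)
      also have "\<dots> = 0" using less.prems(4) ab by (simp add: det3_linear)
      finally show ?thesis using det_nz[of p a b] less.prems sub ab by auto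
    next
      case 4
      then obtain a b d where abd: "T = {a, b, d}" "a \<noteq> b" "a \<noteq> d" "b \<noteq> d"
        by (auto simp: card_3_iff)
      have eq: "s *\<^sub>R w p = c a *\<^sub>R w a + c b *\<^sub>R w b + c d *\<^sub>R w d"
        using less.prems(4) abd by (simp add: add.assoc)
      have "c a * c a > 0" "c b * c b > 0" "c d * c d > 0"
        using nz abd by (auto simp: zero_less_mult_iff)
      then show ?thesis using eq abd by blast
    next
      case 5
      then obtain Q where "Q \<subseteq> T" "card Q = 4" by (meson obtain_subset_with_card_n)
      moreover obtain xs where "set xs = Q" "distinct xs"
        using \<open>Q \<subseteq> T\<close> fT finite_distinct_list finite_subset by blast
      moreover from calculation have "length xs = 4" by (metis distinct_card)
      then obtain q1 q2 q3 q4 where "xs = [q1, q2, q3, q4]"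
        by (auto simp: numeral_eq_Suc length_Suc_conv)
      ultimately have q: "{q1, q2, q3, q4} \<subseteq> T" "distinct [q1, q2, q3, q4]" by auto
      then obtain l where l: "(\<Sum>g\<in>T. l g *\<^sub>R w g) = 0" "l q1 \<noteq> 0"
        using four_vector_relation[of q1 q2 q3 q4 T] fT sub by (metis insert_subset)
      have "T \<noteq> {}" using 5 by auto
      then obtain i where i: "i \<in> T" "\<And>j. j \<in> T \<Longrightarrow> \<bar>l j / c j\<bar> \<le> \<bar>l i / c i\<bar>"
        using fT arg_min_if_finite[of T "\<lambda>j. - \<bar>l j / c j\<bar>"]
        by (metis (no_types, lifting) linorder_not_less neg_less_iff_less)
      \<comment> \<open>The index with the largest ratio is the one whose coefficient can be cancelled without
        reversing the sign of another coefficient.\<close>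
      define r where "r j = l j / c j" for j
      have q1: "q1 \<in> T" using q by simp
      then have "r q1 \<noteq> 0" using l nz by (simp add: r_def)
      moreover have "\<bar>r q1\<bar> \<le> \<bar>r i\<bar>" using i(2)[OF q1] by (simp add: r_def)
      ultimately have ri: "r i \<noteq> 0" by auto
      define c' where "c' j = c j - (1 / r i) * l j" for j
      have c'c: "c' j = c j * (1 - r j / r i)" if "j \<in> T" for j
        using that nz by (auto simp: c'_def r_def field_simps)
      have nn: "0 \<le> 1 - r j / r i" if "j \<in> T" for j
      proof -
        have "\<bar>r j / r i\<bar> \<le> 1" using i(2)[OF that, folded r_def] ri
          by (simp add: abs_divide)
        then show ?thesis by linarith
      qed
      have "(\<Sum>g\<in>T. c' g *\<^sub>R w g) = (\<Sum>g\<in>T. c g *\<^sub>R w g) - (1 / r i) *\<^sub>R (\<Sum>g\<in>T. l g *\<^sub>R w g)"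
        by (simp add: c'_def scaleR_diff_left sum_subtractf scaleR_sum_right)
      then have "s *\<^sub>R w p = (\<Sum>g\<in>T. c' g *\<^sub>R w g)" using l less.prems(4) by simp
      moreover have "c' i = 0" using c'c[OF i(1)] ri by simp
      ultimately have "s *\<^sub>R w p = (\<Sum>g\<in>T - {i}. c' g *\<^sub>R w g)"
        using i(1) fT by (simp add: sum.remove[of T i])
      moreover have "card (T - {i}) < card T" using i(1) fT by (metis card_Diff1_less)
      moreover have "T - {i} \<subseteq> I - {p}" using less.prems(2) by blast
      ultimately obtain a b d x y z where
        abd: "a \<in> T" "b \<in> T" "d \<in> T" "a \<noteq> b \<and> a \<noteq> d \<and> b \<noteq> d"
        "x * c' a > 0" "y * c' b > 0" "z * c' d > 0" "s *\<^sub>R w p = x *\<^sub>R w a + y *\<^sub>R w b + z *\<^sub>R w d"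
        using less.hyps[of "T - {i}" c'] less.prems(1,3) by blast
      have pos: "x * c j > 0" if "x * c' j > 0" "j \<in> T" for x j
        using that nn[OF that(2)] unfolding c'c[OF that(2)]
        by (metis mult.assoc zero_less_mult_pos2 mult_nonneg_nonneg order_le_less mult_eq_0_iff
           zero_less_mult_pos)
      show ?thesis
        using abd pos[OF abd(5) abd(1)] pos[OF abd(6) abd(2)] pos[OF abd(7) abd(3)] by blast
    qed
  qed
qed

text \<open>This lemma and \<open>in_cellD\<close> are the two directions of Cramer's rule: the cell of a signed triple
consists of the points with a representative that is a positive combination of the signed vectors.\<close>

lemma in_cellI:
  assumes "a \<in> I" "b \<in> I" "d \<in> I" "p \<in> I" "distinct [a, b, d, p]" "s \<noteq> 0"
    and "x * sgn_of (e a) > 0" "y * sgn_of (e b) > 0" "z * sgn_of (e d) > 0"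
    and eq: "s *\<^sub>R w p = x *\<^sub>R w a + y *\<^sub>R w b + z *\<^sub>R w d"
  shows "in_cell ccw e a b d p"
proof -
  let ?D = "det3 (w a) (w b) (w d)"
  have "s * det3 (w p) (w b) (w d) = det3 (s *\<^sub>R w p) (w b) (w d)" by (simp add: det3_linear)
  then have 1: "s * det3 (w p) (w b) (w d) = x * ?D" unfolding eq by (simp add: det3_linear)
  have "s * det3 (w a) (w p) (w d) = det3 (w a) (s *\<^sub>R w p) (w d)" by (simp add: det3_linear)
  then have 2: "s * det3 (w a) (w p) (w d) = y * ?D" unfolding eq by (simp add: det3_linear)
  have "s * det3 (w a) (w b) (w p) = det3 (w a) (w b) (s *\<^sub>R w p)" by (simp add: det3_linear)
  then have 3: "s * det3 (w a) (w b) (w p) = z * ?D" unfolding eq by (simp add: det3_linear)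
  have D: "?D \<noteq> 0" using det_nz assms by auto
  have sign: "(e = (r > 0)) = (s * ?D > 0)" if "s * r = x * ?D" "x * sgn_of e > 0" for r x e
  proof -
    have "r * (s * s) = x * (s * ?D)" using that(1) by (metis mult.assoc mult.commute)
    then have "(r > 0) = (x * (s * ?D) > 0)"
      using \<open>s \<noteq> 0\<close> by (metis mult_pos_pos not_real_square_gt_zero zero_less_mult_pos2)
    moreover have "s * ?D \<noteq> 0" using D \<open>s \<noteq> 0\<close> by simp
    ultimately show ?thesis
      using that(2) by (rule sign_product)
  qed
  show ?thesis
    using sign[OF 1 assms(7)] sign[OF 2 assms(8)] sign[OF 3 assms(9)]
    by (auto simp: in_cell_def ccw_def)
qed

lemma in_cellD:
  assumes "a \<in> I" "b \<in> I" "d \<in> I" "p \<in> I" "distinct [a, b, d, p]" "in_cell ccw e a b d p"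
  obtains s x y z where "s \<noteq> 0" "x > 0" "y > 0" "z > 0"
    "s *\<^sub>R w p = x *\<^sub>R (sgn_of (e a) *\<^sub>R w a) + y *\<^sub>R (sgn_of (e b) *\<^sub>R w b) + z *\<^sub>R (sgn_of (e d) *\<^sub>R w d)"
proof -
  let ?D = "det3 (w a) (w b) (w d)"
  let ?x = "det3 (w p) (w b) (w d)" and ?y = "det3 (w a) (w p) (w d)" and ?z = "det3 (w a) (w b) (w p)"
  have nz: "?D \<noteq> 0" "?x \<noteq> 0" "?y \<noteq> 0" "?z \<noteq> 0" using det_nz assms by auto
  define r where "r = sgn_of (e a = ccw p b d)"
  have r: "r \<noteq> 0" "r = sgn_of (e a = ccw p b d)" "r = sgn_of (e b = ccw a p d)" "r = sgn_of (e d = ccw a b p)"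
    using assms(6) by (auto simp: r_def in_cell_def)
  have pos: "0 < r * sgn_of e' * u" if "r = sgn_of (e' = (u > 0))" "u \<noteq> 0" for e' u
    using that by (cases e'; cases "u > 0") auto
  have "(r * ?D) *\<^sub>R w p = (r * sgn_of (e a) * ?x) *\<^sub>R (sgn_of (e a) *\<^sub>R w a)
      + (r * sgn_of (e b) * ?y) *\<^sub>R (sgn_of (e b) *\<^sub>R w b) + (r * sgn_of (e d) * ?z) *\<^sub>R (sgn_of (e d) *\<^sub>R w d)"
  proof -
    have k: "(r * sgn_of e' * x) *\<^sub>R (sgn_of e' *\<^sub>R u) = r *\<^sub>R (x *\<^sub>R u)" for e' x and u::"real^3"
      by (cases e') auto
    have "(r * ?D) *\<^sub>R w p = r *\<^sub>R (?D *\<^sub>R w p)" by simp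
    then show ?thesis unfolding k cramer3[of "w a" "w b" "w d" "w p"]
      by (simp only: scaleR_add_right)
  qed
  moreover have "r * ?D \<noteq> 0" using r nz by simp
  moreover have "r * sgn_of (e a) * ?x > 0" "r * sgn_of (e b) * ?y > 0" "r * sgn_of (e d) * ?z > 0"
    using pos[OF r(2)[unfolded ccw_def] nz(2)] pos[OF r(3)[unfolded ccw_def] nz(3)]
      pos[OF r(4)[unfolded ccw_def] nz(4)] by blast+
  ultimately show ?thesis using that by blast
qed

text \<open>It suffices to inspect the triangles at one vertex \<open>r\<close>, if \<open>r\<close> itself is in no triangle of other
vertices. Write a point \<open>p\<close> of the triangle \<open>abc\<close> as a positive combination of \<open>a\<close>, \<open>b\<close>, \<open>c\<close> and
move from \<open>p\<close> away from \<open>r\<close>, until the first coefficient vanishes. This moment comes unless \<open>r\<close> has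
only nonpositive coefficients, that is, unless \<open>r\<close> is in the triangle. When it comes, it shows that
\<open>p\<close> is in the triangle of \<open>r\<close> and the two vertices that are left.\<close>

lemma empty_triangle_by_fan:
  assumes G: "G \<subseteq> I" "r \<in> G"
    and fan: "\<And>a b c. \<lbrakk>a \<in> G; b \<in> G; c \<in> G; distinct [a, b, c]; r \<in> {a, b, c}\<rbrakk> \<Longrightarrow> empty_triangle I ccw e a b c"
    and out: "\<And>a b c. \<lbrakk>a \<in> G - {r}; b \<in> G - {r}; c \<in> G - {r}; distinct [a, b, c]\<rbrakk> \<Longrightarrow> \<not> in_cell ccw e a b c r"
    and abc: "a \<in> G" "b \<in> G" "c \<in> G" "distinct [a, b, c]"
  shows "empty_triangle I ccw e a b c"
proof (rule ccontr)
  assume nc: "\<not> empty_triangle I ccw e a b c"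
  then have r: "r \<notin> {a, b, c}" using fan abc by blast
  obtain p where p: "p \<in> I" "p \<notin> {a, b, c}" "in_cell ccw e a b c p"
    using nc by (auto simp: empty_triangle_def)
  have pr: "p \<noteq> r" using p out abc r by blast
  have I: "a \<in> I" "b \<in> I" "c \<in> I" "r \<in> I" using G abc by auto
  define v where "v i = sgn_of (e i) *\<^sub>R w i" for i
  have dp: "distinct [a, b, c, p]" using abc p by auto
  obtain s x y z where s: "s \<noteq> 0" "x > 0" "y > 0" "z > 0"
    "s *\<^sub>R w p = x *\<^sub>R v a + y *\<^sub>R v b + z *\<^sub>R v c"
    using in_cellD[OF I(1-3) p(1) dp p(3)] unfolding v_def by metis
  let ?D = "det3 (w a) (w b) (w c)"
  define \<alpha> \<beta> \<gamma> where "\<alpha> = sgn_of (e r) * det3 (w r) (w b) (w c) / ?D * sgn_of (e a)"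
    and "\<beta> = sgn_of (e r) * det3 (w a) (w r) (w c) / ?D * sgn_of (e b)"
    and "\<gamma> = sgn_of (e r) * det3 (w a) (w b) (w r) / ?D * sgn_of (e c)"
  have D: "?D \<noteq> 0" using det_nz I abc by auto
  have nz: "\<alpha> \<noteq> 0" "\<beta> \<noteq> 0" "\<gamma> \<noteq> 0"
    using det_nz I abc r D by (auto simp: \<alpha>_def \<beta>_def \<gamma>_def)
  have vr: "v r = \<alpha> *\<^sub>R v a + \<beta> *\<^sub>R v b + \<gamma> *\<^sub>R v c"
  proof -
    have "v r = (sgn_of (e r) / ?D) *\<^sub>R (?D *\<^sub>R w r)" using D by (simp add: v_def)
    also have "\<dots> = (sgn_of (e r) / ?D) *\<^sub>R (det3 (w r) (w b) (w c) *\<^sub>R w a + det3 (w a) (w r) (w c) *\<^sub>R w b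
       + det3 (w a) (w b) (w r) *\<^sub>R w c)" by (subst cramer3) simp
    also have "\<dots> = \<alpha> *\<^sub>R v a + \<beta> *\<^sub>R v b + \<gamma> *\<^sub>R v c"
      by (simp add: v_def \<alpha>_def \<beta>_def \<gamma>_def scaleR_add_right mult.assoc)
    finally show ?thesis .
  qed
  define \<phi> where "\<phi> i = (if i = a then \<alpha> else if i = b then \<beta> else \<gamma>)" for i
  define \<xi> where "\<xi> i = (if i = a then x else if i = b then y else z)" for i
  have ph: "\<phi> a = \<alpha>" "\<phi> b = \<beta>" "\<phi> c = \<gamma>" using abc(4) by (auto simp: \<phi>_def)
  have x\<xi>: "\<xi> a = x" "\<xi> b = y" "\<xi> c = z" using abc(4) by (auto simp: \<xi>_def)
  define K where "K = {i \<in> {a, b, c}. \<phi> i > 0}"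
  have "K \<noteq> {}"
  proof
    assume "K = {}"
    then have "\<not> \<phi> a > 0" "\<not> \<phi> b > 0" "\<not> \<phi> c > 0" unfolding K_def by blast+
    then have neg: "\<alpha> < 0" "\<beta> < 0" "\<gamma> < 0" unfolding ph using nz by linarith+
    have "(- sgn_of (e r)) *\<^sub>R w r = (- \<alpha> * sgn_of (e a)) *\<^sub>R w a + (- \<beta> * sgn_of (e b)) *\<^sub>R w b + (- \<gamma> * sgn_of (e c)) *\<^sub>R w c"
      using vr by (simp add: v_def algebra_simps)
    then have "in_cell ccw e a b c r"
      using I abc r neg by (intro in_cellI[of a b c r "- sgn_of (e r)" "- \<alpha> * sgn_of (e a)" e "- \<beta> * sgn_of (e b)" "- \<gamma> * sgn_of (e c)"])
          (auto simp: mult.assoc)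
    then show False using out abc r by blast
  qed
  then obtain i where i: "i \<in> K" "\<And>j. j \<in> K \<Longrightarrow> \<xi> i / \<phi> i \<le> \<xi> j / \<phi> j"
  proof -
    have "finite K" by (simp add: K_def)
    then show ?thesis using \<open>K \<noteq> {}\<close> that arg_min_if_finite[of K "\<lambda>j. \<xi> j / \<phi> j"]
      by (meson linorder_not_less)
  qed
  define \<theta> where "\<theta> = \<xi> i / \<phi> i"
  have xi: "\<xi> j > 0" for j using s by (simp add: \<xi>_def)
  have th: "\<theta> > 0" using i(1) xi[of i] by (auto simp: \<theta>_def K_def)
  define q where "q j = (if j = r then \<theta> else \<xi> j - \<theta> * \<phi> j)" for j
  have qi: "q i = 0" using i(1) r by (auto simp: q_def \<theta>_def K_def)
  have qnn: "q j \<ge> 0" if "j \<in> {r, a, b, c}" for j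
  proof (cases "j = r")
    case True
    then show ?thesis using th by (simp add: q_def)
  next
    case False
    show ?thesis
    proof (cases "\<phi> j > 0")
      case True
      then have "j \<in> K" using that False by (auto simp: K_def)
      then show ?thesis using i(2)[of j] True False by (simp add: q_def \<theta>_def pos_le_divide_eq)
    next
      case f: False
      then have "\<theta> * \<phi> j \<le> 0" using th by (simp add: mult_le_0_iff)
      then show ?thesis using False xi[of j] by (simp add: q_def)
    qed
  qed
  have "s *\<^sub>R w p = \<theta> *\<^sub>R v r + (x - \<theta> * \<alpha>) *\<^sub>R v a + (y - \<theta> * \<beta>) *\<^sub>R v b + (z - \<theta> * \<gamma>) *\<^sub>R v c"
    unfolding s(5) vr by (simp add: algebra_simps)
  also have "\<dots> = (\<Sum>g\<in>{r, a, b, c}. (q g * sgn_of (e g)) *\<^sub>R w g)"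
    using abc(4) r by (auto simp: q_def ph x\<xi> v_def add.assoc)
  finally have eq: "s *\<^sub>R w p = (\<Sum>g\<in>{r, a, b, c}. (q g * sgn_of (e g)) *\<^sub>R w g)" .
  have "{r, a, b, c} \<subseteq> I - {p}" using I p pr by auto
  from conic_caratheodory[OF p(1) this s(1) eq]
  obtain a' b' d' x' y' z' where h: "a' \<in> {r, a, b, c}" "b' \<in> {r, a, b, c}" "d' \<in> {r, a, b, c}"
      "a' \<noteq> b'" "a' \<noteq> d'" "b' \<noteq> d'"
      "x' * (q a' * sgn_of (e a')) > 0" "y' * (q b' * sgn_of (e b')) > 0" "z' * (q d' * sgn_of (e d')) > 0"
      "s *\<^sub>R w p = x' *\<^sub>R w a' + y' *\<^sub>R w b' + z' *\<^sub>R w d'" by blast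
  have "i \<notin> {a', b', d'}" using h qi by auto
  moreover have "i \<in> {a, b, c}" using i by (auto simp: K_def)
  ultimately have "r \<in> {a', b', d'}" using h(1-6) abc(4) by auto
  then have cl: "empty_triangle I ccw e a' b' d'" using h abc G by (intro fan) auto
  have pos: "u * sgn_of (e j) > 0" if "u * (q j * sgn_of (e j)) > 0" "j \<in> {r, a, b, c}" for u j
    using that qnn[OF that(2)]
    by (metis mult.left_commute mult_eq_0_iff order_le_less zero_less_mult_pos less_irrefl)
  have "in_cell ccw e a' b' d' p"
    by (rule in_cellI[OF _ _ _ p(1) _ s(1) pos[OF h(7,1)] pos[OF h(8,2)] pos[OF h(9,3)] h(10)])
      (use h I p pr in auto)
  then show False using cl p h pr by (auto simp: empty_triangle_def)
qed

definition signed_family :: "'i set \<Rightarrow> 'i \<Rightarrow> real^3" where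
  "signed_family A i = sgn_of (i \<in> A) *\<^sub>R w i"

text \<open>All geometric properties of the region of a signed hole follow from this: for a vertex \<open>p\<close> it is
strict convex position, and for another point \<open>p\<close> of the family it says that \<open>p\<close> is outside of the
region.\<close>

lemma signed_hole_not_in_cone:
  assumes h: "(A, B) \<in> signed_holes k I ccw" and "p \<in> I" "s \<noteq> 0"
  shows "s *\<^sub>R w p \<notin> cone_of (A \<union> B - {p}) (signed_family A)"
proof
  assume "s *\<^sub>R w p \<in> cone_of (A \<union> B - {p}) (signed_family A)"
  then obtain c where c: "\<forall>g\<in>A \<union> B - {p}. 0 \<le> c g"
      "s *\<^sub>R w p = (\<Sum>g\<in>A \<union> B - {p}. (c g * sgn_of (g \<in> A)) *\<^sub>R w g)"
    unfolding cone_of_def signed_family_def by auto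
  have sub: "A \<union> B - {p} \<subseteq> I - {p}" using h by (auto simp: signed_holes_def)
  obtain a b d x y z where
    abd: "a \<in> A \<union> B - {p}" "b \<in> A \<union> B - {p}" "d \<in> A \<union> B - {p}" "a \<noteq> b" "a \<noteq> d" "b \<noteq> d"
    "x * (c a * sgn_of (a \<in> A)) > 0" "y * (c b * sgn_of (b \<in> A)) > 0" "z * (c d * sgn_of (d \<in> A)) > 0"
    "s *\<^sub>R w p = x *\<^sub>R w a + y *\<^sub>R w b + z *\<^sub>R w d"
    using conic_caratheodory[OF assms(2) sub assms(3) c(2)] by blast
  have pos: "u * sgn_of (j \<in> A) > 0" if "u * (c j * sgn_of (j \<in> A)) > 0" "j \<in> A \<union> B - {p}" for u j
    using that c(1)
    by (metis mult.left_commute mult_eq_0_iff order_le_less zero_less_mult_pos less_irrefl)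
  have "in_cell ccw (\<lambda>i. i \<in> A) a b d p"
    by (rule in_cellI[OF _ _ _ assms(2) _ assms(3) pos[OF abd(7,1)] pos[OF abd(8,2)] pos[OF abd(9,3)] abd(10)])
      (use abd sub in auto)
  moreover have "empty_triangle I ccw (\<lambda>i. i \<in> A) a b d"
    using h abd(1-6) unfolding signed_holes_def by blast
  ultimately show False using assms(2) abd(1-3) by (auto simp: empty_triangle_def)
qed

end

section \<open>Convex sets and segments in affine charts of the projective plane\<close>

lemma rp2_of_scale: "c \<noteq> 0 \<Longrightarrow> rp2_of (c *\<^sub>R v) = rp2_of v"
proof -
  assume c: "c \<noteq> 0"
  have "span {c *\<^sub>R v} = span {v}"
  proof (rule span_eq[THEN iffD2], intro conjI)
    show "{c *\<^sub>R v} \<subseteq> span {v}" by (simp add: span_base span_scale)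
    have "v = (1 / c) *\<^sub>R (c *\<^sub>R v)" using c by simp
    then show "{v} \<subseteq> span {c *\<^sub>R v}" by (metis empty_subsetI insert_subset span_base span_scale singletonI)
  qed
  then show ?thesis by (simp add: rp2_of_def)
qed

lemma Rep_rp2_of: "v \<noteq> 0 \<Longrightarrow> Rep_rp2 (rp2_of v) = span {v}"
  by (simp add: rp2_of_def Abs_rp2_inverse)

lemma rp2_of_eqD:
  assumes "rp2_of u = rp2_of v" "u \<noteq> 0" "v \<noteq> 0"
  obtains c where "c \<noteq> 0" "v = c *\<^sub>R u"
proof -
  have "v \<in> span {u}" using assms by (metis Rep_rp2_of insertI1 span_base)
  then obtain c where "v = c *\<^sub>R u" by (auto simp: span_singleton)
  then show ?thesis using assms that by auto
qed

lemma rp2_of_surj: obtains v where "v \<noteq> 0" "p = rp2_of v"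
proof -
  have R: "subspace (Rep_rp2 p)" "dim (Rep_rp2 p) = 1" using Rep_rp2[of p] by auto
  have "\<not> Rep_rp2 p \<subseteq> {0}" using R(2) by (metis dim_eq_0 zero_neq_one)
  then obtain v where v: "v \<in> Rep_rp2 p" "v \<noteq> 0" by blast
  have "span {v} = Rep_rp2 p"
    by (rule subspace_dim_equal) (use v R in \<open>auto simp: span_minimal\<close>)
  then have "p = rp2_of v" by (metis rp2_of_def Rep_rp2_inverse)
  then show ?thesis using v that by blast
qed

definition plane_of :: "real^3 \<Rightarrow> rp2 set" where
  "plane_of u = {rp2_of v | v. u \<bullet> v \<noteq> 0}"

lemma plane_of_iff: "v \<noteq> 0 \<Longrightarrow> rp2_of v \<in> plane_of u \<longleftrightarrow> u \<bullet> v \<noteq> 0"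
proof
  assume v: "v \<noteq> 0" and "rp2_of v \<in> plane_of u"
  then obtain x where x: "rp2_of x = rp2_of v" "u \<bullet> x \<noteq> 0" unfolding plane_of_def by force
  then obtain c where "c \<noteq> 0" "v = c *\<^sub>R x" using v by (metis inner_zero_right rp2_of_eqD)
  then show "u \<bullet> v \<noteq> 0" using x by simp
qed (auto simp: plane_of_def)

lemma rp2_plane_iff: "rp2_plane \<rho> \<longleftrightarrow> (\<exists>u. u \<noteq> 0 \<and> \<rho> = plane_of u)"
proof -
  have eq: "- {p. Rep_rp2 p \<subseteq> {x. u \<bullet> x = 0}} = plane_of u" for u :: "real^3"
  proof -
    have "Rep_rp2 p \<subseteq> {x. u \<bullet> x = 0} \<longleftrightarrow> p \<notin> plane_of u" for p
    proof -
      obtain v where v: "v \<noteq> 0" "p = rp2_of v" by (rule rp2_of_surj)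
      have "span {v} \<subseteq> {x. u \<bullet> x = 0} \<longleftrightarrow> u \<bullet> v = 0"
      proof
        assume "span {v} \<subseteq> {x. u \<bullet> x = 0}"
        then show "u \<bullet> v = 0" using span_base[of v "{v}"] by blast
      next
        assume "u \<bullet> v = 0"
        then show "span {v} \<subseteq> {x. u \<bullet> x = 0}" by (intro span_minimal subspace_hyperplane) simp
      qed
      then show ?thesis using v by (simp add: Rep_rp2_of plane_of_iff)
    qed
    then show ?thesis by blast
  qed
  show ?thesis
  proof
    assume "rp2_plane \<rho>"
    then obtain W where W: "subspace W" "dim W = 2" "\<rho> = - {p. Rep_rp2 p \<subseteq> W}"
      by (auto simp: rp2_plane_def rp2_line_def)
    have "dim W = DIM(real^3) - 1" using W(2) by simp
    then obtain u where "u \<noteq> 0" "span W = {x. u \<bullet> x = 0}" by (rule lowdim_eq_hyperplane)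
    moreover have "span W = W" using W(1) by (simp add: span_eq_iff)
    ultimately show "\<exists>u. u \<noteq> 0 \<and> \<rho> = plane_of u" using W(3) eq by metis
  next
    assume "\<exists>u. u \<noteq> 0 \<and> \<rho> = plane_of u"
    then obtain u where u: "u \<noteq> 0" "\<rho> = plane_of u" by blast
    have "subspace {x. u \<bullet> x = 0}" by (rule subspace_hyperplane)
    moreover have "dim {x. u \<bullet> x = 0} = 2" using dim_hyperplane[OF u(1)] by simp
    ultimately show "rp2_plane \<rho>" unfolding rp2_plane_def rp2_line_def u(2) eq[symmetric] by blast
  qed
qed

text \<open>The representatives on which the linear form of \<open>u\<close> has the value 1 form an affine plane, on which
\<^const>\<open>rp2_of\<close> is injective and whose image is the Euclidean plane of \<open>u\<close>.\<close>

definition chart :: "real^3 \<Rightarrow> rp2 set \<Rightarrow> (real^3) set" where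
  "chart u X = {v. u \<bullet> v = 1 \<and> rp2_of v \<in> X}"

lemma rp2_of_chart: assumes "X \<subseteq> plane_of u" shows "rp2_of ` chart u X = X"
proof
  show "X \<subseteq> rp2_of ` chart u X"
  proof
    fix p assume p: "p \<in> X"
    then obtain v where v: "p = rp2_of v" "u \<bullet> v \<noteq> 0" using assms by (auto simp: plane_of_def)
    have "p = rp2_of ((1 / (u \<bullet> v)) *\<^sub>R v)" using v by (subst rp2_of_scale) auto
    moreover have "(1 / (u \<bullet> v)) *\<^sub>R v \<in> chart u X"
      using p v calculation by (auto simp: chart_def)
    ultimately show "p \<in> rp2_of ` chart u X" by blast
  qed
qed (auto simp: chart_def)

text \<open>Two points are joined by two segments, but only one of them stays in a given Euclidean plane: if
the representatives at the ends have values of different sign, then the linear form vanishes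
somewhere in between.\<close>

lemma rp2_segment_in_plane:
  assumes S: "rp2_segment (rp2_of a) (rp2_of b) S" "S \<subseteq> plane_of u" and ab: "u \<bullet> a = 1" "u \<bullet> b = 1"
  shows "rp2_of ` closed_segment a b \<subseteq> S"
proof -
  obtain a' b' where S': "rp2_of a = rp2_of a'" "rp2_of b = rp2_of b'" "0 \<notin> closed_segment a' b'"
      "S = rp2_of ` closed_segment a' b'"
    using S(1) by (auto simp: rp2_segment_def)
  have nz: "a \<noteq> 0" "b \<noteq> 0" "a' \<noteq> 0" "b' \<noteq> 0" using ab S'(3) by auto
  obtain s where s: "s \<noteq> 0" "a' = s *\<^sub>R a" using rp2_of_eqD[OF S'(1) nz(1,3)] by blast
  obtain t where t: "t \<noteq> 0" "b' = t *\<^sub>R b" using rp2_of_eqD[OF S'(2) nz(2,4)] by blast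
  have "s * t > 0"
  proof (rule ccontr)
    assume "\<not> s * t > 0"
    then have st: "(s < 0 \<and> t > 0) \<or> (s > 0 \<and> t < 0)"
      using s(1) t(1) by (simp add: zero_less_mult_iff not_less) linarith
    define l where "l = s / (s - t)"
    have d: "s - t \<noteq> 0" using st by auto
    have l: "0 \<le> l" "l \<le> 1" using st by (auto simp: l_def divide_simps)
    have z: "(1 - l) * s + l * t = 0" using d by (simp add: l_def field_simps)
    let ?x = "(1 - l) *\<^sub>R a' + l *\<^sub>R b'"
    have x: "?x \<in> closed_segment a' b'" using l by (auto simp: closed_segment_def)
    then have "rp2_of ?x \<in> plane_of u" "?x \<noteq> 0" using S(2) S'(3,4) by auto
    then have "u \<bullet> ?x \<noteq> 0" by (simp add: plane_of_iff)
    then show False using z ab s t by (simp add: inner_add_right)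
  qed
  show ?thesis
  proof
    fix p assume "p \<in> rp2_of ` closed_segment a b"
    then obtain m where m: "0 \<le> m" "m \<le> 1" "p = rp2_of ((1 - m) *\<^sub>R a + m *\<^sub>R b)"
      by (auto simp: closed_segment_def)
    define d where "d = (1 - m) * t + m * s"
    have d: "d \<noteq> 0"
    proof -
      have "d * s = (1 - m) * (s * t) + m * (s * s)" by (simp add: d_def algebra_simps)
      moreover have "s * s > 0" using s(1) not_real_square_gt_zero by blast
      ultimately have "d * s > 0" using \<open>s * t > 0\<close> m
        by (smt (verit) mult_nonneg_nonneg mult_pos_pos)
      then show ?thesis by auto
    qed
    define l where "l = m * s / d"
    have l1: "1 - l = (1 - m) * t / d" using d by (simp add: l_def d_def field_simps)
    have "0 \<le> l" "0 \<le> 1 - l"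
      unfolding l1 unfolding l_def d_def using \<open>s * t > 0\<close> m
      by (auto simp: zero_less_mult_iff zero_le_mult_iff zero_le_divide_iff
          add_nonneg_nonneg add_nonpos_nonpos mult_nonneg_nonpos)
    then have "(1 - l) *\<^sub>R a' + l *\<^sub>R b' \<in> closed_segment a' b'" by (auto simp: closed_segment_def)
    moreover have "(1 - l) *\<^sub>R a' + l *\<^sub>R b' = (s * t / d) *\<^sub>R ((1 - m) *\<^sub>R a + m *\<^sub>R b)"
      unfolding l1 unfolding l_def s(2) t(2) by (simp add: scaleR_add_right mult_ac)
    moreover have "s * t / d \<noteq> 0" using s t d by simp
    ultimately show "p \<in> S" unfolding m(3) S'(4) by (metis image_eqI rp2_of_scale)
  qed
qed

text \<open>Consequently projective and affine convexity agree inside one Euclidean plane.\<close>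

lemma rp2_semiconvex_iff_chart:
  assumes X: "X \<subseteq> plane_of u"
  shows "rp2_semiconvex X \<longleftrightarrow> convex (chart u X)"
proof
  assume sc: "rp2_semiconvex X"
  show "convex (chart u X)"
    unfolding convex_contains_segment
  proof (intro ballI subsetI)
    fix a b x assume ab: "a \<in> chart u X" "b \<in> chart u X" and x: "x \<in> closed_segment a b"
    then have "rp2_of a \<in> X" "rp2_of b \<in> X" by (simp_all add: chart_def)
    then obtain S where S: "rp2_segment (rp2_of a) (rp2_of b) S" "S \<subseteq> X"
      using sc unfolding rp2_semiconvex_def by blast
    have "rp2_of x \<in> X"
      using rp2_segment_in_plane[OF S(1)] S(2) X ab x by (auto simp: chart_def)
    moreover have "u \<bullet> x = 1"
      using ab x by (auto simp: chart_def closed_segment_def inner_add_right)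
    ultimately show "x \<in> chart u X" by (simp add: chart_def)
  qed
next
  assume cv: "convex (chart u X)"
  show "rp2_semiconvex X"
    unfolding rp2_semiconvex_def
  proof (intro ballI)
    fix p q assume "p \<in> X" "q \<in> X"
    then obtain a b where ab: "a \<in> chart u X" "p = rp2_of a" "b \<in> chart u X" "q = rp2_of b"
      using rp2_of_chart[OF X] by blast
    then have sub: "closed_segment a b \<subseteq> chart u X" using cv by (simp add: convex_contains_segment)
    then have "0 \<notin> closed_segment a b" by (auto simp: chart_def)
    then have "rp2_segment p q (rp2_of ` closed_segment a b)" using ab by (auto simp: rp2_segment_def)
    moreover have "rp2_of ` closed_segment a b \<subseteq> X" using sub by (auto simp: chart_def)
    ultimately show "\<exists>S. rp2_segment p q S \<and> S \<subseteq> X" by blast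
  qed
qed

section \<open>Projective convex hulls are images of cones\<close>

lemma cone_of_generator: "finite G \<Longrightarrow> g \<in> G \<Longrightarrow> v g \<in> cone_of G v"
proof -
  assume "finite G" "g \<in> G"
  then have "v g = (\<Sum>h\<in>G. (if h = g then 1 else 0) *\<^sub>R v h)"
    by (simp add: if_distrib[of "\<lambda>c. c *\<^sub>R _"] sum.delta cong: if_cong)
  then show ?thesis unfolding cone_of_def by (intro CollectI exI[of _ "\<lambda>h. if h = g then 1 else 0"]) auto
qed

lemma cone_of_add: "x \<in> cone_of G v \<Longrightarrow> y \<in> cone_of G v \<Longrightarrow> x + y \<in> cone_of G v"
  unfolding cone_of_def
proof clarify
  fix c d :: "'a \<Rightarrow> real" assume "\<forall>g\<in>G. 0 \<le> c g" "\<forall>g\<in>G. 0 \<le> d g"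
  then show "\<exists>e. (\<forall>g\<in>G. 0 \<le> e g) \<and> (\<Sum>g\<in>G. c g *\<^sub>R v g) + (\<Sum>g\<in>G. d g *\<^sub>R v g) = (\<Sum>g\<in>G. e g *\<^sub>R v g)"
    by (intro exI[of _ "\<lambda>g. c g + d g"]) (simp add: sum.distrib scaleR_add_left)
qed

lemma cone_of_scale: "x \<in> cone_of G v \<Longrightarrow> 0 \<le> r \<Longrightarrow> r *\<^sub>R x \<in> cone_of G v"
  unfolding cone_of_def
proof clarify
  fix c :: "'a \<Rightarrow> real" assume "\<forall>g\<in>G. 0 \<le> c g" "0 \<le> r"
  then show "\<exists>d. (\<forall>g\<in>G. 0 \<le> d g) \<and> r *\<^sub>R (\<Sum>g\<in>G. c g *\<^sub>R v g) = (\<Sum>g\<in>G. d g *\<^sub>R v g)"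
    by (intro exI[of _ "\<lambda>g. r * c g"]) (simp add: scaleR_sum_right)
qed

lemma cone_of_positive:
  assumes "x \<in> cone_of G v" "x \<noteq> 0" "\<And>g. g \<in> G \<Longrightarrow> u \<bullet> v g > 0" shows "u \<bullet> x > 0"
proof -
  obtain c where c: "\<forall>g\<in>G. 0 \<le> c g" "x = (\<Sum>g\<in>G. c g *\<^sub>R v g)" using assms(1) by (auto simp: cone_of_def)
  have ux: "u \<bullet> x = (\<Sum>g\<in>G. c g * (u \<bullet> v g))" by (simp add: c(2) inner_sum_right)
  have fin: "finite G" using assms(2) c(2) by (metis sum.infinite)
  obtain g where g: "g \<in> G" "c g \<noteq> 0"
  proof (rule ccontr)
    assume "\<not> thesis"
    then have "\<And>g. g \<in> G \<Longrightarrow> c g = 0" using that by blast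
    then show False using assms(2) c(2) by simp
  qed
  have "0 < c g * (u \<bullet> v g)" using g c(1) assms(3)[OF g(1)] by (simp add: order_less_le)
  moreover have "0 \<le> c h * (u \<bullet> v h)" if "h \<in> G" for h
    using that c(1) assms(3)[OF that] by simp
  ultimately show ?thesis unfolding ux using fin g(1) by (intro sum_pos2) auto
qed

lemma convex_cone_of: "convex (cone_of G v)"
  by (auto simp: convex_def intro!: cone_of_add cone_of_scale)

definition proj_cone :: "'i set \<Rightarrow> ('i \<Rightarrow> real^3) \<Rightarrow> rp2 set" where
  "proj_cone G v = rp2_of ` (cone_of G v - {0})"

lemma proj_coneD:
  assumes "rp2_of x \<in> proj_cone G v" "x \<noteq> 0"
  obtains "x \<in> cone_of G v" | "- x \<in> cone_of G v"
proof -
  obtain y where y: "y \<in> cone_of G v" "y \<noteq> 0" "rp2_of y = rp2_of x"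
    using assms(1) by (force simp: proj_cone_def)
  obtain c where c: "c \<noteq> 0" "x = c *\<^sub>R y" using rp2_of_eqD[OF y(3,2) assms(2)] by blast
  show ?thesis
  proof (cases "c > 0")
    case True
    then show ?thesis using cone_of_scale[OF y(1), of c] c that by auto
  next
    case False
    then show ?thesis using cone_of_scale[OF y(1), of "- c"] c that by auto
  qed
qed

context
  fixes G :: "'i set" and v :: "'i \<Rightarrow> real^3" and u :: "real^3"
  assumes fin: "finite G" and pos: "\<And>g. g \<in> G \<Longrightarrow> u \<bullet> v g > 0"
begin

lemma proj_cone_in_plane: "proj_cone G v \<subseteq> plane_of u"
  using cone_of_positive[OF _ _ pos] by (fastforce simp: proj_cone_def plane_of_def)

lemma proj_cone_positive:
  assumes "rp2_of x \<in> proj_cone G v" "u \<bullet> x > 0" shows "x \<in> cone_of G v"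
proof -
  have "x \<noteq> 0" using assms(2) by auto
  with assms(1) show ?thesis
  proof (cases rule: proj_coneD)
    case 2
    then have "u \<bullet> (- x) > 0" using cone_of_positive[OF _ _ pos] \<open>x \<noteq> 0\<close> by force
    then show ?thesis using assms(2) by simp
  qed
qed

lemma chart_proj_cone: "chart u (proj_cone G v) = cone_of G v \<inter> {x. u \<bullet> x = 1}"
proof (intro set_eqI iffI)
  fix x assume "x \<in> chart u (proj_cone G v)"
  then show "x \<in> cone_of G v \<inter> {x. u \<bullet> x = 1}" using proj_cone_positive[of x] by (simp add: chart_def)
next
  fix x assume x: "x \<in> cone_of G v \<inter> {x. u \<bullet> x = 1}"
  then have "x \<noteq> 0" by auto
  then show "x \<in> chart u (proj_cone G v)" using x by (simp add: chart_def proj_cone_def)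
qed

lemma generators_in_proj_cone: "rp2_of ` v ` G \<subseteq> proj_cone G v"
proof
  fix p assume "p \<in> rp2_of ` v ` G"
  then obtain g where g: "g \<in> G" "p = rp2_of (v g)" by blast
  then have "v g \<noteq> 0" using pos[of g] by auto
  then show "p \<in> proj_cone G v" using g cone_of_generator[OF fin, of g v] by (simp add: proj_cone_def)
qed

lemma rp2_convex_proj_cone: assumes "u \<noteq> 0" shows "rp2_convex (proj_cone G v)"
proof -
  have "convex (chart u (proj_cone G v))"
    unfolding chart_proj_cone by (intro convex_Int convex_cone_of convex_hyperplane)
  then show ?thesis
    using proj_cone_in_plane assms rp2_semiconvex_iff_chart rp2_plane_iff
    unfolding rp2_convex_def by blast
qed

text \<open>Rescaling the generators into the chart turns the coefficients of a point of the cone into those of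
a convex combination. This is the minimality that makes the image of the cone a convex hull.\<close>

lemma proj_cone_subset_semiconvex:
  assumes "rp2_semiconvex D" "D \<subseteq> plane_of u" "rp2_of ` v ` G \<subseteq> D"
  shows "proj_cone G v \<subseteq> D"
proof
  fix p assume "p \<in> proj_cone G v"
  then obtain x where x: "x \<in> chart u (proj_cone G v)" "p = rp2_of x"
    using rp2_of_chart[OF proj_cone_in_plane] by blast
  then obtain c where c: "\<forall>g\<in>G. 0 \<le> c g" "x = (\<Sum>g\<in>G. c g *\<^sub>R v g)" and ux: "u \<bullet> x = 1"
    unfolding chart_proj_cone by (auto simp: cone_of_def)
  define y where "y g = (1 / (u \<bullet> v g)) *\<^sub>R v g" for g
  have "y g \<in> chart u D" if "g \<in> G" for g
  proof -
    have nz: "u \<bullet> v g \<noteq> 0" using pos[OF that] by simp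
    then have "rp2_of (y g) = rp2_of (v g)" unfolding y_def by (intro rp2_of_scale) simp
    then show ?thesis using nz assms(3) that by (auto simp: chart_def y_def)
  qed
  moreover have "convex (chart u D)" using assms rp2_semiconvex_iff_chart by blast
  moreover have "(\<Sum>g\<in>G. c g * (u \<bullet> v g)) = 1" using ux unfolding c(2) by (simp add: inner_sum_right)
  ultimately have "(\<Sum>g\<in>G. (c g * (u \<bullet> v g)) *\<^sub>R y g) \<in> chart u D"
    using c(1) pos fin by (intro convex_sum) (auto intro!: mult_nonneg_nonneg simp: less_imp_le)
  also have "(\<Sum>g\<in>G. (c g * (u \<bullet> v g)) *\<^sub>R y g) = x"
    unfolding c(2) by (intro sum.cong refl) (use pos in \<open>force simp: y_def\<close>)
  finally show "p \<in> D" using x(2) by (simp add: chart_def)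
qed

lemma rp2_convex_hull_proj_cone:
  assumes "u \<noteq> 0" shows "rp2_convex_hull (rp2_of ` v ` G) (proj_cone G v)"
  unfolding rp2_convex_hull_def
proof (intro conjI allI impI)
  show "rp2_convex (proj_cone G v)" by (rule rp2_convex_proj_cone[OF assms])
  show "rp2_of ` v ` G \<subseteq> proj_cone G v" by (rule generators_in_proj_cone)
  fix D assume D: "rp2_convex D \<and> rp2_of ` v ` G \<subseteq> D \<and> D \<subseteq> proj_cone G v"
  then have "D \<subseteq> plane_of u" using proj_cone_in_plane by (meson order_trans)
  with D have "proj_cone G v \<subseteq> D"
    by (intro proj_cone_subset_semiconvex) (auto simp: rp2_convex_def)
  with D show "D = proj_cone G v" by blast
qed

end

text \<open>The sign of a vertex is the sign of its vector under a linear form whose Euclidean plane contains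
the hull, so every projective convex hull comes from a choice of signs.\<close>

lemma rp2_convex_hullD:
  assumes hull: "rp2_convex_hull (rp2_of ` w ` G) C" and G: "finite G" "\<And>g. g \<in> G \<Longrightarrow> w g \<noteq> 0"
  obtains u where "u \<noteq> 0" "\<And>g. g \<in> G \<Longrightarrow> u \<bullet> w g \<noteq> 0"
    "C = proj_cone G (\<lambda>g. sgn_of (u \<bullet> w g > 0) *\<^sub>R w g)"
proof -
  obtain u where u: "u \<noteq> 0" "C \<subseteq> plane_of u" "rp2_semiconvex C" "rp2_of ` w ` G \<subseteq> C"
    using hull by (auto simp: rp2_convex_hull_def rp2_convex_def rp2_plane_iff)
  have nz: "u \<bullet> w g \<noteq> 0" if "g \<in> G" for g
    using u(2,4) that G(2)[OF that] plane_of_iff by (metis imageI subset_eq)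
  define v where "v g = sgn_of (u \<bullet> w g > 0) *\<^sub>R w g" for g
  have pos: "u \<bullet> v g > 0" if "g \<in> G" for g
    using nz[OF that] by (simp add: v_def sgn_of_def)
  have same: "rp2_of ` v ` G = rp2_of ` w ` G"
    by (auto simp: v_def rp2_of_scale image_image)
  have "proj_cone G v \<subseteq> C"
    using proj_cone_subset_semiconvex[OF G(1) pos u(3,2)] u(4) same by simp
  moreover have "rp2_convex (proj_cone G v)" by (rule rp2_convex_proj_cone[OF G(1) pos u(1)])
  moreover have "rp2_of ` w ` G \<subseteq> proj_cone G v"
    using generators_in_proj_cone[of G u v, OF G(1) pos] same by simp
  ultimately have "C = proj_cone G v" using hull unfolding rp2_convex_hull_def by metis
  then show ?thesis using that u(1) nz unfolding v_def by blast
qed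

section \<open>Interior and frontier of projective cones\<close>

lemma continuous_on_det3:
  "continuous_on UNIV (\<lambda>q. det3 q b c)" "continuous_on UNIV (\<lambda>q. det3 a q c)"
  "continuous_on UNIV (\<lambda>q. det3 a b q)"
  unfolding det3_expand by (intro continuous_intros)+

lemma open_rp2_of_image:
  assumes Q: "open Q" and cone: "\<And>x r. x \<in> Q \<Longrightarrow> 0 < r \<Longrightarrow> r *\<^sub>R x \<in> Q" and "0 \<notin> Q"
  shows "open (rp2_of ` Q)"
proof -
  have "{v. v \<noteq> 0 \<and> rp2_of v \<in> rp2_of ` Q} = Q \<union> uminus ` Q"
  proof (intro set_eqI iffI)
    fix v assume "v \<in> {v. v \<noteq> 0 \<and> rp2_of v \<in> rp2_of ` Q}"
    then obtain x where x: "v \<noteq> 0" "rp2_of x = rp2_of v" "x \<in> Q" by force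
    then have "x \<noteq> 0" using assms(3) by auto
    then obtain c where c: "c \<noteq> 0" "v = c *\<^sub>R x" using rp2_of_eqD x by metis
    show "v \<in> Q \<union> uminus ` Q"
    proof (cases "c > 0")
      case True
      then show ?thesis using c cone x by auto
    next
      case False
      then have "- v \<in> Q" using c cone[OF x(3), of "- c"] by auto
      then show ?thesis by (metis UnI2 add.inverse_inverse imageI)
    qed
  next
    fix v assume "v \<in> Q \<union> uminus ` Q"
    then show "v \<in> {v. v \<noteq> 0 \<and> rp2_of v \<in> rp2_of ` Q}"
      using assms(3) rp2_of_scale[of "-1"] by auto
  qed
  then show ?thesis using Q unfolding open_rp2_def by (metis open_Un open_negations)
qed

text \<open>The interior of the cone of three independent vectors is described by strict inequalities between
determinants, hence its image is open in the quotient topology.\<close>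

lemma triple_in_interior:
  assumes "finite G" "a \<in> G" "b \<in> G" "c \<in> G" and D: "det3 (v a) (v b) (v c) \<noteq> 0"
    and xyz: "x > 0" "y > 0" "z > 0"
  shows "rp2_of (x *\<^sub>R v a + y *\<^sub>R v b + z *\<^sub>R v c) \<in> interior (proj_cone G v)"
proof -
  let ?D = "det3 (v a) (v b) (v c)"
  define Q where "Q = {q. 0 < det3 q (v b) (v c) * ?D} \<inter> {q. 0 < det3 (v a) q (v c) * ?D}
    \<inter> {q. 0 < det3 (v a) (v b) q * ?D}"
  have "open Q"
    unfolding Q_def
    by (intro open_Int open_Collect_less continuous_intros continuous_on_det3)
  moreover have "r *\<^sub>R q \<in> Q" if "q \<in> Q" "0 < r" for q r
    using that by (auto simp: Q_def det3_linear mult.assoc)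
  moreover have "0 \<notin> Q" by (simp add: Q_def)
  ultimately have "open (rp2_of ` Q)" by (rule open_rp2_of_image)
  moreover have "rp2_of ` Q \<subseteq> proj_cone G v"
  proof
    fix p assume "p \<in> rp2_of ` Q"
    then obtain q where q: "q \<in> Q" "p = rp2_of q" by blast
    have coef: "0 \<le> d / ?D" if "0 < d * ?D" for d
      using that by (auto simp: zero_less_mult_iff zero_le_divide_iff)
    have "q = (1 / ?D) *\<^sub>R (?D *\<^sub>R q)" using D by simp
    also have "\<dots> = (det3 q (v b) (v c) / ?D) *\<^sub>R v a + (det3 (v a) q (v c) / ?D) *\<^sub>R v b
        + (det3 (v a) (v b) q / ?D) *\<^sub>R v c"
      by (subst cramer3) (simp add: scaleR_add_right)
    also have "\<dots> \<in> cone_of G v"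
      using assms(1-4) q(1) by (intro cone_of_add cone_of_scale cone_of_generator coef) (auto simp: Q_def)
    finally have "q \<in> cone_of G v" .
    moreover have "q \<noteq> 0" using q \<open>0 \<notin> Q\<close> by auto
    ultimately show "p \<in> proj_cone G v" using q(2) by (auto simp: proj_cone_def)
  qed
  moreover have "x *\<^sub>R v a + y *\<^sub>R v b + z *\<^sub>R v c \<in> Q"
  proof -
    have "0 < ?D * ?D" using D by (auto simp: zero_less_mult_iff)
    then show ?thesis using xyz by (simp add: Q_def det3_linear mult.assoc)
  qed
  ultimately show ?thesis by (intro interiorI) auto
qed

text \<open>If one can move from a generator \<open>g\<close> away from another generator and stay in the cone, then solving
for \<open>g\<close> shows that \<open>g\<close> is a positive combination of the other generators. The linear form \<open>u\<close>
guarantees that the coefficient left on \<open>g\<close> is positive.\<close>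

lemma generator_splitD:
  assumes G: "finite G" "\<And>g. g \<in> G \<Longrightarrow> u \<bullet> v g > 0" "g \<in> G" "h \<in> G" "h \<noteq> g"
    and t: "t > 0" and mem: "v g - t *\<^sub>R v h \<in> cone_of G v"
  obtains s where "s > 0" "s *\<^sub>R v g \<in> cone_of (G - {g}) v"
proof -
  have vg: "u \<bullet> v g > 0" using G by blast
  obtain c where c: "\<forall>k\<in>G. 0 \<le> c k" "v g - t *\<^sub>R v h = (\<Sum>k\<in>G. c k *\<^sub>R v k)"
    using mem by (auto simp: cone_of_def)
  have "(\<Sum>k\<in>G. c k *\<^sub>R v k) = c g *\<^sub>R v g + (\<Sum>k\<in>G - {g}. c k *\<^sub>R v k)"
    using G(1,3) by (simp add: sum.remove)
  then have eq: "(1 - c g) *\<^sub>R v g = t *\<^sub>R v h + (\<Sum>k\<in>G - {g}. c k *\<^sub>R v k)"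
    using c(2) by (simp add: algebra_simps)
  have mem': "(\<Sum>k\<in>G - {g}. c k *\<^sub>R v k) \<in> cone_of (G - {g}) v"
    using c(1) by (auto simp: cone_of_def)
  have rhs: "t *\<^sub>R v h + (\<Sum>k\<in>G - {g}. c k *\<^sub>R v k) \<in> cone_of (G - {g}) v"
    using G t mem' by (intro cone_of_add cone_of_scale cone_of_generator) auto
  have "0 < u \<bullet> (t *\<^sub>R v h) + (\<Sum>k\<in>G - {g}. c k * (u \<bullet> v k))"
    using G t c(1) by (intro add_pos_nonneg sum_nonneg) (auto intro!: mult_nonneg_nonneg intro: less_imp_le)
  also have "\<dots> = u \<bullet> ((1 - c g) *\<^sub>R v g)"
    unfolding eq by (simp add: inner_add_right inner_sum_right)
  finally have "1 - c g > 0" using vg by (simp add: zero_less_mult_iff)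
  then show ?thesis using that eq rhs by metis
qed

lemma interior_generatorD:
  assumes G: "finite G" "\<And>g. g \<in> G \<Longrightarrow> u \<bullet> v g > 0" "g \<in> G" "h \<in> G" "h \<noteq> g"
    and int: "rp2_of (v g) \<in> interior (proj_cone G v)"
  obtains s where "s > 0" "s *\<^sub>R v g \<in> cone_of (G - {g}) v"
proof -
  obtain T where T: "open T" "rp2_of (v g) \<in> T" "T \<subseteq> proj_cone G v" using int by (auto elim: interiorE)
  define Q where "Q = {x. x \<noteq> 0 \<and> rp2_of x \<in> T} \<inter> {x. 0 < u \<bullet> x}"
  have vg: "u \<bullet> v g > 0" using G by blast
  have "open Q" unfolding Q_def using T(1)
    by (intro open_Int open_Collect_less continuous_intros) (simp add: open_rp2_def)
  moreover have "v g \<in> Q" using T(2) vg by (auto simp: Q_def)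
  moreover have "continuous (at 0) (\<lambda>t::real. v g - t *\<^sub>R v h)" by (intro continuous_intros)
  ultimately have "\<forall>\<^sub>F t in at 0. v g - t *\<^sub>R v h \<in> Q"
    unfolding continuous_within by (intro topological_tendstoD) auto
  then have "\<forall>\<^sub>F t in at_right 0. v g - t *\<^sub>R v h \<in> Q"
    using eventually_at_split by blast
  moreover have "\<forall>\<^sub>F t in at_right (0::real). t > 0" by (simp add: eventually_at_right_less)
  ultimately have "\<forall>\<^sub>F t in at_right (0::real). v g - t *\<^sub>R v h \<in> Q \<and> t > 0" by (rule eventually_conj)
  then obtain t where t: "v g - t *\<^sub>R v h \<in> Q" "t > 0"
    by (metis (mono_tags, lifting) eventually_happens trivial_limit_at_right_real)
  then have "v g - t *\<^sub>R v h \<in> cone_of G v"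
    using T(3) proj_cone_positive[OF G(1,2)] by (auto simp: Q_def)
  then show ?thesis using generator_splitD[of G u v g h t, OF G t(2)] that by blast
qed

section \<open>Projective holes as signed point sets\<close>

lemma cone_of_cong: "(\<And>g. g \<in> G \<Longrightarrow> v g = v' g) \<Longrightarrow> cone_of G v = cone_of G v'"
  unfolding cone_of_def by (intro Collect_cong ex_cong1 conj_cong refl arg_cong2[where f="(=)"] sum.cong) auto

lemma cone_of_uminus: "x \<in> cone_of G (\<lambda>g. - v g) \<longleftrightarrow> - x \<in> cone_of G v"
  unfolding cone_of_def by (auto simp: sum_negf) (metis minus_equation_iff)

lemma proj_cone_uminus: "proj_cone G (\<lambda>g. - v g) = proj_cone G v"
proof -
  have "proj_cone G (\<lambda>g. - v g) \<subseteq> proj_cone G v" for v :: "'a \<Rightarrow> real^3"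
  proof
    fix p assume "p \<in> proj_cone G (\<lambda>g. - v g)"
    then obtain x where "x \<in> cone_of G (\<lambda>g. - v g) - {0}" and p: "p = rp2_of x"
      unfolding proj_cone_def by blast
    then have x: "- x \<in> cone_of G v" "x \<noteq> 0" by (simp_all add: cone_of_uminus)
    have "rp2_of x = rp2_of (- x)" using rp2_of_scale[of "- 1" x] by simp
    then show "p \<in> proj_cone G v" using x p unfolding proj_cone_def by (intro image_eqI[of _ _ "- x"]) auto
  qed
  from this[of v] this[of "\<lambda>g. - v g"] show ?thesis by auto
qed

context general_position
begin

abbreviation points :: "rp2 set" where "points \<equiv> rp2_of ` w ` I"

definition region :: "'i set \<times> 'i set \<Rightarrow> rp2 set" where
  "region S = proj_cone (fst S \<union> snd S) (signed_family (fst S))"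

lemma rp2_of_w_inj: "inj_on (\<lambda>i. rp2_of (w i)) I"
proof (rule inj_onI, rule ccontr)
  fix i j assume ij: "i \<in> I" "j \<in> I" "rp2_of (w i) = rp2_of (w j)" "i \<noteq> j"
  then obtain c where "w j = c *\<^sub>R w i" using w_nz rp2_of_eqD by metis
  then show False using cross_nz[of i j] ij by (simp add: cross_mult_right)
qed

lemma signed_family_inj: "inj_on (signed_family A) I"
proof (rule inj_onI)
  fix i j assume ij: "i \<in> I" "j \<in> I" "signed_family A i = signed_family A j"
  then have "rp2_of (w i) = rp2_of (w j)" by (metis rp2_of_scale sgn_of_simps(3) signed_family_def)
  then show "i = j" using rp2_of_w_inj ij by (auto dest: inj_onD)
qed

text \<open>A dependence with nonnegative coefficients between the signed vectors would put the negative of one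
of them into the cone of the others. Hence the origin is outside of their convex hull and can be
separated from it: the region lies in a Euclidean plane.\<close>

lemma signed_hole_halfspace:
  assumes h: "(A, B) \<in> signed_holes k I ccw"
  obtains u where "u \<noteq> 0" "\<And>g. g \<in> A \<union> B \<Longrightarrow> u \<bullet> signed_family A g > 0"
proof -
  let ?G = "A \<union> B" and ?v = "signed_family A"
  have GI: "?G \<subseteq> I" using h by (auto simp: signed_holes_def)
  have fin: "finite ?G" using GI finite_I finite_subset by blast
  have inj: "inj_on ?v ?G" using signed_family_inj GI inj_on_subset by blast
  have "0 \<notin> convex hull (?v ` ?G)"
  proof
    assume "0 \<in> convex hull (?v ` ?G)"
    then obtain d where d: "\<forall>x\<in>?v ` ?G. 0 \<le> d x" "sum d (?v ` ?G) = (1::real)" "(\<Sum>x\<in>?v ` ?G. d x *\<^sub>R x) = 0"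
      using fin by (auto simp: convex_hull_finite)
    define c where "c g = d (?v g)" for g
    have c: "\<forall>g\<in>?G. 0 \<le> c g" "sum c ?G = 1" "(\<Sum>g\<in>?G. c g *\<^sub>R ?v g) = 0"
      using d by (auto simp: sum.reindex[OF inj] c_def)
    have "\<exists>g\<in>?G. c g \<noteq> 0" using c(2) by (metis sum.neutral zero_neq_one)
    then obtain g where g: "g \<in> ?G" "c g > 0" using c(1) by (metis order_less_le)
    have "(\<Sum>h\<in>?G. c h *\<^sub>R ?v h) = c g *\<^sub>R ?v g + (\<Sum>h\<in>?G - {g}. c h *\<^sub>R ?v h)"
      using fin g(1) by (simp only: sum.remove)
    then have "(\<Sum>h\<in>?G - {g}. c h *\<^sub>R ?v h) = - (c g *\<^sub>R ?v g)"
      using c(3) by (metis add_eq_0_iff)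
    then have "(- c g * sgn_of (g \<in> A)) *\<^sub>R w g \<in> cone_of (?G - {g}) ?v"
      using c(1) by (auto simp: cone_of_def signed_family_def intro!: exI[of _ c])
    then show False
      using signed_hole_not_in_cone[OF h, of g "- c g * sgn_of (g \<in> A)"] g GI by auto
  qed
  then obtain u b where u: "u \<noteq> 0" "0 < b" "\<forall>x\<in>convex hull (?v ` ?G). u \<bullet> x > b"
    using separating_hyperplane_closed_0[of "convex hull (?v ` ?G)"] fin
    by (metis convex_convex_hull finite_imageI finite_imp_compact_convex_hull compact_imp_closed)
  have "u \<bullet> ?v g > 0" if "g \<in> ?G" for g
    using u that hull_subset[of "?v ` ?G" convex] by (smt (verit) image_eqI subset_eq)
  then show ?thesis using that u(1) by blast
qed

lemma point_in_region_iff: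
  assumes h: "(A, B) \<in> signed_holes k I ccw" and i: "i \<in> I"
  shows "rp2_of (w i) \<in> region (A, B) \<longleftrightarrow> i \<in> A \<union> B"
proof
  assume "rp2_of (w i) \<in> region (A, B)"
  then have "w i \<in> cone_of (A \<union> B) (signed_family A) \<or> - w i \<in> cone_of (A \<union> B) (signed_family A)"
    using proj_coneD w_nz[OF i] by (metis fst_conv region_def snd_conv)
  then have "1 *\<^sub>R w i \<in> cone_of (A \<union> B) (signed_family A) \<or> (-1) *\<^sub>R w i \<in> cone_of (A \<union> B) (signed_family A)"
    by simp
  then show "i \<in> A \<union> B"
    using signed_hole_not_in_cone[OF h i] by (metis Diff_empty Diff_insert0 zero_neq_one zero_neq_neg_one)
next
  assume "i \<in> A \<union> B"
  moreover have "finite (A \<union> B)" using h finite_I finite_subset by (auto simp: signed_holes_def)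
  moreover obtain u where "u \<noteq> 0" "\<And>g. g \<in> A \<union> B \<Longrightarrow> u \<bullet> signed_family A g > 0"
    using signed_hole_halfspace[OF h] by metis
  ultimately have "rp2_of (signed_family A i) \<in> region (A, B)"
    using generators_in_proj_cone[of "A \<union> B" u "signed_family A"] by (auto simp: region_def)
  then show "rp2_of (w i) \<in> region (A, B)" by (simp add: signed_family_def rp2_of_scale)
qed

lemma region_in_proj_holes:
  assumes h: "(A, B) \<in> signed_holes k I ccw" and k: "3 \<le> k"
  shows "region (A, B) \<in> proj_holes k points"
proof -
  let ?G = "A \<union> B" and ?v = "signed_family A" and ?C = "region (A, B)"
  have GI: "?G \<subseteq> I" and card: "card ?G = k" using h by (auto simp: signed_holes_def)
  have fin: "finite ?G" using GI finite_I finite_subset by blast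
  obtain u where u: "u \<noteq> 0" "\<And>g. g \<in> ?G \<Longrightarrow> u \<bullet> ?v g > 0"
    using signed_hole_halfspace[OF h] by metis
  have same: "rp2_of ` ?v ` S = rp2_of ` w ` S" for S
    by (auto simp: signed_family_def rp2_of_scale image_image)
  have hull: "rp2_convex_hull (rp2_of ` w ` ?G) ?C"
    using rp2_convex_hull_proj_cone[of ?G u ?v, OF fin u(2,1)] by (simp add: region_def same)
  have "inj_on (\<lambda>i. rp2_of (w i)) ?G" using rp2_of_w_inj GI inj_on_subset by blast
  then have card': "card (rp2_of ` w ` ?G) = k" using card card_image by (fastforce simp: image_image)
  have notint: "rp2_of (w g) \<notin> interior ?C" if g: "g \<in> ?G" for g
  proof
    assume "rp2_of (w g) \<in> interior ?C"
    then have int: "rp2_of (?v g) \<in> interior (proj_cone ?G ?v)"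
      by (simp add: signed_family_def rp2_of_scale region_def)
    have "card (?G - {g}) \<noteq> 0" using card k fin g by simp
    then have "?G - {g} \<noteq> {}" by (metis card.empty)
    then obtain h' where "h' \<in> ?G" "h' \<noteq> g" by blast
    then obtain s where s: "s > 0" "s *\<^sub>R ?v g \<in> cone_of (?G - {g}) ?v"
      using interior_generatorD[of ?G u ?v g h', OF fin u(2) g _ _ int] by blast
    then have "(s * sgn_of (g \<in> A)) *\<^sub>R w g \<in> cone_of (?G - {g}) ?v" by (simp add: signed_family_def)
    then show False using signed_hole_not_in_cone[OF h, of g "s * sgn_of (g \<in> A)"] s g GI by auto
  qed
  have "rp2_of ` w ` ?G \<subseteq> frontier ?C"
    using notint hull closure_subset[of ?C] by (fastforce simp: frontier_def rp2_convex_hull_def)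
  moreover have "interior ?C \<inter> points = {}"
    using notint point_in_region_iff[OF h] interior_subset[of ?C] by blast
  ultimately show ?thesis
    using hull card' GI unfolding proj_holes_def proj_gon_def
    by (intro CollectI conjI exI[of _ "rp2_of ` w ` ?G"] image_mono) auto
qed

lemma proj_hole_is_region:
  assumes C: "C \<in> proj_holes k points"
  obtains A B where "(A, B) \<in> signed_holes k I ccw" "C = region (A, B)"
proof -
  obtain G' where G': "G' \<subseteq> points" "card G' = k" "rp2_convex_hull G' C" "interior C \<inter> points = {}"
    using C by (auto simp: proj_holes_def proj_gon_def)
  define G where "G = {i \<in> I. rp2_of (w i) \<in> G'}"
  have GG: "G' = rp2_of ` w ` G" using G'(1) by (auto simp: G_def)
  have "inj_on (\<lambda>i. rp2_of (w i)) G"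
    using rp2_of_w_inj by (rule inj_on_subset) (auto simp: G_def)
  then have card: "card G = k" using G'(2) card_image unfolding GG by (fastforce simp: image_image)
  have fin: "finite G" using finite_I by (simp add: G_def)
  have "w g \<noteq> 0" if "g \<in> G" for g using that w_nz by (simp add: G_def)
  then obtain u where u: "u \<noteq> 0" "\<And>g. g \<in> G \<Longrightarrow> u \<bullet> w g \<noteq> 0"
      "C = proj_cone G (\<lambda>g. sgn_of (u \<bullet> w g > 0) *\<^sub>R w g)"
    using rp2_convex_hullD[OF G'(3)[unfolded GG] fin] by blast
  define A where "A = {g \<in> G. u \<bullet> w g > 0}"
  have AG: "A \<union> (G - A) = G" by (auto simp: A_def)
  have CG: "C = proj_cone G (signed_family A)"
    unfolding u(3) proj_cone_def
    by (intro arg_cong[where f="\<lambda>c. rp2_of ` (c - {0})"] cone_of_cong) (simp add: signed_family_def A_def)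
  have "empty_triangle I ccw (\<lambda>i. i \<in> A) a b c" if abc: "a \<in> G" "b \<in> G" "c \<in> G" "a \<noteq> b" "a \<noteq> c" "b \<noteq> c" for a b c
    unfolding empty_triangle_def
  proof (intro ballI notI)
    fix p assume p: "p \<in> I - {a, b, c}" and cell: "in_cell ccw (\<lambda>i. i \<in> A) a b c p"
    have I: "a \<in> I" "b \<in> I" "c \<in> I" "p \<in> I" "distinct [a, b, c, p]" using abc p by (auto simp: G_def)
    obtain s x y z where s: "s \<noteq> 0" "x > 0" "y > 0" "z > 0"
      "s *\<^sub>R w p = x *\<^sub>R signed_family A a + y *\<^sub>R signed_family A b + z *\<^sub>R signed_family A c"
      using in_cellD[OF I cell] unfolding signed_family_def by metis
    have "det3 (signed_family A a) (signed_family A b) (signed_family A c) \<noteq> 0"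
      using det_nz[of a b c] I by (simp add: signed_family_def det3_linear)
    then have "rp2_of (s *\<^sub>R w p) \<in> interior C"
      unfolding s(5) CG using abc s by (intro triple_in_interior fin)
    then show False using G'(4) s(1) I(4) by (auto simp: rp2_of_scale)
  qed
  then have "(A, G - A) \<in> signed_holes k I ccw"
    unfolding signed_holes_def mem_Collect_eq prod.case AG using card by (auto simp: G_def)
  moreover have "C = region (A, G - A)" using CG AG by (simp add: region_def)
  ultimately show ?thesis using that by blast
qed

lemma proj_holes_eq_regions:
  assumes "3 \<le> k" shows "proj_holes k points = region ` signed_holes k I ccw"
proof
  show "proj_holes k points \<subseteq> region ` signed_holes k I ccw"
    by (rule subsetI, erule proj_hole_is_region) blast
  show "region ` signed_holes k I ccw \<subseteq> proj_holes k points"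
    using region_in_proj_holes[OF _ assms] by (intro image_subsetI) (metis surj_pair)
qed

text \<open>The sum and the difference of two vertex vectors represent points on the two different segments
between the vertices, and only one of these segments lies in the region. So the region determines
the signs up to a common factor.\<close>

lemma same_sign_iff_sum_in_region:
  assumes h: "(A, B) \<in> signed_holes k I ccw" and gh: "g \<in> A \<union> B" "h \<in> A \<union> B" "g \<noteq> h"
  shows "(g \<in> A) = (h \<in> A) \<longleftrightarrow> rp2_of (w g + w h) \<in> region (A, B)"
proof -
  let ?G = "A \<union> B" and ?v = "signed_family A"
  have GI: "?G \<subseteq> I" using h by (auto simp: signed_holes_def)
  have fin: "finite ?G" using GI finite_I finite_subset by blast
  obtain u where u: "u \<noteq> 0" "\<And>g. g \<in> ?G \<Longrightarrow> u \<bullet> ?v g > 0"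
    using signed_hole_halfspace[OF h] by metis
  have sum_nz: "w g + w h \<noteq> 0"
  proof
    assume "w g + w h = 0"
    then have "cross3 (w g) (w h) = 0" by (metis add.commute add_eq_0_iff cross_minus_right cross_refl minus_zero)
    then show False using cross_nz gh GI by blast
  qed
  have no: False if ab: "?v a - ?v b \<in> cone_of ?G ?v" "a \<in> ?G" "b \<in> ?G" "b \<noteq> a" for a b
  proof -
    obtain s where "s > 0" "s *\<^sub>R ?v a \<in> cone_of (?G - {a}) ?v"
      using generator_splitD[of ?G u ?v a b 1, OF fin u(2)] ab by auto
    then show False
      using signed_hole_not_in_cone[OF h, of a "s * sgn_of (a \<in> A)"] ab GI by (auto simp: signed_family_def)
  qed
  show ?thesis
  proof
    assume s: "(g \<in> A) = (h \<in> A)"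
    have "?v g + ?v h \<in> cone_of ?G ?v" using gh by (intro cone_of_add cone_of_generator fin)
    moreover have eq: "?v g + ?v h = sgn_of (g \<in> A) *\<^sub>R (w g + w h)"
      using s by (simp add: signed_family_def scaleR_add_right)
    ultimately have "rp2_of (sgn_of (g \<in> A) *\<^sub>R (w g + w h)) \<in> region (A, B)"
      using sum_nz by (auto simp: region_def proj_cone_def intro!: imageI)
    then show "rp2_of (w g + w h) \<in> region (A, B)" by (simp add: rp2_of_scale)
  next
    assume "rp2_of (w g + w h) \<in> region (A, B)"
    then have c: "w g + w h \<in> cone_of ?G ?v \<or> - (w g + w h) \<in> cone_of ?G ?v"
      using proj_coneD sum_nz by (metis fst_conv region_def snd_conv)
    show "(g \<in> A) = (h \<in> A)"
    proof (rule ccontr)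
      assume d: "(g \<in> A) \<noteq> (h \<in> A)"
      then have "?v g - ?v h = w g + w h \<and> ?v h - ?v g = - (w g + w h) \<or>
          ?v g - ?v h = - (w g + w h) \<and> ?v h - ?v g = w g + w h"
        by (cases "g \<in> A"; cases "h \<in> A") (auto simp: signed_family_def)
      then have "?v g - ?v h \<in> cone_of ?G ?v \<or> ?v h - ?v g \<in> cone_of ?G ?v"
        using c by metis
      then show False using no gh by blast
    qed
  qed
qed

lemma region_eqD:
  assumes h: "(A, B) \<in> signed_holes k I ccw" "(A', B') \<in> signed_holes k I ccw"
    and eq: "region (A, B) = region (A', B')"
  shows "(A', B') = (A, B) \<or> (A', B') = (B, A)"
proof -
  have G: "A \<union> B = A' \<union> B'"
  proof -
    have "A \<union> B \<subseteq> I" "A' \<union> B' \<subseteq> I" using h by (auto simp: signed_holes_def)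
    then show ?thesis using point_in_region_iff[OF h(1)] point_in_region_iff[OF h(2)] eq by blast
  qed
  have disj: "A \<inter> B = {}" "A' \<inter> B' = {}" using h by (auto simp: signed_holes_def)
  have same: "(g \<in> A) = (h \<in> A) \<longleftrightarrow> (g \<in> A') = (h \<in> A')" if "g \<in> A \<union> B" "h \<in> A \<union> B" for g h
    using same_sign_iff_sum_in_region[OF assms(1), of g h] same_sign_iff_sum_in_region[OF assms(2), of g h]
      that G eq by blast
  show ?thesis
  proof (cases "A \<union> B = {}")
    case True
    then show ?thesis using G by auto
  next
    case False
    then obtain g where g: "g \<in> A \<union> B" by blast
    show ?thesis
    proof (cases "(g \<in> A) = (g \<in> A')")
      case True
      then have "h \<in> A \<longleftrightarrow> h \<in> A'" if "h \<in> A \<union> B" for h using same[OF g that] by blast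
      then show ?thesis using G disj by blast
    next
      case False
      then have "h \<in> A \<longleftrightarrow> h \<notin> A'" if "h \<in> A \<union> B" for h using same[OF g that] by blast
      then show ?thesis using G disj by blast
    qed
  qed
qed

lemma region_swap:
  assumes "A \<inter> B = {}" shows "region (B, A) = region (A, B)"
proof -
  have "cone_of (A \<union> B) (signed_family B) = cone_of (A \<union> B) (\<lambda>g. - signed_family A g)"
    using assms by (intro cone_of_cong) (auto simp: signed_family_def sgn_of_def)
  then have "proj_cone (A \<union> B) (signed_family B) = proj_cone (A \<union> B) (\<lambda>g. - signed_family A g)"
    by (simp add: proj_cone_def)
  then show ?thesis by (simp add: region_def proj_cone_uminus Un_commute)
qed

end

section \<open>Triangles across two classes that lie deep below each other\<close>

definition alternating :: "'i set \<Rightarrow> 'i chirotope \<Rightarrow> bool" where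
  "alternating I cc \<longleftrightarrow> (\<forall>i\<in>I. \<forall>j\<in>I. \<forall>k\<in>I. i \<noteq> j \<longrightarrow> i \<noteq> k \<longrightarrow> j \<noteq> k \<longrightarrow>
     cc j i k = (\<not> cc i j k) \<and> cc i k j = (\<not> cc i j k))"

lemma alternatingD:
  assumes "alternating I cc" "i \<in> I" "j \<in> I" "k \<in> I" "i \<noteq> j" "i \<noteq> k" "j \<noteq> k"
  shows "cc j i k = (\<not> cc i j k)" "cc i k j = (\<not> cc i j k)" "cc j k i = cc i j k"
    "cc k i j = cc i j k" "cc k j i = (\<not> cc i j k)"
  using assms unfolding alternating_def by metis+

lemma alternating_subset: "alternating I cc \<Longrightarrow> J \<subseteq> I \<Longrightarrow> alternating J cc"
  unfolding alternating_def by blast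

lemma in_cell_permute:
  assumes alt: "alternating I cc" and I: "a \<in> I" "b \<in> I" "c \<in> I" "a \<noteq> b" "a \<noteq> c" "b \<noteq> c"
    and p: "p \<in> I - {a, b, c}"
  shows "in_cell cc e b a c p = in_cell cc e a b c p" "in_cell cc e a c b p = in_cell cc e a b c p"
proof -
  have 1: "cc p c b = (\<not> cc p b c)" "cc b p c = (\<not> cc p b c)"
    using alternatingD[OF alt, of p b c] p I by auto
  have 2: "cc p a c = (\<not> cc a p c)" "cc a c p = (\<not> cc a p c)"
    using alternatingD[OF alt, of a p c] p I by auto
  have 3: "cc b a p = (\<not> cc a b p)" "cc a p b = (\<not> cc a b p)"
    using alternatingD[OF alt, of a b p] p I by auto
  show "in_cell cc e b a c p = in_cell cc e a b c p" "in_cell cc e a c b p = in_cell cc e a b c p"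
    unfolding in_cell_def 1 2 3 by auto
qed

lemma empty_triangle_permute:
  assumes "alternating I cc" "a \<in> I" "b \<in> I" "c \<in> I" "a \<noteq> b" "a \<noteq> c" "b \<noteq> c"
  shows "empty_triangle I cc e b a c = empty_triangle I cc e a b c" "empty_triangle I cc e a c b = empty_triangle I cc e a b c"
proof -
  have "{b, a, c} = {a, b, c}" "{a, c, b} = {a, b, c}" by auto
  then show "empty_triangle I cc e b a c = empty_triangle I cc e a b c" "empty_triangle I cc e a c b = empty_triangle I cc e a b c"
    using in_cell_permute[OF assms] unfolding empty_triangle_def by simp_all
qed

text \<open>The elements of \<open>X\<close> are thought of as points numbered from left to right, and \<^term>\<open>cc i j x\<close> with
\<open>i < j\<close> as the statement that \<open>x\<close> lies above the line \<open>ij\<close>. So no point of \<open>X\<close> is between \<open>i\<close>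
and \<open>j\<close> and on side \<open>d\<close> of their line.\<close>

definition free_side :: "bool \<Rightarrow> nat set \<Rightarrow> nat chirotope \<Rightarrow> nat \<Rightarrow> nat \<Rightarrow> bool" where
  "free_side d X cc i j \<longleftrightarrow> (\<forall>x\<in>X. i < x \<and> x < j \<longrightarrow> cc i j x \<noteq> d)"

text \<open>The analogue for the other segment between \<open>i\<close> and \<open>j\<close>, which passes through the line at infinity,
where the two sides of the line \<open>ij\<close> change places.\<close>

definition free_wedge :: "bool \<Rightarrow> nat set \<Rightarrow> nat chirotope \<Rightarrow> nat \<Rightarrow> nat \<Rightarrow> bool" where
  "free_wedge d X cc i j \<longleftrightarrow> (\<forall>x\<in>X. (x < i \<longrightarrow> cc i j x \<noteq> d) \<and> (j < x \<longrightarrow> cc i j x = d))"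

text \<open>For \<open>d = True\<close> the set \<open>Y\<close> lies high above \<open>X\<close>, for \<open>d = False\<close> deep below.\<close>

locale separated_classes =
  fixes X Y :: "nat set" and cc :: "nat \<Rightarrow> nat \<Rightarrow> nat \<Rightarrow> bool" and d :: bool
  assumes alt: "alternating (X \<union> Y) cc"
    and disj: "X \<inter> Y = {}"
    and XY: "\<And>i j k. i \<in> X \<Longrightarrow> j \<in> X \<Longrightarrow> k \<in> Y \<Longrightarrow> i < j \<Longrightarrow> cc i j k = d"
    and YX: "\<And>i j k. i \<in> Y \<Longrightarrow> j \<in> Y \<Longrightarrow> k \<in> X \<Longrightarrow> i < j \<Longrightarrow> cc i j k = (\<not> d)"
begin

lemma swap: "separated_classes Y X cc (\<not> d)"
  using alt disj XY YX by unfold_locales (auto simp: Un_commute)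

lemma XY': "i \<in> X \<Longrightarrow> j \<in> X \<Longrightarrow> k \<in> Y \<Longrightarrow> i \<noteq> j \<Longrightarrow> cc i j k = ((i < j) = d)"
  using XY[of i j k] XY[of j i k] alternatingD(1)[OF alt, of i j k] disj
  by (metis IntI UnCI empty_iff linorder_neqE_nat order_less_asym)

lemma YX': "i \<in> Y \<Longrightarrow> j \<in> Y \<Longrightarrow> k \<in> X \<Longrightarrow> i \<noteq> j \<Longrightarrow> cc i j k = ((i < j) \<noteq> d)"
  using YX[of i j k] YX[of j i k] alternatingD(1)[OF alt, of i j k] disj
  by (metis IntI UnCI empty_iff linorder_neqE_nat order_less_asym)

text \<open>All points of the other class are on the same side of the three lines, hence in the same one of
the four triangles. It is the one with exceptional middle vertex, which contains the vertical
direction.\<close>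

lemma mono_in_cell_iff:
  assumes "a \<in> X" "b \<in> X" "c \<in> X" "a < b" "b < c" "y \<in> Y"
  shows "in_cell cc e a b c y \<longleftrightarrow> e a \<noteq> e b \<and> e c \<noteq> e b"
proof -
  have ne: "y \<noteq> a" "y \<noteq> b" "y \<noteq> c" using assms disj by auto
  have "cc y b c = d" using alternatingD(4)[OF alt, of b c y] XY[of b c y] assms ne by auto
  moreover have "cc a y c = (\<not> d)" using alternatingD(2)[OF alt, of a c y] XY[of a c y] assms ne by auto
  moreover have "cc a b y = d" using XY assms by auto
  ultimately show ?thesis unfolding in_cell_def by auto
qed

text \<open>Determinants of two points of one class and a point of the other one depend only on the horizontal
order within the class of the two. Therefore the position of \<open>r\<close> relative to \<open>p\<close> and \<open>q\<close> does not
matter. If \<open>p\<close> and \<open>q\<close> have the same sign, then only points of \<open>X\<close> between them can be in the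
triangle. If the signs differ, then only points of \<open>X\<close> on the left of \<open>p\<close> or on the right of \<open>q\<close>
can be in it, but in addition all points of \<open>Y\<close> on the left of \<open>r\<close>, or all on the right of \<open>r\<close>, are
in it. The triangle lies on side \<open>d'\<close> of the line \<open>pq\<close> along the part of the edge that starts at \<open>p\<close>.\<close>

lemma mixed_empty_triangle_iff:
  fixes e
  assumes p: "p \<in> X" and q: "q \<in> X" and r: "r \<in> Y" and pq: "p < q"
  defines "d' \<equiv> ((e r = e p) = d)"
  shows "empty_triangle (X \<union> Y) cc e p q r \<longleftrightarrow>
    (if e p = e q then free_side d' X cc p q
     else free_wedge d' X cc p q \<and> (\<forall>y\<in>Y. if e r = e p then r \<le> y else y \<le> r))"
proof -
  have ne: "r \<noteq> p" "r \<noteq> q" using assms disj by auto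
  have x: "\<not> in_cell cc e p q r x \<longleftrightarrow> (if e p = e q then p < x \<and> x < q \<longrightarrow> cc p q x \<noteq> d'
      else (x < p \<longrightarrow> cc p q x \<noteq> d') \<and> (q < x \<longrightarrow> cc p q x = d'))" if x: "x \<in> X" "x \<noteq> p" "x \<noteq> q" for x
  proof -
    have 1: "cc x q r = ((x < q) = d)" using XY' assms x by auto
    have 2: "cc p x r = ((p < x) = d)" using XY' assms x by auto
    consider "x < p" "x < q" | "p < x" "x < q" | "p < x" "q < x" using x pq by linarith
    then show ?thesis
      by cases (use pq in \<open>auto simp: in_cell_def 1 2 d'_def\<close>)
  qed
  have y: "\<not> in_cell cc e p q r y \<longleftrightarrow> (e p = e q \<or> (if e r = e p then r \<le> y else y \<le> r))"
    if y: "y \<in> Y" "y \<noteq> r" for y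
  proof -
    have yp: "y \<noteq> p" "y \<noteq> q" using y p q disj by auto
    have 1: "cc y q r = ((y < r) = d)"
      using alternatingD(2)[OF alt, of y r q] YX'[of y r q] y yp q r ne by auto
    have 2: "cc p y r = ((y < r) \<noteq> d)"
      using alternatingD(4)[OF alt, of y r p] YX'[of y r p] y yp p r ne by auto
    have 3: "cc p q y = d" using XY p q y pq by auto
    have "y < r \<or> r < y" using y by auto
    then show ?thesis by (auto simp: in_cell_def 1 2 3)
  qed
  have "empty_triangle (X \<union> Y) cc e p q r \<longleftrightarrow>
      (\<forall>x\<in>X. x \<noteq> p \<and> x \<noteq> q \<longrightarrow> \<not> in_cell cc e p q r x) \<and> (\<forall>y\<in>Y. y \<noteq> r \<longrightarrow> \<not> in_cell cc e p q r y)"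
    using p q r disj unfolding empty_triangle_def by blast
  also have "\<dots> \<longleftrightarrow> (if e p = e q then free_side d' X cc p q
     else free_wedge d' X cc p q \<and> (\<forall>y\<in>Y. if e r = e p then r \<le> y else y \<le> r))"
  proof (cases "e p = e q")
    case True
    have "(\<forall>x\<in>X. x \<noteq> p \<and> x \<noteq> q \<longrightarrow> \<not> in_cell cc e p q r x) \<longleftrightarrow> free_side d' X cc p q"
      unfolding free_side_def by (rule ball_cong[OF refl]) (use x True in auto)
    then show ?thesis using True y by simp
  next
    case False
    have "(\<forall>x\<in>X. x \<noteq> p \<and> x \<noteq> q \<longrightarrow> \<not> in_cell cc e p q r x) \<longleftrightarrow> free_wedge d' X cc p q"
      unfolding free_wedge_def by (rule ball_cong[OF refl]) (use x False pq in auto)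
    moreover have "(\<forall>y\<in>Y. y \<noteq> r \<longrightarrow> \<not> in_cell cc e p q r y) \<longleftrightarrow> (\<forall>y\<in>Y. if e r = e p then r \<le> y else y \<le> r)"
      by (rule ball_cong[OF refl]) (use y False in auto)
    ultimately show ?thesis using False by simp
  qed
  finally show ?thesis .
qed

end

section \<open>Chirotopes of Horton sets\<close>

text \<open>The two parity classes play the roles of \<^const>\<open>horton0\<close> and \<^const>\<open>horton1\<close>; \<open>t = True\<close> means that
the odd numbers are the upper class.\<close>

definition interleaved :: "bool \<Rightarrow> nat \<Rightarrow> nat chirotope \<Rightarrow> bool" where
  "interleaved t n cc \<longleftrightarrow> (\<forall>i j k. i < j \<longrightarrow> j < n \<longrightarrow> k < n \<longrightarrow> even i = even j \<longrightarrow> even k \<noteq> even i \<longrightarrow>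
     cc i j k = (t = even i))"

definition class_size :: "nat \<Rightarrow> nat \<Rightarrow> nat" where "class_size b n = (n + 1 - b) div 2"

definition class_chirotope :: "nat \<Rightarrow> nat chirotope \<Rightarrow> nat \<Rightarrow> nat \<Rightarrow> nat \<Rightarrow> bool" where
  "class_chirotope b cc i j k = cc (2 * i + b) (2 * j + b) (2 * k + b)"

definition parity_class :: "nat \<Rightarrow> nat \<Rightarrow> nat set" where "parity_class b n = {x. x < n \<and> x mod 2 = b}"

text \<open>The set \<open>T\<close> restricts which class may be the upper one: \<^term>\<open>UNIV\<close> gives all Horton sets and
\<^term>\<open>{True}\<close> the canonical ones.\<close>

inductive horton_chirotope :: "bool set \<Rightarrow> nat \<Rightarrow> nat chirotope \<Rightarrow> bool" for T where
  chirotope_small: "n \<le> 1 \<Longrightarrow> horton_chirotope T n cc"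
| chirotope_step: "2 \<le> n \<Longrightarrow> t \<in> T \<Longrightarrow> interleaved t n cc \<Longrightarrow> horton_chirotope T (class_size 0 n) (class_chirotope 0 cc) \<Longrightarrow>
    horton_chirotope T (class_size 1 n) (class_chirotope 1 cc) \<Longrightarrow> horton_chirotope T n cc"

lemma parity_class_image: "b < 2 \<Longrightarrow> parity_class b n = (\<lambda>i. 2 * i + b) ` {..<class_size b n}"
proof (intro set_eqI iffI)
  fix x assume "b < 2" "x \<in> parity_class b n"
  then have x: "b < 2" "x < n" "x mod 2 = b" by (auto simp: parity_class_def)
  then have "x = 2 * (x div 2) + b" by presburger
  moreover have "x div 2 < class_size b n"
  proof (cases "b = 0")
    case True
    then show ?thesis using x unfolding class_size_def by (simp; presburger)
  next
    case False
    then have "b = 1" using x by simp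
    then show ?thesis using x unfolding class_size_def by (simp; presburger)
  qed
  ultimately show "x \<in> (\<lambda>i. 2 * i + b) ` {..<class_size b n}" by blast
next
  fix x assume "b < 2" "x \<in> (\<lambda>i. 2 * i + b) ` {..<class_size b n}"
  then show "x \<in> parity_class b n" by (auto simp: parity_class_def class_size_def)
qed

lemma parity_class_member: "b < 2 \<Longrightarrow> i < class_size b n \<Longrightarrow> 2 * i + b < n"
  unfolding class_size_def by presburger

lemma parity_class_Un: "parity_class 0 n \<union> parity_class 1 n = {..<n}" "parity_class 0 n \<inter> parity_class 1 n = {}"
  by (auto simp: parity_class_def)

lemma parity_class_Un': "b < 2 \<Longrightarrow> parity_class b n \<union> parity_class (1 - b) n = {..<n}" "b < 2 \<Longrightarrow> parity_class b n \<inter> parity_class (1 - b) n = {}"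
  by (auto simp: parity_class_def; presburger)+

lemma class_size_sum: "class_size 0 n + class_size 1 n = n" by (simp add: class_size_def)

lemma alternating_class:
  assumes "alternating {..<n} cc" "b < 2" shows "alternating {..<class_size b n} (class_chirotope b cc)"
  unfolding alternating_def class_chirotope_def
proof (intro ballI impI)
  fix i j k assume "i \<in> {..<class_size b n}" "j \<in> {..<class_size b n}" "k \<in> {..<class_size b n}" "i \<noteq> j" "i \<noteq> k" "j \<noteq> k"
  then show "cc (2 * j + b) (2 * i + b) (2 * k + b) = (\<not> cc (2 * i + b) (2 * j + b) (2 * k + b)) \<and>
      cc (2 * i + b) (2 * k + b) (2 * j + b) = (\<not> cc (2 * i + b) (2 * j + b) (2 * k + b))"
    using alternatingD(1,2)[OF assms(1), of "2 * i + b" "2 * j + b" "2 * k + b"]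
      parity_class_member[OF assms(2)] by simp
qed

lemma parity_class_even: "b < 2 \<Longrightarrow> x \<in> parity_class b n \<Longrightarrow> x < n \<and> even x = (b = 0)"
  "b < 2 \<Longrightarrow> x \<in> parity_class (1 - b) n \<Longrightarrow> x < n \<and> even x = (b \<noteq> 0)"
  unfolding parity_class_def even_iff_mod_2_eq_zero by auto

lemma interleavedD:
  "interleaved t n cc \<Longrightarrow> i < j \<Longrightarrow> j < n \<Longrightarrow> k < n \<Longrightarrow> even i = even j \<Longrightarrow> even k \<noteq> even i \<Longrightarrow> cc i j k = (t = even i)"
  unfolding interleaved_def by blast

lemma separated_parity_classes:
  assumes alt: "alternating {..<n} cc" and sp: "interleaved t n cc" and b: "b < 2"
  shows "separated_classes (parity_class b n) (parity_class (1 - b) n) cc (t = (b = 0))"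
proof
  show "alternating (parity_class b n \<union> parity_class (1 - b) n) cc" using alt parity_class_Un'(1)[OF b] by simp
  show "parity_class b n \<inter> parity_class (1 - b) n = {}" by (rule parity_class_Un'(2)[OF b])
  fix i j k :: nat
  show "cc i j k = (t = (b = 0))" if "i \<in> parity_class b n" "j \<in> parity_class b n" "k \<in> parity_class (1 - b) n" "i < j"
    using interleavedD[OF sp, of i j k] that parity_class_even[OF b, of _ n] by auto
  show "cc i j k = (\<not> (t = (b = 0)))" if "i \<in> parity_class (1 - b) n" "j \<in> parity_class (1 - b) n" "k \<in> parity_class b n" "i < j"
    using interleavedD[OF sp, of i j k] that parity_class_even[OF b, of _ n] by auto
qed

lemma free_side_class: "b < 2 \<Longrightarrow> free_side d (parity_class b n) cc (2 * i + b) (2 * j + b) \<longleftrightarrow> free_side d {..<class_size b n} (class_chirotope b cc) i j"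
  by (auto simp: free_side_def parity_class_image class_chirotope_def)

lemma free_wedge_class: "b < 2 \<Longrightarrow> free_wedge d (parity_class b n) cc (2 * i + b) (2 * j + b) \<longleftrightarrow> free_wedge d {..<class_size b n} (class_chirotope b cc) i j"
  by (auto simp: free_wedge_def parity_class_image class_chirotope_def)

text \<open>The other class lies on one side of the whole class and has a point between any two of its points.\<close>

lemma free_side_same:
  assumes sp: "interleaved t n cc" and b: "b < 2" and ij: "i < j" "j < class_size b n"
  shows "free_side d {..<n} cc (2 * i + b) (2 * j + b) \<longleftrightarrow>
    (t = (b = 0)) \<noteq> d \<and> free_side d {..<class_size b n} (class_chirotope b cc) i j"
proof -
  let ?u = "2 * i + b" and ?v = "2 * j + b"
  have v: "?v < n" using ij b parity_class_member by blast
  have cc: "cc ?u ?v x = (t = (b = 0))" if "x \<in> parity_class (1 - b) n" for x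
    using interleavedD[OF sp, of ?u ?v x] parity_class_even(2)[OF b that] v ij(1) b by (auto simp: less_2_cases_iff)
  have mid: "?u + 1 \<in> parity_class (1 - b) n" "?u < ?u + 1" "?u + 1 < ?v"
    using v ij b unfolding parity_class_def by auto presburger
  have "free_side d {..<n} cc ?u ?v \<longleftrightarrow> free_side d (parity_class b n) cc ?u ?v \<and> free_side d (parity_class (1 - b) n) cc ?u ?v"
    unfolding parity_class_Un'(1)[OF b, symmetric] free_side_def by blast
  moreover have "free_side d (parity_class (1 - b) n) cc ?u ?v \<longleftrightarrow> (t = (b = 0)) \<noteq> d"
    unfolding free_side_def using mid cc by metis
  ultimately show ?thesis using free_side_class[OF b] by blast
qed

text \<open>For a pair of different parity the side of every third point depends on parities alone. Exchanging
the roles of the points reduces this to the defining condition for two points of equal parity.\<close>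

lemma interleaved_diff:
  assumes alt: "alternating {..<n} cc" and sp: "interleaved t n cc" and uv: "u < v" "v < n" "even u \<noteq> even v"
    and x: "x < n" "x \<noteq> u" "x \<noteq> v"
  shows "cc u v x = (if x < u then t = even u else if v < x then t \<noteq> even u
     else if even x = even u then t \<noteq> even u else t = even u)"
proof (cases "even x = even u")
  case True
  have 1: "cc u x v = (t = even u)" if "u < x" using sp that uv x True unfolding interleaved_def by auto
  have 2: "cc x u v = (t = even u)" if "x < u" using sp that uv x True unfolding interleaved_def by auto
  show ?thesis using alternatingD[OF alt, of u x v] alternatingD[OF alt, of x u v] 1 2 uv x True by auto
next
  case False
  have 1: "cc v x u = (t \<noteq> even u)" if "v < x" using sp that uv x False unfolding interleaved_def by auto
  have 2: "cc x v u = (t \<noteq> even u)" if "x < v" using sp that uv x False unfolding interleaved_def by auto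
  show ?thesis using alternatingD[OF alt, of v x u] alternatingD[OF alt, of x v u] 1 2 uv x False by auto
qed

text \<open>The two points to the right of \<open>u\<close> have different parity and hence are on different sides of the line
\<open>uv\<close>, if they are to the left of \<open>v\<close>.\<close>

lemma free_side_diff:
  assumes alt: "alternating {..<n} cc" and sp: "interleaved t n cc" and uv: "u < v" "v < n" "even u \<noteq> even v"
  shows "free_side d {..<n} cc u v \<longleftrightarrow> v = u + 1"
proof
  assume f: "free_side d {..<n} cc u v"
  show "v = u + 1"
  proof (rule ccontr)
    assume "v \<noteq> u + 1"
    then have "u + 2 < v" using uv by presburger
    then have "cc u v (u + 1) \<noteq> d" "cc u v (u + 2) \<noteq> d" using f uv by (auto simp: free_side_def)
    moreover have "cc u v (u + 1) = (t = even u)" "cc u v (u + 2) = (t \<noteq> even u)"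
      using interleaved_diff[OF alt sp uv, of "u + 1"] interleaved_diff[OF alt sp uv, of "u + 2"] uv \<open>u + 2 < v\<close> by auto
    ultimately show False by auto
  qed
qed (auto simp: free_side_def)

text \<open>On the left of \<open>u\<close> all points are on the same side of the line \<open>uv\<close>, on the right of \<open>v\<close> all are on the
opposite side. So the wedge is either free, or both of its parts contain every available point.\<close>

lemma free_wedge_diff:
  assumes alt: "alternating {..<n} cc" and sp: "interleaved t n cc" and uv: "u < v" "v < n" "even u \<noteq> even v"
  shows "free_wedge d {..<n} cc u v \<longleftrightarrow> (t = even u) \<noteq> d \<or> u = 0 \<and> v = n - 1"
proof -
  have l: "cc u v x = (t = even u)" if "x < u" for x
    using interleaved_diff[OF alt sp uv, of x] that uv by auto
  have r: "cc u v x = (t \<noteq> even u)" if "v < x" "x < n" for x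
    using interleaved_diff[OF alt sp uv, of x] that uv by auto
  have "free_wedge d {..<n} cc u v \<longleftrightarrow>
      (\<forall>x<u. (t = even u) \<noteq> d) \<and> (\<forall>x. v < x \<and> x < n \<longrightarrow> (t \<noteq> even u) = d)"
  proof -
    have "free_wedge d {..<n} cc u v \<longleftrightarrow>
        (\<forall>x\<in>{..<n}. (x < u \<longrightarrow> (t = even u) \<noteq> d) \<and> (v < x \<longrightarrow> (t \<noteq> even u) = d))"
      unfolding free_wedge_def by (rule ball_cong[OF refl]) (use l r in auto)
    moreover have "x \<in> {..<n}" if "x < u" for x using that uv by simp
    ultimately show ?thesis by blast
  qed
  also have "\<dots> \<longleftrightarrow> (t = even u) \<noteq> d \<or> u = 0 \<and> v = n - 1"
  proof (cases "(t = even u) \<noteq> d")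
    case False
    have "(\<forall>x. \<not> (v < x \<and> x < n)) \<longleftrightarrow> v = n - 1"
    proof
      assume "\<forall>x. \<not> (v < x \<and> x < n)"
      then have "\<not> v + 1 < n" by auto
      then show "v = n - 1" using uv by linarith
    qed (use uv in auto)
    then show ?thesis using False by auto
  qed auto
  finally show ?thesis .
qed

lemma free_wedge_same:
  assumes sp: "interleaved t n cc" and b: "b < 2" and ij: "i < j" "j < class_size b n"
  shows "free_wedge d {..<n} cc (2 * i + b) (2 * j + b) \<longleftrightarrow>
    free_wedge d {..<class_size b n} (class_chirotope b cc) i j \<and>
    (if (t = (b = 0)) = d then \<forall>x\<in>parity_class (1 - b) n. \<not> x < 2 * i + b else \<forall>x\<in>parity_class (1 - b) n. \<not> 2 * j + b < x)"
proof -
  let ?u = "2 * i + b" and ?v = "2 * j + b"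
  have v: "?v < n" using ij b parity_class_member by blast
  have cc: "cc ?u ?v x = (t = (b = 0))" if "x \<in> parity_class (1 - b) n" for x
    using interleavedD[OF sp, of ?u ?v x] parity_class_even(2)[OF b that] v ij(1) b by (auto simp: less_2_cases_iff)
  have "free_wedge d {..<n} cc ?u ?v \<longleftrightarrow> free_wedge d (parity_class b n) cc ?u ?v \<and> free_wedge d (parity_class (1 - b) n) cc ?u ?v"
    unfolding parity_class_Un'(1)[OF b, symmetric] free_wedge_def by blast
  moreover have "free_wedge d (parity_class (1 - b) n) cc ?u ?v \<longleftrightarrow>
      (if (t = (b = 0)) = d then \<forall>x\<in>parity_class (1 - b) n. \<not> x < ?u else \<forall>x\<in>parity_class (1 - b) n. \<not> ?v < x)"
    unfolding free_wedge_def using cc by (auto simp: ij)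
  ultimately show ?thesis using free_wedge_class[OF b] by blast
qed

section \<open>The quadratic upper bound\<close>

lemma empty_triangle_image:
  assumes "inj_on f I" "A \<subseteq> I" "a \<in> I" "b \<in> I" "c \<in> I"
  shows "empty_triangle (f ` I) cc (\<lambda>i. i \<in> f ` A) (f a) (f b) (f c) \<longleftrightarrow>
    empty_triangle I (\<lambda>i j k. cc (f i) (f j) (f k)) (\<lambda>i. i \<in> A) a b c"
proof -
  have mem: "f i \<in> f ` A \<longleftrightarrow> i \<in> A" if "i \<in> I" for i
    using assms(1,2) that by (meson inj_on_image_mem_iff)
  have "f ` I - {f a, f b, f c} = f ` (I - {a, b, c})"
    using assms by (simp add: inj_on_image_set_diff)
  then show ?thesis by (simp add: empty_triangle_def in_cell_def mem assms)
qed

lemma signed_holes_image: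
  assumes f: "inj_on f I"
  shows "signed_holes k (f ` I) cc =
    (\<lambda>(A, B). (f ` A, f ` B)) ` signed_holes k I (\<lambda>i j k. cc (f i) (f j) (f k))"
proof -
  have iff: "(f ` A, f ` B) \<in> signed_holes k (f ` I) cc \<longleftrightarrow>
      (A, B) \<in> signed_holes k I (\<lambda>i j k. cc (f i) (f j) (f k))" if AB: "A \<union> B \<subseteq> I" for A B
  proof -
    have 1: "f ` A \<inter> f ` B = {} \<longleftrightarrow> A \<inter> B = {}"
      using f AB by (metis inj_on_image_Int image_is_empty Un_subset_iff)
    have 2: "card (f ` (A \<union> B)) = card (A \<union> B)"
      using f AB by (metis card_image inj_on_subset)
    have inj: "f a = f b \<longleftrightarrow> a = b" if "a \<in> A \<union> B" "b \<in> A \<union> B" for a b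
      using f AB that by (meson inj_on_eq_iff subset_eq)
    have cl: "empty_triangle (f ` I) cc (\<lambda>i. i \<in> f ` A) (f a) (f b) (f c) \<longleftrightarrow>
        empty_triangle I (\<lambda>i j k. cc (f i) (f j) (f k)) (\<lambda>i. i \<in> A) a b c"
      if "a \<in> A \<union> B" "b \<in> A \<union> B" "c \<in> A \<union> B" for a b c
      using AB that by (intro empty_triangle_image f) auto
    have 3: "(\<forall>x\<in>A \<union> B. \<forall>y\<in>A \<union> B. \<forall>z\<in>A \<union> B. f x \<noteq> f y \<longrightarrow> f x \<noteq> f z \<longrightarrow> f y \<noteq> f z \<longrightarrow>
          empty_triangle (f ` I) cc (\<lambda>i. i \<in> f ` A) (f x) (f y) (f z)) \<longleftrightarrow>
        (\<forall>x\<in>A \<union> B. \<forall>y\<in>A \<union> B. \<forall>z\<in>A \<union> B. x \<noteq> y \<longrightarrow> x \<noteq> z \<longrightarrow> y \<noteq> z \<longrightarrow>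
          empty_triangle I (\<lambda>i j k. cc (f i) (f j) (f k)) (\<lambda>i. i \<in> A) x y z)"
      by (intro ball_cong refl) (simp only: inj cl)
    have 4: "f ` (A \<union> B) \<subseteq> f ` I" using AB by (rule image_mono)
    show ?thesis
      unfolding signed_holes_def mem_Collect_eq prod.case 1 image_Un[symmetric] ball_simps(9) 2 3
      using AB 4 by simp
  qed
  show ?thesis
  proof (intro set_eqI iffI)
    fix S assume "S \<in> signed_holes k (f ` I) cc"
    moreover obtain A B where S: "S = (A, B)" by (cases S)
    ultimately have AB: "A \<subseteq> f ` I" "B \<subseteq> f ` I" and h: "(A, B) \<in> signed_holes k (f ` I) cc"
      by (auto simp: signed_holes_def)
    obtain A' B' where A': "A' \<subseteq> I" "A = f ` A'" "B' \<subseteq> I" "B = f ` B'"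
      using AB by (metis subset_image_iff)
    then show "S \<in> (\<lambda>(A, B). (f ` A, f ` B)) ` signed_holes k I (\<lambda>i j k. cc (f i) (f j) (f k))"
      using h iff[of A' B'] S by auto
  next
    fix S assume "S \<in> (\<lambda>(A, B). (f ` A, f ` B)) ` signed_holes k I (\<lambda>i j k. cc (f i) (f j) (f k))"
    then obtain A B where S: "S = (f ` A, f ` B)" "(A, B) \<in> signed_holes k I (\<lambda>i j k. cc (f i) (f j) (f k))"
      by auto
    then have "A \<union> B \<subseteq> I" by (auto simp: signed_holes_def)
    then show "S \<in> signed_holes k (f ` I) cc" using iff S by blast
  qed
qed

lemma signed_holes_restrict:
  assumes "(A, B) \<in> signed_holes k I cc" "A \<union> B \<subseteq> J" "J \<subseteq> I"
  shows "(A, B) \<in> signed_holes k J cc"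
proof -
  have "empty_triangle J cc e a b c" if "empty_triangle I cc e a b c" for e a b c
    using that assms(3) by (auto simp: empty_triangle_def)
  then show ?thesis using assms unfolding signed_holes_def by simp
qed

lemma signed_holes_empty_triangle:
  assumes "(A, B) \<in> signed_holes k I cc" "a \<in> A \<union> B" "b \<in> A \<union> B" "c \<in> A \<union> B" "a \<noteq> b" "a \<noteq> c" "b \<noteq> c"
  shows "empty_triangle I cc (\<lambda>i. i \<in> A) a b c"
  using assms unfolding signed_holes_def by simp

lemma finite_signed_holes: assumes "finite I" shows "finite (signed_holes k I cc)"
proof (rule finite_subset)
  show "signed_holes k I cc \<subseteq> Pow I \<times> Pow I" by (auto simp: signed_holes_def)
qed (use assms in auto)

lemma signed_holes_class:
  assumes b: "b < 2" and h: "(A, B) \<in> signed_holes k {..<n} cc" "A \<union> B \<subseteq> parity_class b n"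
  shows "(A, B) \<in> (\<lambda>(A, B). ((\<lambda>i. 2 * i + b) ` A, (\<lambda>i. 2 * i + b) ` B)) ` signed_holes k {..<class_size b n} (class_chirotope b cc)"
proof -
  have "(A, B) \<in> signed_holes k (parity_class b n) cc"
    using h by (rule signed_holes_restrict) (auto simp: parity_class_def)
  moreover have "inj_on (\<lambda>i. 2 * i + b) {..<class_size b n}" by (auto simp: inj_on_def)
  ultimately show ?thesis
    unfolding parity_class_image[OF b] by (simp add: signed_holes_image class_chirotope_def[abs_def])
qed

text \<open>By \<open>mixed_empty_triangle_iff\<close> the vertices of one sign in one class form a clique as soon as the hole
has a vertex in the other class.\<close>

definition cliques :: "bool \<Rightarrow> nat set \<Rightarrow> nat chirotope \<Rightarrow> nat set set" where
  "cliques d X cc = {P. P \<subseteq> X \<and> (\<forall>p\<in>P. \<forall>q\<in>P. p < q \<longrightarrow> free_side d X cc p q)}"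

lemma finite_cliques: "finite X \<Longrightarrow> finite (cliques d X cc)"
  by (rule finite_subset[of _ "Pow X"]) (auto simp: cliques_def)

lemma cliques_class:
  assumes b: "b < 2"
  shows "cliques d (parity_class b n) cc \<subseteq> (`) (\<lambda>i. 2 * i + b) ` cliques d {..<class_size b n} (class_chirotope b cc)"
proof
  fix P assume P: "P \<in> cliques d (parity_class b n) cc"
  then obtain P' where P': "P' \<subseteq> {..<class_size b n}" "P = (\<lambda>i. 2 * i + b) ` P'"
    unfolding cliques_def parity_class_image[OF b] by (auto simp: subset_image_iff)
  have "P' \<in> cliques d {..<class_size b n} (class_chirotope b cc)"
    using P P' free_side_class[OF b] by (auto simp: cliques_def)
  then show "P \<in> (`) (\<lambda>i. 2 * i + b) ` cliques d {..<class_size b n} (class_chirotope b cc)" using P'(2) by blast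
qed

lemma card_cliques_class:
  "b < 2 \<Longrightarrow> card (cliques d (parity_class b n) cc) \<le> card (cliques d {..<class_size b n} (class_chirotope b cc))"
  by (meson cliques_class finite_cliques finite_lessThan surj_card_le)

lemma card_class: "b < 2 \<Longrightarrow> card (parity_class b n) = class_size b n"
  by (simp add: parity_class_image card_image inj_on_def)

text \<open>Two points of the class away from side \<open>d\<close> are separated by a point of the other class on side \<open>d\<close>.
So a clique contains at most one such point, and apart from it only the two neighbours of this point
are possible. This makes the number of cliques linear.\<close>

lemma cliques_split:
  fixes d
  assumes alt: "alternating {..<n} cc" and sp: "interleaved t n cc"
  defines "b \<equiv> (if t = d then 1 else 0 :: nat)"
  shows "cliques d {..<n} cc \<subseteq> cliques d (parity_class b n) cc \<union> (\<Union>p\<in>parity_class (1 - b) n. Pow {p - 1, p, p + 1})"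
proof
  fix P assume P: "P \<in> cliques d {..<n} cc"
  have b: "b < 2" "1 - b < 2" by (auto simp: b_def)
  have bad: "(t = (1 - b = 0)) = d" by (auto simp: b_def)
  show "P \<in> cliques d (parity_class b n) cc \<union> (\<Union>p\<in>parity_class (1 - b) n. Pow {p - 1, p, p + 1})"
  proof (cases "P \<subseteq> parity_class b n")
    case True
    have "parity_class b n \<subseteq> {..<n}" by (auto simp: parity_class_def)
    then have "P \<in> cliques d (parity_class b n) cc"
      using P True unfolding cliques_def free_side_def by blast
    then show ?thesis by blast
  next
    case False
    then obtain p where p: "p \<in> P" "p \<in> parity_class (1 - b) n"
      using P parity_class_Un'(1)[OF b(1)] unfolding cliques_def by blast
    have same: False if q: "u \<in> P" "v \<in> P" "u < v" "u \<in> parity_class (1 - b) n" "v \<in> parity_class (1 - b) n" for u v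
    proof -
      obtain i j where ij: "u = 2 * i + (1 - b)" "v = 2 * j + (1 - b)" "j < class_size (1 - b) n"
        using q(4,5) parity_class_image[OF b(2), of n] by auto
      then have "\<not> free_side d {..<n} cc u v"
        using free_side_same[OF sp b(2), of i j d] q(3) bad by auto
      then show False using P q by (auto simp: cliques_def)
    qed
    have "q \<in> {p - 1, p, p + 1}" if q: "q \<in> P" for q
    proof (cases "q \<in> parity_class (1 - b) n")
      case True
      then show ?thesis using same[of p q] same[of q p] p q by (metis insertCI linorder_neqE_nat)
    next
      case False
      have qn: "q < n" "p < n" using P p q by (auto simp: cliques_def)
      then have "q \<in> parity_class b n" using False parity_class_Un'(1)[OF b(1)] by blast
      then have par: "even q \<noteq> even p" using p(2) parity_class_even[OF b(1)] by blast
      then have "q \<noteq> p" by auto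
      then consider "p < q" | "q < p" by linarith
      then show ?thesis
      proof cases
        case 1
        then have "free_side d {..<n} cc p q" using P p q by (auto simp: cliques_def)
        then show ?thesis using free_side_diff[OF alt sp 1 qn(1)] par by simp
      next
        case 2
        then have "free_side d {..<n} cc q p" using P p q by (auto simp: cliques_def)
        then show ?thesis using free_side_diff[OF alt sp 2 qn(2)] par by simp
      qed
    qed
    then show ?thesis using p by blast
  qed
qed

lemma card_cliques:
  assumes "horton_chirotope T n cc" "alternating {..<n} cc"
  shows "card (cliques d {..<n} cc) \<le> 8 * n + 1"
  using assms
proof (induction rule: horton_chirotope.induct)
  case (chirotope_small n cc)
  have "cliques d {..<n} cc \<subseteq> Pow {..<n}" by (auto simp: cliques_def)
  then have "card (cliques d {..<n} cc) \<le> 2 ^ n"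
    by (metis card_Pow card_lessThan card_mono finite_Pow_iff finite_lessThan)
  also have "\<dots> \<le> 8 * n + 1" using chirotope_small.hyps by (cases n) auto
  finally show ?case .
next
  case (chirotope_step n t cc)
  define b where "b = (if t = d then 1 else 0 :: nat)"
  have b: "b < 2" "1 - b < 2" by (auto simp: b_def)
  have IH: "card (cliques d {..<class_size b n} (class_chirotope b cc)) \<le> 8 * class_size b n + 1"
    using chirotope_step.IH chirotope_step.prems alternating_class b(1) by (cases "t = d") (auto simp: b_def)
  have "card (cliques d {..<n} cc) \<le> card (cliques d (parity_class b n) cc \<union> (\<Union>p\<in>parity_class (1 - b) n. Pow {p - 1, p, p + 1}))"
    using cliques_split[OF chirotope_step.prems chirotope_step.hyps(3), of d, folded b_def]
    by (intro card_mono finite_UnI finite_UN_I finite_cliques) (auto simp: parity_class_def)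
  also have "\<dots> \<le> card (cliques d (parity_class b n) cc) + card (\<Union>p\<in>parity_class (1 - b) n. Pow {p - 1, p, p + 1})"
    by (rule card_Un_le)
  also have "card (\<Union>p\<in>parity_class (1 - b) n. Pow {p - 1, p, p + 1}) \<le> (\<Sum>p\<in>parity_class (1 - b) n. card (Pow {p - 1, p, p + 1}))"
    by (rule card_UN_le) (auto simp: parity_class_def)
  also have "\<dots> \<le> (\<Sum>p\<in>parity_class (1 - b) n. 8)"
  proof (rule sum_mono)
    fix p :: nat
    have "card {p - 1, p, p + 1} \<le> 3" by (simp add: card_insert_if)
    then have "(2::nat) ^ card {p - 1, p, p + 1} \<le> 2 ^ 3" by (intro power_increasing) auto
    then show "card (Pow {p - 1, p, p + 1}) \<le> 8" by (simp add: card_Pow)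
  qed
  also have "\<dots> = 8 * class_size (1 - b) n" using card_class[OF b(2)] by simp
  finally have "card (cliques d {..<n} cc) \<le> (8 * class_size b n + 1) + 8 * class_size (1 - b) n"
    using card_cliques_class[OF b(1), of d n cc] IH by linarith
  moreover have "class_size b n + class_size (1 - b) n = n" using class_size_sum[of n] by (auto simp: b_def)
  ultimately show ?case by linarith
qed

definition sided :: "nat set \<Rightarrow> nat chirotope \<Rightarrow> nat set set" where
  "sided X cc = cliques True X cc \<union> cliques False X cc"

definition extremes :: "nat set \<Rightarrow> nat set" where
  "extremes Y = {y \<in> Y. (\<forall>x\<in>Y. y \<le> x) \<or> (\<forall>x\<in>Y. x \<le> y)}"

lemma card_Pow_extremes: "finite Y \<Longrightarrow> finite (Pow (extremes Y)) \<and> card (Pow (extremes Y)) \<le> 4"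
proof -
  assume fin: "finite Y"
  have "extremes Y \<subseteq> {Min Y, Max Y}"
    using fin by (auto simp: extremes_def intro!: Min_eqI[symmetric] Max_eqI[symmetric])
  then have "card (extremes Y) \<le> card {Min Y, Max Y}" by (intro card_mono) auto
  also have "\<dots> \<le> 2" by (simp add: card_insert_if)
  finally have "(2::nat) ^ card (extremes Y) \<le> 2 ^ 2" by (intro power_increasing) auto
  moreover have "finite (extremes Y)" using fin by (simp add: extremes_def)
  ultimately show ?thesis by (simp add: card_Pow)
qed

context separated_classes
begin

lemma hole_part_sided:
  assumes h: "(A, B) \<in> signed_holes k (X \<union> Y) cc" and r: "r \<in> A \<union> B" "r \<in> Y"
  shows "A \<inter> X \<in> sided X cc" "B \<inter> X \<in> sided X cc"
proof -
  have disjAB: "A \<inter> B = {}" using h by (auto simp: signed_holes_def)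
  have part: "S \<inter> X \<in> cliques (((r \<in> A) = s) = d) X cc" if S: "S \<subseteq> A \<union> B" "\<And>p. p \<in> S \<Longrightarrow> (p \<in> A) = s" for S s
    unfolding cliques_def
  proof (intro CollectI conjI ballI impI)
    fix p q assume pq: "p \<in> S \<inter> X" "q \<in> S \<inter> X" "p < q"
    then have "empty_triangle (X \<union> Y) cc (\<lambda>i. i \<in> A) p q r"
      using pq r disj S(1) by (intro signed_holes_empty_triangle[OF h]) auto
    then show "free_side (((r \<in> A) = s) = d) X cc p q"
      using mixed_empty_triangle_iff[of p q r "\<lambda>i. i \<in> A"] pq r S(2) by auto
  qed auto
  have "A \<inter> X \<in> cliques (((r \<in> A) = True) = d) X cc" by (rule part) auto
  then show "A \<inter> X \<in> sided X cc" by (cases "((r \<in> A) = True) = d") (auto simp: sided_def)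
  have "B \<inter> X \<in> cliques (((r \<in> A) = False) = d) X cc" by (rule part) (use disjAB in auto)
  then show "B \<inter> X \<in> sided X cc" by (cases "((r \<in> A) = False) = d") (auto simp: sided_def)
qed

text \<open>If a class carries vertices of both signs, then every vertex in the other class is its first or its
last point; this compensates for the larger number of choices in the first class.\<close>

lemma hole_part_extreme:
  assumes h: "(A, B) \<in> signed_holes k (X \<union> Y) cc" and r: "r \<in> A \<union> B" "r \<in> Y"
    and pq: "p \<in> A \<inter> X" "q \<in> B \<inter> X"
  shows "r \<in> extremes Y"
proof -
  have disjAB: "A \<inter> B = {}" using h by (auto simp: signed_holes_def)
  have ext: "r \<in> extremes Y" if u: "u \<in> (A \<union> B) \<inter> X" "v \<in> (A \<union> B) \<inter> X" "u < v" "(u \<in> A) \<noteq> (v \<in> A)" for u v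
  proof -
    have "empty_triangle (X \<union> Y) cc (\<lambda>i. i \<in> A) u v r"
      using r disj u by (intro signed_holes_empty_triangle[OF h]) auto
    then have "\<forall>y\<in>Y. if (r \<in> A) = (u \<in> A) then r \<le> y else y \<le> r"
      using mixed_empty_triangle_iff[of u v r "\<lambda>i. i \<in> A"] u r by auto
    then show ?thesis using r by (cases "(r \<in> A) = (u \<in> A)") (auto simp: extremes_def)
  qed
  have "p \<noteq> q" "q \<notin> A" using pq disjAB by auto
  then show ?thesis using ext[of p q] ext[of q p] pq by (metis IntE IntI UnCI linorder_neqE_nat)
qed

text \<open>A hole is determined by its four parts, given by class and sign. Either at most one sign occurs in
each class, which leaves four times at most \<open>q * q\<close> choices, or one class carries both signs and the
vertices in the other class are among two points, which leaves twice sixteen times \<open>q * q\<close> choices.\<close>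

lemma card_mixed_holes:
  assumes fin: "finite X" "finite Y" and q: "card (sided X cc) \<le> q" "card (sided Y cc) \<le> q"
  shows "card {(A, B) \<in> signed_holes k (X \<union> Y) cc. (A \<union> B) \<inter> X \<noteq> {} \<and> (A \<union> B) \<inter> Y \<noteq> {}} \<le> 36 * q\<^sup>2"
    (is "card ?M \<le> _")
proof -
  interpret YX: separated_classes Y X cc "\<not> d" by (rule swap)
  let ?SX = "sided X cc" and ?SY = "sided Y cc" and ?EX = "Pow (extremes X)" and ?EY = "Pow (extremes Y)"
  let ?parts = "\<lambda>(A, B). ((A \<inter> X, B \<inter> X), (A \<inter> Y, B \<inter> Y))"
  have finS: "finite ?SX" "finite ?SY" using fin by (auto simp: sided_def finite_cliques)
  define T1 where "T1 = (?SX \<times> ?SX) \<times> (?EY \<times> ?EY)"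
  define T2 where "T2 = (?EX \<times> ?EX) \<times> (?SY \<times> ?SY)"
  define T3 where "T3 = (?SX \<times> {{}} \<union> {{}} \<times> ?SX) \<times> (?SY \<times> {{}} \<union> {{}} \<times> ?SY)"
  have fT: "finite T1" "finite T2" "finite T3"
    using finS card_Pow_extremes[OF fin(1)] card_Pow_extremes[OF fin(2)] by (simp_all add: T1_def T2_def T3_def)
  have inj: "inj_on ?parts ?M"
  proof (rule inj_onI, clarify)
    fix A B A' B' assume h: "(A, B) \<in> signed_holes k (X \<union> Y) cc" "(A', B') \<in> signed_holes k (X \<union> Y) cc"
      and eq: "A \<inter> X = A' \<inter> X" "B \<inter> X = B' \<inter> X" "A \<inter> Y = A' \<inter> Y" "B \<inter> Y = B' \<inter> Y"
    have "A \<union> B \<subseteq> X \<union> Y" "A' \<union> B' \<subseteq> X \<union> Y" using h by (auto simp: signed_holes_def)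
    then show "A = A' \<and> B = B'" using eq by blast
  qed
  have "?parts ` ?M \<subseteq> T1 \<union> T2 \<union> T3"
  proof (rule image_subsetI, clarify)
    fix A B x y assume h: "(A, B) \<in> signed_holes k (X \<union> Y) cc"
      and ne: "(A \<union> B) \<inter> X \<noteq> {}" "(A \<union> B) \<inter> Y \<noteq> {}"
      and not: "((A \<inter> X, B \<inter> X), (A \<inter> Y, B \<inter> Y)) \<notin> T3" "((A \<inter> X, B \<inter> X), (A \<inter> Y, B \<inter> Y)) \<notin> T2"
    obtain r where r: "r \<in> A \<union> B" "r \<in> Y" using ne by blast
    obtain s where s: "s \<in> A \<union> B" "s \<in> X" using ne by blast
    have h': "(A, B) \<in> signed_holes k (Y \<union> X) cc" using h by (simp add: Un_commute)
    have SX: "A \<inter> X \<in> ?SX" "B \<inter> X \<in> ?SX" by (rule hole_part_sided[OF h r])+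
    have SY: "A \<inter> Y \<in> ?SY" "B \<inter> Y \<in> ?SY" by (rule YX.hole_part_sided[OF h' s])+
    have "\<not> (A \<inter> Y \<noteq> {} \<and> B \<inter> Y \<noteq> {})"
    proof
      assume "A \<inter> Y \<noteq> {} \<and> B \<inter> Y \<noteq> {}"
      then obtain p q where "p \<in> A \<inter> Y" "q \<in> B \<inter> Y" by blast
      then have "A \<inter> X \<subseteq> extremes X" "B \<inter> X \<subseteq> extremes X"
        using YX.hole_part_extreme[OF h'] by blast+
      then show False using not(2) SY by (simp add: T2_def)
    qed
    then have "A \<inter> X \<noteq> {} \<and> B \<inter> X \<noteq> {}" using not(1) SX SY by (auto simp: T3_def)
    then obtain p q where "p \<in> A \<inter> X" "q \<in> B \<inter> X" by blast
    then have "A \<inter> Y \<subseteq> extremes Y" "B \<inter> Y \<subseteq> extremes Y"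
      using hole_part_extreme[OF h] by blast+
    then show "((A \<inter> X, B \<inter> X), (A \<inter> Y, B \<inter> Y)) \<in> T1" using SX by (simp add: T1_def)
  qed
  then have "card ?M \<le> card (T1 \<union> T2 \<union> T3)" using fT by (intro card_inj_on_le[OF inj]) auto
  also have "\<dots> \<le> card T1 + card T2 + card T3"
    using card_Un_le[of "T1 \<union> T2" T3] card_Un_le[of T1 T2] by linarith
  also have "card T1 \<le> (q * q) * (4 * 4)"
    unfolding T1_def card_cartesian_product
    using q card_Pow_extremes[OF fin(2)] by (intro mult_mono) auto
  also have "card T2 \<le> (4 * 4) * (q * q)"
    unfolding T2_def card_cartesian_product
    using q card_Pow_extremes[OF fin(1)] by (intro mult_mono) auto
  also have "card T3 \<le> (q + q) * (q + q)"
  proof -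
    have "card (S \<times> {{}} \<union> {{}} \<times> S) \<le> q + q" if "card S \<le> q" for S :: "nat set set"
      using that card_Un_le[of "S \<times> {{}}" "{{}} \<times> S"] by (simp add: card_cartesian_product)
    then show ?thesis unfolding T3_def card_cartesian_product using q by (intro mult_mono) auto
  qed
  finally show ?thesis by (simp add: power2_eq_square algebra_simps)
qed

end

lemma card_sided_class:
  assumes "b < 2" "horton_chirotope T (class_size b n) (class_chirotope b cc)" "alternating {..<n} cc" "n \<ge> 1"
  shows "card (sided (parity_class b n) cc) \<le> 18 * n"
proof -
  have c: "card (cliques d (parity_class b n) cc) \<le> 8 * n + 1" for d
  proof -
    have "card (cliques d (parity_class b n) cc) \<le> card (cliques d {..<class_size b n} (class_chirotope b cc))"
      by (rule card_cliques_class[OF assms(1)])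
    also have "\<dots> \<le> 8 * class_size b n + 1"
      using card_cliques[OF assms(2)] alternating_class[OF assms(3,1)] by blast
    also have "class_size b n \<le> n" using assms(4) by (simp add: class_size_def)
    finally show ?thesis by simp
  qed
  have "card (sided (parity_class b n) cc) \<le> card (cliques True (parity_class b n) cc) + card (cliques False (parity_class b n) cc)"
    unfolding sided_def by (rule card_Un_le)
  then show ?thesis using c[of True] c[of False] assms(4) by linarith
qed

text \<open>The holes with vertices in both classes are quadratically many, and the other ones are holes of one
of the classes. The constant is four times the constant 36 * 18 * 18 for mixed holes, so that the
recursion closes.\<close>

theorem card_signed_holes_le:
  assumes "horton_chirotope T n cc" "alternating {..<n} cc" "2 \<le> k"
  shows "card (signed_holes k {..<n} cc) \<le> 46656 * n\<^sup>2"
  using assms(1,2)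
proof (induction rule: horton_chirotope.induct)
  case (chirotope_small n cc)
  have "signed_holes k {..<n} cc = {}"
  proof (rule ccontr)
    assume "signed_holes k {..<n} cc \<noteq> {}"
    then obtain A B where "A \<union> B \<subseteq> {..<n}" "card (A \<union> B) = k" by (auto simp: signed_holes_def)
    then have "k \<le> n" by (metis card_lessThan card_mono finite_lessThan)
    then show False using chirotope_small.hyps assms(3) by linarith
  qed
  then show ?case by simp
next
  case (chirotope_step n t cc)
  interpret separated_classes "parity_class 0 n" "parity_class 1 n" cc t
    using separated_parity_classes[OF chirotope_step.prems chirotope_step.hyps(3), of 0] by simp
  let ?H = "signed_holes k {..<n} cc"
  let ?img = "\<lambda>b (A, B). ((\<lambda>i. 2 * i + b) ` A, (\<lambda>i::nat. 2 * i + b) ` B)"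
  let ?M = "{(A, B) \<in> signed_holes k (parity_class 0 n \<union> parity_class 1 n) cc. (A \<union> B) \<inter> parity_class 0 n \<noteq> {} \<and> (A \<union> B) \<inter> parity_class 1 n \<noteq> {}}"
  let ?N = "\<lambda>b. signed_holes k {..<class_size b n} (class_chirotope b cc)"
  have sub: "?H \<subseteq> ?img 0 ` ?N 0 \<union> ?img 1 ` ?N 1 \<union> ?M"
  proof (rule subsetI, clarify)
    fix A B assume h: "(A, B) \<in> ?H" and n: "(A, B) \<notin> ?img 1 ` ?N 1" "(A, B) \<notin> ?img 0 ` ?N 0"
    have AB: "A \<union> B \<subseteq> parity_class 0 n \<union> parity_class 1 n" using h unfolding parity_class_Un(1) by (auto simp: signed_holes_def)
    have nsub: "\<not> A \<union> B \<subseteq> parity_class 0 n" "\<not> A \<union> B \<subseteq> parity_class 1 n"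
      using signed_holes_class[of 0, OF _ h] signed_holes_class[of 1, OF _ h] n by auto
    then show "(A, B) \<in> signed_holes k (parity_class 0 n \<union> parity_class 1 n) cc \<and> (A \<union> B) \<inter> parity_class 0 n \<noteq> {} \<and> (A \<union> B) \<inter> parity_class 1 n \<noteq> {}"
    proof (intro conjI)
      show "(A, B) \<in> signed_holes k (parity_class 0 n \<union> parity_class 1 n) cc" using h unfolding parity_class_Un(1) .
      show "(A \<union> B) \<inter> parity_class 0 n \<noteq> {}" "(A \<union> B) \<inter> parity_class 1 n \<noteq> {}" using AB nsub by blast+
    qed
  qed
  have fM: "finite ?M" using finite_signed_holes[of "parity_class 0 n \<union> parity_class 1 n" k cc] unfolding parity_class_Un(1)
    by (rule finite_subset[rotated]) auto
  have "card ?H \<le> card (?img 0 ` ?N 0 \<union> ?img 1 ` ?N 1 \<union> ?M)"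
    using fM by (intro card_mono[OF _ sub] finite_UnI finite_imageI finite_signed_holes) auto
  also have "\<dots> \<le> card (?N 0) + card (?N 1) + card ?M"
    using card_Un_le[of "?img 0 ` ?N 0 \<union> ?img 1 ` ?N 1" ?M] card_Un_le[of "?img 0 ` ?N 0" "?img 1 ` ?N 1"]
      card_image_le[of "?N 0" "?img 0"] card_image_le[of "?N 1" "?img 1"]
      finite_signed_holes[of "{..<class_size 0 n}" k "class_chirotope 0 cc"] finite_signed_holes[of "{..<class_size 1 n}" k "class_chirotope 1 cc"]
    by simp
  also have "card (?N 0) \<le> 46656 * (class_size 0 n)\<^sup>2"
    using chirotope_step.IH(1) alternating_class[OF chirotope_step.prems] by simp
  also have "card (?N 1) \<le> 46656 * (class_size 1 n)\<^sup>2"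
    using chirotope_step.IH(2) alternating_class[OF chirotope_step.prems] by simp
  also have "card ?M \<le> 36 * (18 * n)\<^sup>2"
    using chirotope_step.hyps chirotope_step.prems by (intro card_mixed_holes card_sided_class) (auto simp: parity_class_def)
  finally have "card ?H \<le> 46656 * ((class_size 0 n)\<^sup>2 + (class_size 1 n)\<^sup>2) + 11664 * n\<^sup>2"
    by (simp add: power_mult_distrib)
  also have "\<dots> \<le> 46656 * n\<^sup>2"
  proof -
    \<comment> \<open>The two classes are almost equally large, so that the product of their sizes is at least
      an eighth of the square of the sum.\<close>
    obtain c where c: "class_size 1 n = c" "c \<ge> 1" "class_size 0 n = c \<or> class_size 0 n = c + 1"
    proof -
      have "class_size 1 n \<ge> 1" "class_size 0 n = class_size 1 n \<or> class_size 0 n = class_size 1 n + 1"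
        using chirotope_step.hyps(1) unfolding class_size_def by (simp; presburger)+
      then show ?thesis using that by blast
    qed
    have n: "n = class_size 0 n + c" using class_size_sum[of n] c(1) by simp
    from c(3) show ?thesis
    proof
      assume "class_size 0 n = c" then show ?thesis using n c(1)
        by (simp add: power2_eq_square algebra_simps)
    next
      assume e: "class_size 0 n = c + 1"
      have "1 \<le> c * c" "c \<le> c * c" using c(2) by (simp_all add: Suc_le_eq)
      then show ?thesis using e n c(1)
        by (simp add: power2_eq_square algebra_simps)
    qed
  qed
  finally show ?case .
qed

section \<open>The quadratic lower bound\<close>

lemma empty_triangle_fan_sorted:
  fixes r :: nat
  assumes alt: "alternating I cc" and G: "G \<subseteq> I" "r \<in> G"
    and sorted: "\<And>p q. p \<in> G - {r} \<Longrightarrow> q \<in> G - {r} \<Longrightarrow> p < q \<Longrightarrow> empty_triangle I cc e p q r"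
    and abc: "a \<in> G" "b \<in> G" "c \<in> G" "distinct [a, b, c]" "r \<in> {a, b, c}"
  shows "empty_triangle I cc e a b c"
proof -
  have pq: "empty_triangle I cc e p q r" if "p \<in> G" "q \<in> G" "p \<noteq> q" "p \<noteq> r" "q \<noteq> r" for p q
    using sorted[of p q] sorted[of q p] empty_triangle_permute(1)[OF alt, of p q r e] that G
    by (metis Diff_iff linorder_neqE_nat singletonD subsetD)
  have I: "a \<in> I" "b \<in> I" "c \<in> I" using G abc by auto
  consider "r = a" | "r = b" | "r = c" using abc by auto
  then show ?thesis
  proof cases
    case 1
    then have "empty_triangle I cc e b c a" using pq[of b c] abc by auto
    then show ?thesis using empty_triangle_permute[OF alt, of b a c e] empty_triangle_permute[OF alt, of a b c e] I abc(4)
      by (metis alt empty_triangle_permute(1) empty_triangle_permute(2) distinct_length_2_or_more)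
  next
    case 2
    then have "empty_triangle I cc e a c b" using pq[of a c] abc by auto
    then show ?thesis using empty_triangle_permute(2)[OF alt, of a b c e] I abc(4) by auto
  next
    case 3
    then show ?thesis using pq[of a b] abc by auto
  qed
qed

lemma in_cell_sort:
  fixes a b c :: nat
  assumes alt: "alternating I cc" and I: "a \<in> I" "b \<in> I" "c \<in> I" "distinct [a, b, c]" "p \<in> I - {a, b, c}"
  obtains x y z where "{x, y, z} = {a, b, c}" "x < y" "y < z" "in_cell cc e x y z p = in_cell cc e a b c p"
proof -
  note perm = in_cell_permute[OF alt, where p = p and e = e]
  have s: "a \<noteq> b" "a \<noteq> c" "b \<noteq> c" "p \<in> I - {b, a, c}" "p \<in> I - {a, c, b}" "p \<in> I - {b, c, a}"
    "p \<in> I - {c, a, b}" using I by auto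
  have e1: "in_cell cc e b a c p = in_cell cc e a b c p" and e2: "in_cell cc e a c b p = in_cell cc e a b c p"
    using perm[of a b c] I s by auto
  have e3: "in_cell cc e b c a p = in_cell cc e a b c p" using perm(2)[of b a c] e1 I s by auto
  have e4: "in_cell cc e c a b p = in_cell cc e a b c p" using perm(1)[of a c b] e2 I s by auto
  have e5: "in_cell cc e c b a p = in_cell cc e a b c p" using perm(1)[of b c a] e3 I s by auto
  consider "a < b" "b < c" | "a < c" "c < b" | "b < a" "a < c" | "b < c" "c < a" | "c < a" "a < b" | "c < b" "b < a"
    using s(1-3) by linarith
  then show ?thesis
  proof cases
    case 1 then show ?thesis using that[of a b c] by simp
  next
    case 2 then show ?thesis using that[of a c b] e2 by (simp add: insert_commute)
  next
    case 3 then show ?thesis using that[of b a c] e1 by (simp add: insert_commute)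
  next
    case 4 then show ?thesis using that[of b c a] e3 by (simp add: insert_commute)
  next
    case 5 then show ?thesis using that[of c a b] e4 by (simp add: insert_commute)
  next
    case 6 then show ?thesis using that[of c b a] e5 by (simp add: insert_commute)
  qed
qed

lemma free_side_adjacent: "free_side d X cc i (i + 1)" "free_side d X cc i (Suc i)"
  by (auto simp: free_side_def)

text \<open>Neighbours are always free. The outer two of three consecutive points belong to one class, with the
middle one as the only point between them; the parity \<open>\<gamma>\<close> is chosen such that this point is on the
harmless side.\<close>

lemma consecutive_triple:
  assumes "horton_chirotope T m cc"
  obtains \<gamma> where "\<gamma> < 2" "\<And>i x y. x < y \<Longrightarrow> y \<le> 2 \<Longrightarrow> 2 * i + \<gamma> + 2 < m \<Longrightarrow>
    free_side d {..<m} cc (2 * i + \<gamma> + x) (2 * i + \<gamma> + y)"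
  using assms
proof (cases rule: horton_chirotope.cases)
  case chirotope_small
  then show ?thesis using that[of 0] by simp
next
  case (chirotope_step t)
  define \<gamma> where "\<gamma> = (if t = d then 1 else 0 :: nat)"
  have g: "\<gamma> < 2" "(t = (\<gamma> = 0)) \<noteq> d" by (auto simp: \<gamma>_def)
  show ?thesis
  proof (rule that[OF g(1)])
    fix i x y :: nat assume xy: "x < y" "y \<le> 2" "2 * i + \<gamma> + 2 < m"
    show "free_side d {..<m} cc (2 * i + \<gamma> + x) (2 * i + \<gamma> + y)"
    proof (cases "y = x + 1")
      case True
      then show ?thesis using free_side_adjacent(2)[of d "{..<m}" cc "2 * i + \<gamma> + x"] by simp
    next
      case False
      then have 2: "x = 0" "y = 2" using xy by auto
      have "i + 1 < class_size \<gamma> m" using xy g(1) by (simp add: class_size_def)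
      then have "free_side d {..<m} cc (2 * i + \<gamma>) (2 * (i + 1) + \<gamma>)"
        using free_side_same[OF chirotope_step(3) g(1), of i "i + 1" d] g(2) free_side_adjacent by auto
      moreover have "2 * (i + 1) + \<gamma> = 2 * i + \<gamma> + 2" by simp
      ultimately show ?thesis unfolding 2 by (metis add_0_right)
    qed
  qed
qed

text \<open>The conditions of \<open>empty_triangle_by_fan\<close> with the point 1, the first one of the odd class, as apex.
It is always given the positive sign, so that no region is encoded twice.\<close>

definition fan_hole :: "nat \<Rightarrow> nat \<Rightarrow> nat chirotope \<Rightarrow> nat set \<times> nat set \<Rightarrow> bool" where
  "fan_hole k n cc S \<longleftrightarrow> (let A = fst S; B = snd S; G = A \<union> B; e = (\<lambda>i. i \<in> A) in
     G \<subseteq> {..<n} \<and> A \<inter> B = {} \<and> card G = k \<and> 1 \<in> A \<and>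
     (\<forall>a\<in>G. \<forall>b\<in>G. \<forall>c\<in>G. distinct [a, b, c] \<longrightarrow> 1 \<in> {a, b, c} \<longrightarrow> empty_triangle {..<n} cc e a b c) \<and>
     (\<forall>a\<in>G - {1}. \<forall>b\<in>G - {1}. \<forall>c\<in>G - {1}. distinct [a, b, c] \<longrightarrow> \<not> in_cell cc e a b c 1))"

text \<open>With apex 1 in the odd class and all other vertices in the even class, the triangles at the apex are
governed by \<open>mixed_empty_triangle_iff\<close>. The signs change only once from left to right in the even
class, so the apex, which can only be in triangles with exceptional middle vertex, is in none of the
triangles of the even class.\<close>

lemma fan_holeI:
  assumes alt_n: "alternating {..<n} cc" and sp: "interleaved t n cc" and n: "1 < n"
    and P: "P \<subseteq> parity_class 0 n" and Q: "Q \<subseteq> parity_class 0 n" and less: "\<And>p q. p \<in> P \<Longrightarrow> q \<in> Q \<Longrightarrow> p < q"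
    and fin: "finite P" "finite Q" "card P + card Q + 1 = k"
    and PP: "\<And>p q. p \<in> P \<Longrightarrow> q \<in> P \<Longrightarrow> p < q \<Longrightarrow> free_side t (parity_class 0 n) cc p q"
    and QQ: "\<And>p q. p \<in> Q \<Longrightarrow> q \<in> Q \<Longrightarrow> p < q \<Longrightarrow> free_side (\<not> t) (parity_class 0 n) cc p q"
    and PQ: "\<And>p q. p \<in> P \<Longrightarrow> q \<in> Q \<Longrightarrow> free_wedge t (parity_class 0 n) cc p q"
  shows "fan_hole k n cc (insert 1 P, Q)"
proof -
  interpret separated_classes "parity_class 0 n" "parity_class 1 n" cc t
    using separated_parity_classes[OF alt_n sp, of 0] by simp
  let ?e = "\<lambda>i. i \<in> insert 1 P" and ?G = "insert 1 P \<union> Q"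
  have PQ0: "P \<inter> Q = {}" using less by blast
  have one: "1 \<in> parity_class 1 n" "1 \<notin> P" "1 \<notin> Q" using n P Q by (auto simp: parity_class_def)
  have G: "?G \<subseteq> {..<n}" using P Q n by (auto simp: parity_class_def)
  have G1: "?G - {1} = P \<union> Q" using one by auto
  have G0: "?G - {1} \<subseteq> parity_class 0 n" using P Q by auto
  have notP: "q \<notin> P" if "q \<in> Q" for q using that PQ0 by blast
  have "card ?G = k"
  proof -
    have "card ?G = Suc (card (P \<union> Q))" using one fin by simp
    then show ?thesis using fin PQ0 by (simp add: card_Un_disjoint)
  qed
  have pq: "empty_triangle {..<n} cc ?e p q 1" if pq: "p \<in> ?G - {1}" "q \<in> ?G - {1}" "p < q" for p q
  proof -
    have mem: "p \<in> parity_class 0 n" "q \<in> parity_class 0 n" using pq G0 by auto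
    have PQ1: "p \<in> P \<union> Q" "q \<in> P \<union> Q" using pq unfolding G1 by auto
    have e: "?e p \<longleftrightarrow> p \<in> P" "?e q \<longleftrightarrow> q \<in> P" "?e 1 = True" using pq by auto
    have y: "\<forall>y\<in>parity_class 1 n. 1 \<le> y" by (auto simp: parity_class_def)
    have "empty_triangle (parity_class 0 n \<union> parity_class 1 n) cc ?e p q 1"
    proof (subst mixed_empty_triangle_iff[OF mem one(1) pq(3)], unfold e)
      consider "p \<in> P" "q \<in> P" | "p \<in> Q" "q \<in> Q" | "p \<in> P" "q \<in> Q"
        using PQ1 less[of q p] pq(3) by (metis UnE order_less_asym)
      then show "if (p \<in> P) = (q \<in> P) then free_side ((True = (p \<in> P)) = t) (parity_class 0 n) cc p q
        else free_wedge ((True = (p \<in> P)) = t) (parity_class 0 n) cc p q \<and>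
          (\<forall>y\<in>parity_class 1 n. if True = (p \<in> P) then 1 \<le> y else y \<le> 1)"
      proof cases
        case 1 then show ?thesis using PP[OF _ _ pq(3)] by simp
      next
        case 2 then show ?thesis using QQ[OF _ _ pq(3)] notP by simp
      next
        case 3 then show ?thesis using PQ notP y by simp
      qed
    qed
    then show ?thesis unfolding parity_class_Un(1) .
  qed
  have fan: "empty_triangle {..<n} cc ?e a b c" if "a \<in> ?G" "b \<in> ?G" "c \<in> ?G" "distinct [a, b, c]" "1 \<in> {a, b, c}" for a b c
    by (rule empty_triangle_fan_sorted[OF alt_n G _ pq]) (use that in auto)
  have out: "\<not> in_cell cc ?e a b c 1" if abc: "a \<in> ?G - {1}" "b \<in> ?G - {1}" "c \<in> ?G - {1}" "distinct [a, b, c]" for a b c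
  proof -
    have "1 \<in> {..<n} - {a, b, c}" using abc n by auto
    then obtain x y z where xyz: "{x, y, z} = {a, b, c}" "x < y" "y < z"
        "in_cell cc ?e x y z 1 = in_cell cc ?e a b c 1"
      using in_cell_sort[OF alt_n, of a b c 1 ?e] abc G by (metis Diff_iff subsetD)
    have "{x, y, z} \<subseteq> P \<union> Q" using abc(1-3) unfolding xyz(1) G1 by simp
    then have mem: "x \<in> P \<union> Q" "y \<in> P \<union> Q" "z \<in> P \<union> Q" by auto
    have "\<not> (?e x \<noteq> ?e y \<and> ?e z \<noteq> ?e y)"
      using mem less[of y x] less[of z y] xyz(2,3) one PQ0 by auto
    moreover have "in_cell cc ?e x y z 1 \<longleftrightarrow> ?e x \<noteq> ?e y \<and> ?e z \<noteq> ?e y"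
      using mem P Q xyz(2,3) one(1) by (intro mono_in_cell_iff) auto
    ultimately show ?thesis using xyz(4) by blast
  qed
  show ?thesis
    unfolding fan_hole_def Let_def fst_conv snd_conv
  proof (intro conjI ballI impI)
    show "?G \<subseteq> {..<n}" "card ?G = k" "1 \<in> insert 1 P" by (rule G, fact, simp)
    show "insert 1 P \<inter> Q = {}" using one PQ0 by simp
  qed (rule fan out; assumption)+
qed

text \<open>The even class is split once more. The positive vertices are consecutive in its class on side \<open>t\<close> and
the negative ones are consecutive in its other class, further to the right: any such pair has a free
wedge by \<open>free_wedge_diff\<close>. Each of the two groups has at most three points and can be placed in linearly
many ways, which gives quadratically many holes with up to \<open>1 + 3 + 3 = 7\<close> vertices.\<close>

lemma many_fan_holes:
  assumes h: "horton_chirotope T n cc" and alt: "alternating {..<n} cc" and n: "64 \<le> n"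
    and a: "1 \<le> a" "a \<le> 3" and b: "1 \<le> b" "b \<le> (3::nat)"
  shows "\<exists>F. finite F \<and> card F = ((n - 24) div 16)\<^sup>2 \<and> (\<forall>S\<in>F. fan_hole (1 + a + b) n cc S)"
proof -
  obtain t where t: "interleaved t n cc" "horton_chirotope T (class_size 0 n) (class_chirotope 0 cc)"
    using h n by (cases rule: horton_chirotope.cases) auto
  define m cc0 where "m = class_size 0 n" and "cc0 = class_chirotope 0 cc"
  have m: "n \<le> 2 * m" "32 \<le> m" using n by (auto simp: m_def class_size_def)
  have alt0: "alternating {..<m} cc0" unfolding m_def cc0_def by (rule alternating_class[OF alt]) simp
  obtain t' where t': "interleaved t' m cc0" "horton_chirotope T (class_size 0 m) (class_chirotope 0 cc0)" "horton_chirotope T (class_size 1 m) (class_chirotope 1 cc0)"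
    using t(2)[folded m_def cc0_def] m by (cases rule: horton_chirotope.cases) auto
  define \<beta> where "\<beta> = (if t' = t then 1 else 0 :: nat)"
  have \<beta>: "\<beta> < 2" "1 - \<beta> < 2" "(t' = (\<beta> = 0)) \<noteq> t" "(t' = (1 - \<beta> = 0)) \<noteq> (\<not> t)"
    by (auto simp: \<beta>_def)
  have hb: "horton_chirotope T (class_size \<beta> m) (class_chirotope \<beta> cc0)" "horton_chirotope T (class_size (1 - \<beta>) m) (class_chirotope (1 - \<beta>) cc0)"
    using t' by (auto simp: \<beta>_def)
  obtain \<gamma> where \<gamma>: "\<gamma> < 2" "\<And>i x y. x < y \<Longrightarrow> y \<le> 2 \<Longrightarrow> 2 * i + \<gamma> + 2 < class_size \<beta> m \<Longrightarrow>
      free_side t {..<class_size \<beta> m} (class_chirotope \<beta> cc0) (2 * i + \<gamma> + x) (2 * i + \<gamma> + y)"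
    using consecutive_triple[OF hb(1)] by metis
  obtain \<delta> where \<delta>: "\<delta> < 2" "\<And>i x y. x < y \<Longrightarrow> y \<le> 2 \<Longrightarrow> 2 * i + \<delta> + 2 < class_size (1 - \<beta>) m \<Longrightarrow>
      free_side (\<not> t) {..<class_size (1 - \<beta>) m} (class_chirotope (1 - \<beta>) cc0) (2 * i + \<delta> + x) (2 * i + \<delta> + y)"
    using consecutive_triple[OF hb(2)] by metis
  \<comment> \<open>The indices below are at most \<open>4 * M + 3\<close>, which has to be less than the number of points in
    a class of a class, hence about a quarter of \<open>n\<close>.\<close>
  define M where "M = (n - 24) div 16"
  have M: "4 * M + 3 < class_size \<beta> m" "4 * M + 3 < class_size (1 - \<beta>) m" "16 * M + 24 \<le> n"
    using n m(1) \<beta>(1) by (auto simp: M_def class_size_def)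
  define f where "f i x = 2 * (2 * (2 * i + \<gamma> + x) + \<beta>)" for i x
  define g where "g j y = 2 * (2 * (2 * j + \<delta> + y) + (1 - \<beta>))" for j y
  define P where "P i = f i ` {..<a}" for i
  define Q where "Q j = g j ` {..<b}" for j
  have inside_f: "2 * i + \<gamma> + x < class_size \<beta> m" if "i \<le> 2 * M" "x \<le> 2" for i x
    using that M \<gamma>(1) by linarith
  have inside_g: "2 * i + \<delta> + x < class_size (1 - \<beta>) m" if "i \<le> 2 * M" "x \<le> 2" for i x
    using that M \<delta>(1) by linarith
  have Psub: "P i \<subseteq> parity_class 0 n" if "i \<le> 2 * M" for i
  proof
    fix p assume "p \<in> P i"
    then obtain x where x: "x < a" "p = f i x" by (auto simp: P_def)
    have "2 * (2 * i + \<gamma> + x) + \<beta> < m" using inside_f[OF that, of x] x a by (intro parity_class_member \<beta>) auto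
    then show "p \<in> parity_class 0 n" using parity_class_member[of 0 "2 * (2 * i + \<gamma> + x) + \<beta>" n] x(2)
      by (simp add: parity_class_def f_def m_def)
  qed
  have Qsub: "Q i \<subseteq> parity_class 0 n" if "i \<le> 2 * M" for i
  proof
    fix p assume "p \<in> Q i"
    then obtain x where x: "x < b" "p = g i x" by (auto simp: Q_def)
    have "2 * (2 * i + \<delta> + x) + (1 - \<beta>) < m" using inside_g[OF that, of x] x b by (intro parity_class_member \<beta>) auto
    then show "p \<in> parity_class 0 n" using parity_class_member[of 0 "2 * (2 * i + \<delta> + x) + (1 - \<beta>)" n] x(2)
      by (simp add: parity_class_def g_def m_def)
  qed
  \<comment> \<open>Positions \<open>i < M\<close> for the positive and \<open>j > M\<close> for the negative vertices keep two steps apart,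
    so that the positive vertices are to the left of the negative ones.\<close>
  have hole: "fan_hole (1 + a + b) n cc (insert 1 (P i), Q j)" if ij: "i < M" "M < j" "j \<le> 2 * M" for i j
  proof (rule fan_holeI[OF alt t(1)])
    show "1 < n" using n by simp
    show "P i \<subseteq> parity_class 0 n" "Q j \<subseteq> parity_class 0 n" using Psub[of i] Qsub[of j] ij by auto
    show "finite (P i)" "finite (Q j)" by (auto simp: P_def Q_def)
    have "card (P i) = a" "card (Q j) = b"
      by (auto simp: P_def Q_def f_def g_def card_image inj_on_def)
    then show "card (P i) + card (Q j) + 1 = 1 + a + b" by simp
    have lt: "f i x < g j y" if "x \<le> 2" for x y
    proof -
      have "i + 2 \<le> j" "\<gamma> \<le> 1" "\<beta> \<le> 1" using ij \<gamma>(1) \<beta>(1) by linarith+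
      then have "2 * (2 * i + \<gamma> + x) + \<beta> < 2 * (2 * j + \<delta> + y)" using that by presburger
      then show ?thesis by (simp add: f_def g_def)
    qed
    show "p < q" if "p \<in> P i" "q \<in> Q j" for p q
      using that lt a by (auto simp: P_def Q_def)
    show "free_side t (parity_class 0 n) cc p q" if "p \<in> P i" "q \<in> P i" "p < q" for p q
    proof -
      obtain x y where xy: "x < a" "p = f i x" "y < a" "q = f i y" using \<open>p \<in> P i\<close> \<open>q \<in> P i\<close> by (auto simp: P_def)
      have "x < y" using \<open>p < q\<close> xy by (simp add: f_def)
      have "free_side t {..<m} cc0 (2 * (2 * i + \<gamma> + x) + \<beta>) (2 * (2 * i + \<gamma> + y) + \<beta>)"
        using free_side_same[OF t'(1) \<beta>(1), of "2 * i + \<gamma> + x" "2 * i + \<gamma> + y" t] \<beta>(3) \<open>x < y\<close>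
          \<gamma>(2)[of x y i] inside_f[of i y] inside_f[of i 2] ij xy a by simp
      then show ?thesis using free_side_class[of 0 t n cc "2 * (2 * i + \<gamma> + x) + \<beta>" "2 * (2 * i + \<gamma> + y) + \<beta>"] xy by (simp add: f_def m_def cc0_def)
    qed
    show "free_side (\<not> t) (parity_class 0 n) cc p q" if "p \<in> Q j" "q \<in> Q j" "p < q" for p q
    proof -
      obtain x y where xy: "x < b" "p = g j x" "y < b" "q = g j y" using \<open>p \<in> Q j\<close> \<open>q \<in> Q j\<close> by (auto simp: Q_def)
      have "x < y" using \<open>p < q\<close> xy by (simp add: g_def)
      have "free_side (\<not> t) {..<m} cc0 (2 * (2 * j + \<delta> + x) + (1 - \<beta>)) (2 * (2 * j + \<delta> + y) + (1 - \<beta>))"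
        using free_side_same[OF t'(1) \<beta>(2), of "2 * j + \<delta> + x" "2 * j + \<delta> + y" "\<not> t"] \<beta>(4) \<open>x < y\<close>
          \<delta>(2)[of x y j] inside_g[of j y] inside_g[of j 2] ij xy b by simp
      then show ?thesis using free_side_class[of 0 "\<not> t" n cc "2 * (2 * j + \<delta> + x) + (1 - \<beta>)" "2 * (2 * j + \<delta> + y) + (1 - \<beta>)"] xy by (simp add: g_def m_def cc0_def)
    qed
    show "free_wedge t (parity_class 0 n) cc p q" if pq: "p \<in> P i" "q \<in> Q j" for p q
    proof -
      obtain x y where xy: "x < a" "p = f i x" "y < b" "q = g j y" using pq by (auto simp: P_def Q_def)
      let ?u = "2 * (2 * i + \<gamma> + x) + \<beta>" and ?v = "2 * (2 * j + \<delta> + y) + (1 - \<beta>)"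
      have "?u < ?v" using lt[of x y] xy a by (simp add: f_def g_def)
      moreover have "?v < m" using inside_g[of j y] ij xy b by (intro parity_class_member \<beta>) auto
      moreover have "even ?u \<noteq> even ?v" "even ?u = (\<beta> = 0)" using \<beta>(1) by (auto simp: less_2_cases_iff)
      ultimately have "free_wedge t {..<m} cc0 ?u ?v"
        using free_wedge_diff[OF alt0 t'(1), of ?u ?v t] \<beta>(3) by auto
      then show ?thesis using free_wedge_class[of 0 t n cc ?u ?v] xy by (simp add: f_def g_def m_def cc0_def)
    qed
  qed
  define F where "F = (\<lambda>(i, j). (insert 1 (P i), Q j)) ` ({..<M} \<times> {M<..2 * M})"
  have "inj_on (\<lambda>(i, j). (insert (1::nat) (P i), Q j)) ({..<M} \<times> {M<..2 * M})"
  proof (rule inj_onI, clarify)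
    fix i j i' j'
    assume eq: "insert 1 (P i) = insert 1 (P i')" "Q j = Q j'"
    have "1 \<noteq> f i x" for i x unfolding f_def by presburger
    then have one: "1 \<notin> P i" for i unfolding P_def by blast
    have P: "P i = P i'" using eq(1) one by (metis insert_ident)
    have "f i 0 \<in> P i'" "f i' 0 \<in> P i" using a P by (auto simp: P_def)
    then have "i' \<le> i" "i \<le> i'" by (auto simp: P_def f_def)
    moreover have "g j 0 \<in> Q j'" "g j' 0 \<in> Q j" using b eq(2) by (auto simp: Q_def)
    then have "j' \<le> j" "j \<le> j'" by (auto simp: Q_def g_def)
    ultimately show "i = i' \<and> j = j'" by simp
  qed
  then have "card F = M\<^sup>2" by (simp add: F_def card_image power2_eq_square)
  moreover have "finite F" by (simp add: F_def)
  moreover have "\<forall>S\<in>F. fan_hole (1 + a + b) n cc S" using hole by (auto simp: F_def)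
  ultimately show ?thesis unfolding M_def by blast
qed

section \<open>Free pairs in canonical Horton sets\<close>

definition free_pairs :: "bool \<Rightarrow> nat \<Rightarrow> nat chirotope \<Rightarrow> (nat \<times> nat) set" where
  "free_pairs d n cc = {(i, j). i < j \<and> j < n \<and> free_side d {..<n} cc i j}"

definition wedge_pairs :: "bool \<Rightarrow> nat \<Rightarrow> nat chirotope \<Rightarrow> (nat \<times> nat) set" where
  "wedge_pairs d n cc = {(i, j). i < j \<and> j < n \<and> free_wedge d {..<n} cc i j}"

lemma finite_pairs [simp]: "finite (free_pairs d n cc)" "finite (wedge_pairs d n cc)"
  by (rule finite_subset[of _ "{..<n} \<times> {..<n}"]; auto simp: free_pairs_def wedge_pairs_def)+

lemma same_parity_cases:
  fixes u v :: nat
  assumes "even u = even v" "u < v" "v < n"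
  obtains c i j where "c < 2" "u = 2 * i + c" "v = 2 * j + c" "i < j" "j < class_size c n"
proof -
  define c where "c = v mod 2"
  have "u mod 2 = v mod 2" using assms(1) by presburger
  then have c: "c < 2" "u mod 2 = c" by (auto simp: c_def)
  have "v \<in> parity_class c n" using assms c_def by (simp add: parity_class_def)
  then obtain j where j: "v = 2 * j + c" "j < class_size c n" using parity_class_image[OF c(1)] by auto
  have "u = 2 * (u div 2) + c" using c(2) by presburger
  then show ?thesis using that[OF c(1) _ j(1) _ j(2), of "u div 2"] j(1) assms(2) by linarith
qed

text \<open>Free pairs are the free pairs of the class on side \<open>d\<close> and the pairs of neighbours.\<close>

lemma free_pairs_split:
  fixes d
  assumes alt: "alternating {..<n} cc" and sp: "interleaved t n cc"
  defines "b \<equiv> (if t = d then 1 else 0 :: nat)"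
  shows "free_pairs d n cc = (\<lambda>(i, j). (2 * i + b, 2 * j + b)) ` free_pairs d (class_size b n) (class_chirotope b cc)
    \<union> (\<lambda>i. (i, i + 1)) ` {..<n - 1}" (is "_ = ?L \<union> ?R")
proof -
  have b: "b < 2" "(t = (b = 0)) \<noteq> d" by (auto simp: b_def)
  show ?thesis
  proof (intro set_eqI iffI)
    fix s assume s: "s \<in> free_pairs d n cc"
    then obtain u v where uv: "s = (u, v)" "u < v" "v < n" "free_side d {..<n} cc u v"
      by (auto simp: free_pairs_def)
    show "s \<in> ?L \<union> ?R"
    proof (cases "even u = even v")
      case True
      obtain c i j where c: "c < 2" "u = 2 * i + c" "v = 2 * j + c" "i < j" "j < class_size c n"
        by (rule same_parity_cases[OF True uv(2,3)])
      have f: "(t = (c = 0)) \<noteq> d" "free_side d {..<class_size c n} (class_chirotope c cc) i j"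
        using free_side_same[OF sp c(1,4,5), of d] uv(4) c by auto
      have "c = b" using f(1) b c(1) by (auto simp: less_2_cases_iff)
      then have "(i, j) \<in> free_pairs d (class_size b n) (class_chirotope b cc)" using f c by (simp add: free_pairs_def)
      then show ?thesis using uv(1) c \<open>c = b\<close> by (auto intro!: image_eqI[of _ _ "(i, j)"])
    next
      case False
      then have "v = u + 1" using free_side_diff[OF alt sp uv(2,3)] uv(4) by blast
      then show ?thesis using uv by auto
    qed
  next
    fix s assume "s \<in> ?L \<union> ?R"
    then show "s \<in> free_pairs d n cc"
    proof
      assume "s \<in> ?L"
      then obtain i j where ij: "s = (2 * i + b, 2 * j + b)" "i < j" "j < class_size b n"
          "free_side d {..<class_size b n} (class_chirotope b cc) i j" by (auto simp: free_pairs_def)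
      then have "free_side d {..<n} cc (2 * i + b) (2 * j + b)"
        using free_side_same[OF sp b(1), of i j d] b by auto
      then show ?thesis using ij parity_class_member[OF b(1) ij(3)] by (simp add: free_pairs_def)
    next
      assume "s \<in> ?R"
      then show ?thesis by (auto simp: free_pairs_def free_side_def)
    qed
  qed
qed

lemma class_size_pow: "b < 2 \<Longrightarrow> class_size b (2 ^ Suc z) = 2 ^ z"
  by (auto simp: class_size_def less_2_cases_iff)

lemma canonical_interleaved:
  assumes "horton_chirotope {True} (2 ^ Suc z) cc"
  shows "interleaved True (2 ^ Suc z) cc" "b < 2 \<Longrightarrow> horton_chirotope {True} (2 ^ z) (class_chirotope b cc)"
proof -
  have n: "(2::nat) \<le> 2 ^ Suc z" by simp
  from assms have "interleaved True (2 ^ Suc z) cc \<and> horton_chirotope {True} (2 ^ z) (class_chirotope 0 cc) \<and> horton_chirotope {True} (2 ^ z) (class_chirotope 1 cc)"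
  proof (cases rule: horton_chirotope.cases)
    case chirotope_small
    then show ?thesis using n by linarith
  next
    case (chirotope_step t)
    then show ?thesis using class_size_pow[of 0 z] class_size_pow[of 1 z] by auto
  qed
  then show "interleaved True (2 ^ Suc z) cc" "b < 2 \<Longrightarrow> horton_chirotope {True} (2 ^ z) (class_chirotope b cc)"
    by (auto simp: less_2_cases_iff)
qed

lemma alternating_class_pow:
  "alternating {..<2 ^ Suc z} cc \<Longrightarrow> b < 2 \<Longrightarrow> alternating {..<2 ^ z} (class_chirotope b cc)"
  using alternating_class[of "2 ^ Suc z" cc b] class_size_pow[of b z] by (simp only:)

text \<open>Both counts satisfy the recursion given by \<open>free_pairs_split\<close>; the second one adds the distances in a
class, which double in the whole set, and is needed for the triangles that are lost when the set
becomes a class of a larger one.\<close>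

lemma canonical_free_pairs:
  assumes "horton_chirotope {True} (2 ^ z) cc" "alternating {..<2 ^ z} cc"
  shows "card (free_pairs d (2 ^ z) cc) + z + 2 = 2 ^ (z + 1) \<and>
    (\<Sum>(i, j)\<in>free_pairs d (2 ^ z) cc. j - i) + 2 ^ z = z * 2 ^ z + 1"
  using assms
proof (induction z arbitrary: cc)
  case 0
  have "free_pairs d 1 cc = {}" by (auto simp: free_pairs_def)
  then show ?case by simp
next
  case (Suc z)
  define b where "b = (if True = d then 1 else 0 :: nat)"
  have b: "b < 2" by (simp add: b_def)
  define f where "f = (\<lambda>(i, j). (2 * i + b, 2 * j + b))"
  define g where "g = (\<lambda>i::nat. (i, i + 1))"
  let ?F = "free_pairs d (2 ^ z) (class_chirotope b cc)"
  have eq: "free_pairs d (2 ^ Suc z) cc = f ` ?F \<union> g ` {..<2 ^ Suc z - 1}"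
    using free_pairs_split[OF Suc.prems(2) canonical_interleaved(1)[OF Suc.prems(1)], of d]
    unfolding f_def g_def b_def[symmetric] class_size_pow[OF b] .
  have disj: "f ` ?F \<inter> g ` {..<2 ^ Suc z - 1} = {}"
  proof -
    have "2 * j \<noteq> Suc (2 * i)" for i j by presburger
    then show ?thesis by (auto simp: f_def g_def)
  qed
  have inj: "inj_on f ?F" "inj_on g {..<2 ^ Suc z - 1}" by (auto simp: f_def g_def inj_on_def)
  note IH = Suc.IH[OF canonical_interleaved(2)[OF Suc.prems(1) b] alternating_class_pow[OF Suc.prems(2) b]]
  have "card (free_pairs d (2 ^ Suc z) cc) = card ?F + (2 ^ Suc z - 1)"
    unfolding eq using disj inj by (simp add: card_Un_disjoint card_image)
  moreover have "(\<Sum>(i, j)\<in>free_pairs d (2 ^ Suc z) cc. j - i) = 2 * (\<Sum>(i, j)\<in>?F. j - i) + (2 ^ Suc z - 1)"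
  proof -
    have "(\<Sum>(i, j)\<in>free_pairs d (2 ^ Suc z) cc. j - i) =
        (\<Sum>(i, j)\<in>f ` ?F. j - i) + (\<Sum>(i, j)\<in>g ` {..<2 ^ Suc z - 1}. j - i)"
      unfolding eq using disj by (intro sum.union_disjoint) auto
    moreover have "(\<Sum>(i, j)\<in>f ` ?F. j - i) = (\<Sum>(i, j)\<in>?F. 2 * (j - i))"
      by (subst sum.reindex[OF inj(1)]) (auto intro!: sum.cong simp: f_def)
    moreover have "(\<Sum>(i, j)\<in>g ` {..<2 ^ Suc z - 1}. j - i) = 2 ^ Suc z - 1"
      by (subst sum.reindex[OF inj(2)]) (simp add: g_def)
    moreover have "(\<Sum>(i, j)\<in>?F. 2 * (j - i)) = 2 * (\<Sum>(i, j)\<in>?F. j - i)"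
      unfolding sum_distrib_left by (intro sum.cong) auto
    ultimately show ?thesis by simp
  qed
  moreover have "(2::nat) ^ Suc z - 1 + 1 = 2 ^ Suc z" "(2::nat) ^ Suc z = 2 * 2 ^ z"
    "Suc z * 2 ^ Suc z = 2 * (z * 2 ^ z) + 2 * 2 ^ z" "(2::nat) ^ (Suc z + 1) = 2 * 2 ^ (z + 1)"
    "(2::nat) ^ (z + 1) = 2 * 2 ^ z" by simp_all
  ultimately show ?case using IH by (intro conjI; linarith)
qed

definition wedges_from_first :: "nat \<Rightarrow> nat chirotope \<Rightarrow> nat set" where
  "wedges_from_first n cc = {j. (0, j) \<in> wedge_pairs True n cc}"

definition wedges_to_last :: "nat \<Rightarrow> nat chirotope \<Rightarrow> nat set" where
  "wedges_to_last n cc = {i. (i, n - 1) \<in> wedge_pairs True n cc}"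

lemma finite_wedges [simp]: "finite (wedges_from_first n cc)" "finite (wedges_to_last n cc)"
  by (rule finite_subset[of _ "{..<n}"]; auto simp: wedge_pairs_def wedges_from_first_def wedges_to_last_def)+

lemma wedge_same:
  assumes "interleaved True (2 * m) cc" "i < j" "j < m"
  shows "free_wedge True {..<2 * m} cc (2 * i) (2 * j) \<longleftrightarrow> free_wedge True {..<m} (class_chirotope 0 cc) i j \<and> i = 0"
    "free_wedge True {..<2 * m} cc (2 * i + 1) (2 * j + 1) \<longleftrightarrow> free_wedge True {..<m} (class_chirotope 1 cc) i j \<and> j = m - 1"
    "\<not> free_wedge False {..<2 * m} cc (2 * i) (2 * j)"
    "\<not> free_wedge False {..<2 * m} cc (2 * i + 1) (2 * j + 1)"
proof -
  have c: "class_size 0 (2 * m) = m" "class_size 1 (2 * m) = m" by (auto simp: class_size_def)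
  have o: "1 \<in> parity_class 1 (2 * m)" "2 * m - 1 \<in> parity_class 1 (2 * m)" "0 \<in> parity_class 0 (2 * m)" "2 * m - 2 \<in> parity_class 0 (2 * m)"
    using assms(2,3) by (auto simp: parity_class_def mod_Suc) presburger+
  have 0: "(\<forall>x\<in>parity_class 1 (2 * m). \<not> x < 2 * i) \<longleftrightarrow> i = 0"
  proof
    assume "\<forall>x\<in>parity_class 1 (2 * m). \<not> x < 2 * i"
    then have "\<not> 1 < 2 * i" using o by blast
    then show "i = 0" by simp
  qed simp
  have 1: "(\<forall>x\<in>parity_class 0 (2 * m). \<not> 2 * j + 1 < x) \<longleftrightarrow> j = m - 1"
  proof
    assume "\<forall>x\<in>parity_class 0 (2 * m). \<not> 2 * j + 1 < x"
    then have "\<not> 2 * j + 1 < 2 * m - 2" using o by blast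
    then show "j = m - 1" using assms(3) by linarith
  next
    assume "j = m - 1" then show "\<forall>x\<in>parity_class 0 (2 * m). \<not> 2 * j + 1 < x" by (auto simp: parity_class_def)
  qed
  have 2: "\<not> (\<forall>x\<in>parity_class 1 (2 * m). \<not> 2 * j < x)" using o(2) assms(3) by force
  have 3: "\<not> (\<forall>x\<in>parity_class 0 (2 * m). \<not> x < 2 * i + 1)" using o(3) by force
  show "free_wedge True {..<2 * m} cc (2 * i) (2 * j) \<longleftrightarrow> free_wedge True {..<m} (class_chirotope 0 cc) i j \<and> i = 0"
    "\<not> free_wedge False {..<2 * m} cc (2 * i) (2 * j)"
    using free_wedge_same[OF assms(1), of 0 i j] assms(2,3) 0 2 by (simp_all add: c)
  show "free_wedge True {..<2 * m} cc (2 * i + 1) (2 * j + 1) \<longleftrightarrow> free_wedge True {..<m} (class_chirotope 1 cc) i j \<and> j = m - 1"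
    "\<not> free_wedge False {..<2 * m} cc (2 * i + 1) (2 * j + 1)"
    using free_wedge_same[OF assms(1), of 1 i j] assms(2,3) 1 3 c by simp_all
qed

lemma double_neq_pred_double: "0 < m \<Longrightarrow> 2 * j \<noteq> 2 * m - (1::nat)"
  by presburger

lemma even_odd_cases: fixes u :: nat obtains i where "u = 2 * i" | i where "u = 2 * i + 1"
  by (metis evenE oddE)

text \<open>For two even or two odd numbers, the free wedge must not contain points of the other class. As the
first number is even and the last one is odd, for \<open>d = False\<close> this is impossible and for \<open>d = True\<close>
the pair has to start with the first or to end with the last point.\<close>

lemma wedge_pairs_iff:
  assumes alt: "alternating {..<2 * m} cc" and sp: "interleaved True (2 * m) cc" and m: "0 < m"
  shows "(u, v) \<in> wedge_pairs True (2 * m) cc \<longleftrightarrow> u < v \<and> v < 2 * m \<and>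
     (if even u \<and> even v then u = 0 \<and> v div 2 \<in> wedges_from_first m (class_chirotope 0 cc)
      else if odd u \<and> odd v then v = 2 * m - 1 \<and> u div 2 \<in> wedges_to_last m (class_chirotope 1 cc)
      else if odd u then True else u = 0 \<and> v = 2 * m - 1)" (is ?T)
    and "(u, v) \<in> wedge_pairs False (2 * m) cc \<longleftrightarrow> u < v \<and> v < 2 * m \<and> even u \<and> odd v" (is ?F)
proof -
  have "?T \<and> ?F"
  proof (cases "u < v \<and> v < 2 * m")
    case uv: True
    then have uv': "u < v" "v < 2 * m" by auto
    note wd = free_wedge_diff[OF alt sp uv']
    show ?thesis
    proof (cases rule: even_odd_cases[of u]; cases rule: even_odd_cases[of v])
      fix i j assume e: "u = 2 * i" "v = 2 * j"
      then have "i < j" "j < m" using uv' by auto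
      from wedge_same(1,3)[OF sp this] this show ?thesis
        using e uv by (auto simp: wedge_pairs_def wedges_from_first_def)
    next
      fix i j assume e: "u = 2 * i" "v = 2 * j + 1"
      then show ?thesis using wd uv by (auto simp: wedge_pairs_def)
    next
      fix i j assume e: "u = 2 * i + 1" "v = 2 * j"
      then show ?thesis using wd uv by (auto simp: wedge_pairs_def)
    next
      fix i j assume e: "u = 2 * i + 1" "v = 2 * j + 1"
      then have "i < j" "j < m" using uv' by auto
      note ws = wedge_same(2,4)[OF sp this]
      have eq: "Suc (2 * j) = 2 * m - Suc 0 \<longleftrightarrow> j = m - Suc 0" using m by presburger
      show ?thesis
        using ws \<open>i < j\<close> \<open>j < m\<close> unfolding e by (auto simp: wedge_pairs_def wedges_to_last_def eq)
    qed
  qed (auto simp: wedge_pairs_def)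
  then show ?T ?F by auto
qed

lemma canonical_wedges_first_last:
  assumes "horton_chirotope {True} (2 ^ z) cc" "alternating {..<2 ^ z} cc"
  shows "card (wedges_from_first (2 ^ z) cc) = z \<and> card (wedges_to_last (2 ^ z) cc) = z"
  using assms
proof (induction z arbitrary: cc)
  case 0
  have "wedges_from_first 1 cc = {}" "wedges_to_last 1 cc = {}"
    by (auto simp: wedges_from_first_def wedges_to_last_def wedge_pairs_def)
  then show ?case by simp
next
  case (Suc z)
  let ?m = "2 ^ z :: nat"
  have n: "(2::nat) ^ Suc z = 2 * ?m" by simp
  have alt: "alternating {..<2 * ?m} cc" and sp: "interleaved True (2 * ?m) cc"
    using Suc.prems canonical_interleaved(1)[OF Suc.prems(1)] unfolding n by auto
  have m: "0 < ?m" by simp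
  have m1: "1 < 2 * ?m" using m by linarith
  note iff = wedge_pairs_iff(1)[OF alt sp m]
  have F: "wedges_from_first (2 * ?m) cc = insert (2 * ?m - 1) ((\<lambda>j. 2 * j) ` wedges_from_first ?m (class_chirotope 0 cc))"
  proof (intro set_eqI)
    fix v
    show "v \<in> wedges_from_first (2 * ?m) cc \<longleftrightarrow> v \<in> insert (2 * ?m - 1) ((\<lambda>j. 2 * j) ` wedges_from_first ?m (class_chirotope 0 cc))"
    proof (cases rule: even_odd_cases[of v])
      case (1 j)
      have "2 * j \<noteq> 2 * ?m - 1" by (rule double_neq_pred_double[OF m])
      moreover have "j \<in> wedges_from_first ?m (class_chirotope 0 cc) \<Longrightarrow> 0 < j \<and> j < ?m"
        by (auto simp: wedges_from_first_def wedge_pairs_def)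
      ultimately show ?thesis unfolding 1 using iff[of 0 "2 * j"]
        by (auto simp: wedges_from_first_def[of "2 * ?m"])
    next
      case (2 j)
      have "2 * j + 1 \<noteq> 2 * i" for i by presburger
      then show ?thesis unfolding 2 using iff[of 0 "2 * j + 1"] m
        by (auto simp: wedges_from_first_def[of "2 * ?m"])
    qed
  qed
  have L: "wedges_to_last (2 * ?m) cc = insert 0 ((\<lambda>j. 2 * j + 1) ` wedges_to_last ?m (class_chirotope 1 cc))"
  proof (intro set_eqI)
    fix u
    have odd: "odd (2 * ?m - 1)" using m by simp
    show "u \<in> wedges_to_last (2 * ?m) cc \<longleftrightarrow> u \<in> insert 0 ((\<lambda>j. 2 * j + 1) ` wedges_to_last ?m (class_chirotope 1 cc))"
    proof (cases rule: even_odd_cases[of u])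
      case (1 j)
      have "2 * j \<noteq> 2 * i + 1" for i by presburger
      then show ?thesis unfolding 1 using iff[of "2 * j" "2 * ?m - 1"] m m1 odd
        by (auto simp: wedges_to_last_def[of "2 * ?m"])
    next
      case (2 j)
      have "j \<in> wedges_to_last ?m (class_chirotope 1 cc) \<Longrightarrow> j < ?m - 1"
        by (auto simp: wedges_to_last_def wedge_pairs_def)
      then have "j \<in> wedges_to_last ?m (class_chirotope 1 cc) \<Longrightarrow> 2 * j + 1 < 2 * ?m - 1" by fastforce
      then show ?thesis unfolding 2 using iff[of "2 * j + 1" "2 * ?m - 1"] m odd
        by (auto simp: wedges_to_last_def[of "2 * ?m"])
    qed
  qed
  have IH: "card (wedges_from_first ?m (class_chirotope 0 cc)) = z" "card (wedges_to_last ?m (class_chirotope 1 cc)) = z"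
    using Suc.IH[OF canonical_interleaved(2)[OF Suc.prems(1)] alternating_class_pow[OF Suc.prems(2)]] by auto
  have h1: "2 * ?m - 1 \<notin> (\<lambda>j. 2 * j) ` wedges_from_first ?m (class_chirotope 0 cc)"
    using double_neq_pred_double[OF m] by (metis imageE)
  have h2: "0 \<notin> (\<lambda>j. 2 * j + 1) ` wedges_to_last ?m (class_chirotope 1 cc)" by auto
  show ?case
    unfolding n F L card_insert_disjoint[OF finite_imageI[OF finite_wedges(1)] h1]
      card_insert_disjoint[OF finite_imageI[OF finite_wedges(2)] h2]
    using IH by (simp add: card_image inj_on_def)
qed

lemma card_mixed_parity: "card {(u, v). u < v \<and> v < 2 * m \<and> even u \<noteq> even (v::nat)} = m * m"
proof -
  define f where "f = (\<lambda>(i, j). if i \<le> j then (2 * i, 2 * j + 1) else (2 * j + 1, 2 * i :: nat))"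
  have "bij_betw f ({..<m} \<times> {..<m}) {(u, v). u < v \<and> v < 2 * m \<and> even u \<noteq> even v}"
  proof (rule bij_betwI')
    fix x y assume "x \<in> {..<m} \<times> {..<m}" "y \<in> {..<m} \<times> {..<m}"
    have ne: "2 * i + 1 \<noteq> 2 * j" "2 * i \<noteq> 2 * j + 1" for i j :: nat by presburger+
    show "(f x = f y) = (x = y)"
      using ne by (cases x; cases y) (auto simp: f_def split: if_splits)
  next
    fix x assume "x \<in> {..<m} \<times> {..<m}"
    then show "f x \<in> {(u, v). u < v \<and> v < 2 * m \<and> even u \<noteq> even v}"
      by (auto simp: f_def split: if_splits)
  next
    fix y assume "y \<in> {(u, v). u < v \<and> v < 2 * m \<and> even u \<noteq> even v}"
    then obtain u v where y: "y = (u, v)" "u < v" "v < 2 * m" "even u \<noteq> even v" by auto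
    show "\<exists>x\<in>{..<m} \<times> {..<m}. y = f x"
    proof (cases "even u")
      case True
      then obtain i j where "u = 2 * i" "v = 2 * j + 1" using y by (metis evenE oddE)
      then show ?thesis using y by (intro bexI[of _ "(i, j)"]) (auto simp: f_def)
    next
      case False
      then obtain i j where "v = 2 * i" "u = 2 * j + 1" using y by (metis evenE oddE)
      then show ?thesis using y by (intro bexI[of _ "(i, j)"]) (auto simp: f_def)
    qed
  qed
  then show ?thesis by (simp add: bij_betw_same_card[symmetric] card_cartesian_product)
qed

text \<open>The pairs of different parity are distributed between the two sides according to the parity of the
first point, so that the sum of both counts is easier than each of them: it contains every pair of
different parity once, and the pair of the first and the last point a second time. The remaining
pairs start with the first or end with the last point.\<close>

lemma canonical_wedge_pairs:
  assumes "horton_chirotope {True} (2 ^ Suc z) cc" "alternating {..<2 ^ Suc z} cc"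
  shows "card (wedge_pairs True (2 ^ Suc z) cc) + card (wedge_pairs False (2 ^ Suc z) cc) = 2 * z + 1 + 2 ^ z * 2 ^ z"
proof -
  let ?m = "2 ^ z :: nat"
  have n: "(2::nat) ^ Suc z = 2 * ?m" by simp
  have alt: "alternating {..<2 * ?m} cc" and sp: "interleaved True (2 * ?m) cc"
    using assms canonical_interleaved(1)[OF assms(1)] unfolding n by auto
  have m: "0 < ?m" by simp
  note iff = wedge_pairs_iff[OF alt sp m]
  define FF where "FF = (\<lambda>j. (0::nat, 2 * j)) ` wedges_from_first ?m (class_chirotope 0 cc)"
  define LL where "LL = (\<lambda>i. (2 * i + 1, 2 * ?m - 1)) ` wedges_to_last ?m (class_chirotope 1 cc)"
  define OE where "OE = {(u, v). u < v \<and> v < 2 * ?m \<and> odd u \<and> even v}"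
  define EO where "EO = {(u, v). u < v \<and> v < 2 * ?m \<and> even u \<and> odd v}"
  have odd: "odd (2 * ?m - 1)" using m by simp
  have T: "wedge_pairs True (2 * ?m) cc = FF \<union> LL \<union> OE \<union> {(0, 2 * ?m - 1)}"
  proof (intro set_eqI, clarify)
    fix u v
    have from_first: "0 < j \<and> j < ?m" if "j \<in> wedges_from_first ?m (class_chirotope 0 cc)" for j
      using that by (auto simp: wedges_from_first_def wedge_pairs_def)
    have to_last: "2 * j + 1 < 2 * ?m - 1" if "j \<in> wedges_to_last ?m (class_chirotope 1 cc)" for j
    proof -
      have "j < ?m - 1" using that by (auto simp: wedges_to_last_def wedge_pairs_def)
      then show ?thesis by linarith
    qed
    have memF: "(u, v) \<in> FF \<longleftrightarrow> u = 0 \<and> even v \<and> v div 2 \<in> wedges_from_first ?m (class_chirotope 0 cc)"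
      by (auto simp: FF_def elim!: evenE)
    have memL: "(u, v) \<in> LL \<longleftrightarrow> odd u \<and> v = 2 * ?m - 1 \<and> u div 2 \<in> wedges_to_last ?m (class_chirotope 1 cc)"
      by (auto simp: LL_def elim!: oddE)
    have memO: "(u, v) \<in> OE \<longleftrightarrow> u < v \<and> v < 2 * ?m \<and> odd u \<and> even v" by (simp add: OE_def)
    have ev: "2 * (w div 2) = w" if "even w" for w :: nat using that by simp
    have od: "2 * (w div 2) + 1 = w" if "odd w" for w :: nat using that by simp
    have rF: "0 < v \<and> v < 2 * ?m" if "even v" "v div 2 \<in> wedges_from_first ?m (class_chirotope 0 cc)"
      using from_first[OF that(2)] ev[OF that(1)] by linarith
    have rL: "u < 2 * ?m - 1" if "odd u" "u div 2 \<in> wedges_to_last ?m (class_chirotope 1 cc)"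
      using to_last[OF that(2)] od[OF that(1)] by linarith
    have m1: "0 < 2 * ?m - 1" "2 * ?m - 1 < 2 * ?m" using m by linarith+
    show "(u, v) \<in> wedge_pairs True (2 * ?m) cc \<longleftrightarrow> (u, v) \<in> FF \<union> LL \<union> OE \<union> {(0, 2 * ?m - 1)}"
      unfolding iff(1) Un_iff memF memL memO singleton_iff prod.inject
      by (cases "even u"; cases "even v") (use rF rL m1 odd in auto)
  qed
  have F: "wedge_pairs False (2 * ?m) cc = EO" using iff(2) by (auto simp: EO_def)
  have fin: "finite OE" "finite EO"
    by (rule finite_subset[of _ "{..<2 * ?m} \<times> {..<2 * ?m}"]; auto simp: OE_def EO_def)+
  have "OE \<union> EO = {(u, v). u < v \<and> v < 2 * ?m \<and> even u \<noteq> even v}" by (auto simp: OE_def EO_def)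
  moreover have "OE \<inter> EO = {}" by (auto simp: OE_def EO_def)
  ultimately have OE: "card OE + card EO = ?m * ?m"
    using card_mixed_parity[of ?m] card_Un_disjoint[OF fin] by simp
  have IH: "card (wedges_from_first ?m (class_chirotope 0 cc)) = z" "card (wedges_to_last ?m (class_chirotope 1 cc)) = z"
    using canonical_wedges_first_last[OF canonical_interleaved(2)[OF assms(1)] alternating_class_pow[OF assms(2)]] by auto
  have cF: "card FF = z" "finite FF" unfolding FF_def using IH by (auto simp: card_image inj_on_def)
  have cL: "card LL = z" "finite LL" unfolding LL_def using IH by (auto simp: card_image inj_on_def)
  have d1: "FF \<inter> LL = {}" by (auto simp: FF_def LL_def)
  have d2: "(FF \<union> LL) \<inter> OE = {}" using odd by (auto simp: FF_def LL_def OE_def)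
  have d3: "(0, 2 * ?m - 1) \<notin> FF \<union> LL \<union> OE"
  proof -
    have "2 * ?m - 1 \<noteq> 2 * a" for a using odd by (metis dvd_triv_left)
    then show ?thesis by (auto simp: FF_def LL_def OE_def)
  qed
  have "card (wedge_pairs True (2 * ?m) cc) = Suc (card (FF \<union> LL \<union> OE))"
    unfolding T using d3 cF cL fin by simp
  also have "card (FF \<union> LL \<union> OE) = z + z + card OE"
    using d1 d2 cF cL fin by (simp add: card_Un_disjoint)
  finally show ?thesis unfolding n F using OE by simp
qed

section \<open>Triangular holes of canonical Horton sets\<close>

lemma signed_holes_3_iff:
  fixes x y z :: nat
  assumes alt: "alternating I cc" and I: "{x, y, z} \<subseteq> I" "x \<noteq> y" "x \<noteq> z" "y \<noteq> z"
    and AB: "A \<union> B = {x, y, z}" "A \<inter> B = {}"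
  shows "(A, B) \<in> signed_holes 3 I cc \<longleftrightarrow> empty_triangle I cc (\<lambda>i. i \<in> A) x y z"
proof -
  let ?e = "\<lambda>i. i \<in> A"
  note perm = empty_triangle_permute[OF alt, where e = ?e]
  have 1: "empty_triangle I cc ?e y x z = empty_triangle I cc ?e x y z" "empty_triangle I cc ?e x z y = empty_triangle I cc ?e x y z"
    using perm[of x y z] I by auto
  have 2: "empty_triangle I cc ?e y z x = empty_triangle I cc ?e x y z" using perm(2)[of y x z] 1 I by auto
  have 3: "empty_triangle I cc ?e z x y = empty_triangle I cc ?e x y z" using perm(1)[of x z y] 1 I by auto
  have 4: "empty_triangle I cc ?e z y x = empty_triangle I cc ?e x y z" using perm(2)[of z x y] 3 I by auto
  have "card {x, y, z} = 3" using I by simp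
  then show ?thesis
    unfolding signed_holes_def mem_Collect_eq prod.case AB using I AB(2) 1 2 3 4 by auto
qed

text \<open>Among the two encodings of a triangular region exactly one has at most one negative vertex.\<close>

definition holes3 :: "nat \<Rightarrow> nat chirotope \<Rightarrow> (nat set \<times> nat set) set" where
  "holes3 n cc = {(A, B) \<in> signed_holes 3 {..<n} cc. card B \<le> 1}"

text \<open>The exceptional vertex is the middle one, so the triangle contains the vertical direction. These are
the triangles that contain all points of the other class by \<open>mono_in_cell_iff\<close>.\<close>

definition vertical :: "nat set \<times> nat set \<Rightarrow> bool" where
  "vertical S \<longleftrightarrow> (\<exists>x y z. x < y \<and> y < z \<and> S = ({x, z}, {y}))"

lemma finite_holes3 [simp]: "finite (holes3 n cc)"
  by (rule finite_subset[OF _ finite_signed_holes[of "{..<n}" 3 cc]]) (auto simp: holes3_def)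

lemma card_3_sorted:
  fixes G :: "nat set"
  assumes "card G = 3" obtains x y z where "G = {x, y, z}" "x < y" "y < z"
proof -
  obtain a b c where G: "G = {a, b, c}" "a \<noteq> b" "a \<noteq> c" "b \<noteq> c" using assms by (auto simp: card_3_iff)
  consider "a < b" "b < c" | "a < c" "c < b" | "b < a" "a < c" | "b < c" "c < a" | "c < a" "a < b" | "c < b" "b < a"
    using G(2-4) by linarith
  then show ?thesis using that G(1) by cases (metis insert_commute)+
qed

lemma vertical_iff_signs:
  assumes AB: "A \<union> B = {x, y, z}" "A \<inter> B = {}" "card B \<le> 1" and less: "x < y" "y < z"
  shows "vertical (A, B) \<longleftrightarrow> (x \<in> A) \<noteq> (y \<in> A) \<and> (z \<in> A) \<noteq> (y \<in> A)"
proof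
  assume "vertical (A, B)"
  then obtain x' y' z' where v: "x' < y'" "y' < z'" "A = {x', z'}" "B = {y'}" by (auto simp: vertical_def)
  then have "{x', y', z'} = {x, y, z}" using AB(1) by auto
  then have "x' \<in> {x, y, z}" "y' \<in> {x, y, z}" "z' \<in> {x, y, z}" by auto
  then have "x' = x" "y' = y" "z' = z" using v(1,2) less by auto
  then show "(x \<in> A) \<noteq> (y \<in> A) \<and> (z \<in> A) \<noteq> (y \<in> A)" using v less by auto
next
  assume s: "(x \<in> A) \<noteq> (y \<in> A) \<and> (z \<in> A) \<noteq> (y \<in> A)"
  have finB: "finite B" using AB(1) by (metis finite.simps finite_Un)
  show "vertical (A, B)"
  proof (cases "y \<in> A")
    case True
    then have "{x, z} \<subseteq> B" using s AB(1) by auto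
    then have "card {x, z} \<le> card B" using finB by (rule card_mono[rotated])
    then show ?thesis using AB(3) less by simp
  next
    case False
    then have "y \<in> B" "x \<in> A" "z \<in> A" using s AB(1) by auto
    then have "A = {x, z}" "B = {y}" using AB(1,2) False by auto
    then show ?thesis using less unfolding vertical_def by blast
  qed
qed

lemma vertical_image:
  assumes "strict_mono f" shows "vertical (f ` A, f ` B) \<longleftrightarrow> vertical (A, B)"
proof
  assume "vertical (f ` A, f ` B)"
  then obtain x y z where v: "x < y" "y < z" "f ` A = {x, z}" "f ` B = {y}" by (auto simp: vertical_def)
  then have "x \<in> f ` A" "z \<in> f ` A" "y \<in> f ` B" by auto
  then obtain x' y' z' where e: "x = f x'" "y = f y'" "z = f z'" by blast
  then have "f ` A = f ` {x', z'}" "f ` B = f ` {y'}" using v by auto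
  then have "A = {x', z'}" "B = {y'}"
    using inj_image_eq_iff[OF strict_mono_imp_inj_on[OF assms]] by (simp_all only:)
  moreover have "x' < y'" "y' < z'" using v(1,2) unfolding e strict_mono_less[OF assms] by auto
  ultimately show "vertical (A, B)" unfolding vertical_def by blast
next
  assume "vertical (A, B)"
  then obtain x y z where v: "x < y" "y < z" "A = {x, z}" "B = {y}" by (auto simp: vertical_def)
  then have "f x < f y" "f y < f z" "f ` A = {f x, f z}" "f ` B = {f y}"
    using strict_mono_less[OF assms] by auto
  then show "vertical (f ` A, f ` B)" unfolding vertical_def by blast
qed

definition double_pair :: "nat \<Rightarrow> nat set \<times> nat set \<Rightarrow> nat set \<times> nat set" where
  "double_pair b = (\<lambda>(A, B). ((\<lambda>i. 2 * i + b) ` A, (\<lambda>i. 2 * i + b) ` B))"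

lemma double_pair_inj: "inj (double_pair b)"
proof -
  have "inj (\<lambda>i::nat. 2 * i + b)" by (auto simp: inj_on_def)
  then show ?thesis by (auto simp: inj_on_def double_pair_def inj_image_eq_iff)
qed

lemma vertical_double_pair: "vertical (double_pair b S) \<longleftrightarrow> vertical S"
proof -
  have "strict_mono (\<lambda>i::nat. 2 * i + b)" by (auto simp: strict_mono_def)
  then show ?thesis by (cases S) (simp add: double_pair_def vertical_image)
qed

text \<open>A triangle in one class stays empty in the whole set unless it is vertical.\<close>

lemma holes3_same_class:
  assumes alt_n: "alternating {..<n} cc" and sp: "interleaved t n cc" and b: "b < 2" and n: "2 \<le> n"
  shows "{(A, B) \<in> holes3 n cc. A \<union> B \<subseteq> parity_class b n} =
    double_pair b ` {S \<in> holes3 (class_size b n) (class_chirotope b cc). \<not> vertical S}"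
proof -
  interpret separated_classes "parity_class b n" "parity_class (1 - b) n" cc "t = (b = 0)" by (rule separated_parity_classes[OF alt_n sp b])
  have altb: "alternating (parity_class b n) cc" by (rule alternating_subset[OF alt_n]) (auto simp: parity_class_def)
  obtain w where w: "w \<in> parity_class (1 - b) n" using n b by (auto simp: parity_class_def intro!: that[of "1 - b"])
  have key: "(A, B) \<in> signed_holes 3 {..<n} cc \<longleftrightarrow> (A, B) \<in> signed_holes 3 (parity_class b n) cc \<and> \<not> vertical (A, B)"
    if AB: "A \<union> B \<subseteq> parity_class b n" "card B \<le> 1" "card (A \<union> B) = 3" "A \<inter> B = {}" for A B
  proof -
    let ?e = "\<lambda>i. i \<in> A"
    obtain x y z where xyz: "A \<union> B = {x, y, z}" "x < y" "y < z" using card_3_sorted AB(3) by metis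
    have mem: "x \<in> parity_class b n" "y \<in> parity_class b n" "z \<in> parity_class b n" using AB(1) xyz(1) by auto
    have "empty_triangle {..<n} cc ?e x y z \<longleftrightarrow> empty_triangle (parity_class b n) cc ?e x y z \<and> (\<forall>v\<in>parity_class (1 - b) n. \<not> in_cell cc ?e x y z v)"
      unfolding parity_class_Un'(1)[OF b, symmetric] empty_triangle_def using mem disj by blast
    also have "(\<forall>v\<in>parity_class (1 - b) n. \<not> in_cell cc ?e x y z v) \<longleftrightarrow> \<not> vertical (A, B)"
      using mono_in_cell_iff[OF mem xyz(2,3), of _ ?e] w vertical_iff_signs[OF xyz(1) AB(4,2) xyz(2,3)] by metis
    finally have c: "empty_triangle {..<n} cc ?e x y z \<longleftrightarrow> empty_triangle (parity_class b n) cc ?e x y z \<and> \<not> vertical (A, B)" .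
    have sub: "{x, y, z} \<subseteq> parity_class b n" "{x, y, z} \<subseteq> {..<n}" using mem by (auto simp: parity_class_def)
    have ne: "x \<noteq> y" "x \<noteq> z" "y \<noteq> z" using xyz by auto
    show ?thesis
      using c signed_holes_3_iff[OF alt_n sub(2) ne xyz(1) AB(4)] signed_holes_3_iff[OF altb sub(1) ne xyz(1) AB(4)]
      by blast
  qed
  let ?f = "\<lambda>i::nat. 2 * i + b"
  have inj: "inj_on ?f {..<class_size b n}" by (auto simp: inj_on_def)
  have img: "signed_holes 3 (parity_class b n) cc = double_pair b ` signed_holes 3 {..<class_size b n} (class_chirotope b cc)"
    unfolding parity_class_image[OF b] signed_holes_image[OF inj] double_pair_def class_chirotope_def[abs_def] ..
  have cardf: "card (?f ` B) = card B" for B by (intro card_image) (auto simp: inj_on_def)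
  show ?thesis
  proof (intro set_eqI iffI)
    fix S assume "S \<in> {(A, B) \<in> holes3 n cc. A \<union> B \<subseteq> parity_class b n}"
    then obtain A B where S: "S = (A, B)" "(A, B) \<in> signed_holes 3 {..<n} cc" "card B \<le> 1" "A \<union> B \<subseteq> parity_class b n"
      by (auto simp: holes3_def)
    then have "card (A \<union> B) = 3" "A \<inter> B = {}" by (auto simp: signed_holes_def)
    then have "S \<in> signed_holes 3 (parity_class b n) cc" "\<not> vertical S" using key S by auto
    then obtain A' B' where R: "(A', B') \<in> signed_holes 3 {..<class_size b n} (class_chirotope b cc)" "S = double_pair b (A', B')"
      unfolding img by auto
    then have "(A', B') \<in> holes3 (class_size b n) (class_chirotope b cc)"
      using S cardf by (auto simp: holes3_def double_pair_def)
    moreover have "\<not> vertical (A', B')" using \<open>\<not> vertical S\<close> R vertical_double_pair by blast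
    ultimately show "S \<in> double_pair b ` {S \<in> holes3 (class_size b n) (class_chirotope b cc). \<not> vertical S}" using R(2) by blast
  next
    fix S assume "S \<in> double_pair b ` {S \<in> holes3 (class_size b n) (class_chirotope b cc). \<not> vertical S}"
    then obtain A B where AB: "(A, B) \<in> signed_holes 3 {..<class_size b n} (class_chirotope b cc)" "card B \<le> 1" "\<not> vertical (A, B)"
        "S = (?f ` A, ?f ` B)" "S = double_pair b (A, B)" by (auto simp: holes3_def double_pair_def)
    then have h: "(?f ` A, ?f ` B) \<in> signed_holes 3 (parity_class b n) cc"
      unfolding img by (metis imageI)
    then have 1: "?f ` A \<union> ?f ` B \<subseteq> parity_class b n" "card (?f ` A \<union> ?f ` B) = 3" "?f ` A \<inter> ?f ` B = {}"
      unfolding signed_holes_def by auto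
    have "\<not> vertical (?f ` A, ?f ` B)" using AB(3,4,5) vertical_double_pair by metis
    moreover have "card (?f ` B) \<le> 1" using AB(2) cardf by simp
    ultimately have "(?f ` A, ?f ` B) \<in> signed_holes 3 {..<n} cc"
      using key[OF 1(1) _ 1(2,3)] h by blast
    then show "S \<in> {(A, B) \<in> holes3 n cc. A \<union> B \<subseteq> parity_class b n}"
      using AB(4) 1 \<open>card (?f ` B) \<le> 1\<close> by (simp add: holes3_def)
  qed
qed

definition mixed3 :: "nat \<Rightarrow> nat \<Rightarrow> nat chirotope \<Rightarrow> (nat set \<times> nat set) set" where
  "mixed3 b n cc = {(A, B) \<in> holes3 n cc. \<exists>p\<in>parity_class b n. \<exists>q\<in>parity_class b n. \<exists>r\<in>parity_class (1 - b) n.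
     p < q \<and> A \<union> B = {p, q, r}}"

lemma holes3_partition:
  "holes3 n cc = {(A, B) \<in> holes3 n cc. A \<union> B \<subseteq> parity_class 0 n} \<union> {(A, B) \<in> holes3 n cc. A \<union> B \<subseteq> parity_class 1 n}
     \<union> (mixed3 0 n cc \<union> mixed3 1 n cc)" (is "_ = ?R")
proof
  show "holes3 n cc \<subseteq> ?R"
  proof
    fix S assume S: "S \<in> holes3 n cc"
    obtain A B where AB: "S = (A, B)" by (cases S)
    have c: "card (A \<union> B) = 3" "A \<union> B \<subseteq> {..<n}" using S AB by (auto simp: holes3_def signed_holes_def)
    obtain x y z where xyz: "A \<union> B = {x, y, z}" "x < y" "y < z" using card_3_sorted[OF c(1)] by metis
    have par: "v \<in> parity_class 0 n \<or> v \<in> parity_class 1 n" if "v \<in> {x, y, z}" for v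
      using that c(2) unfolding xyz(1) parity_class_Un(1)[symmetric] by blast
    have p: "x \<in> parity_class 0 n \<or> x \<in> parity_class 1 n" "y \<in> parity_class 0 n \<or> y \<in> parity_class 1 n" "z \<in> parity_class 0 n \<or> z \<in> parity_class 1 n"
      using par by auto
    have mx: "S \<in> mixed3 b n cc" if "A \<union> B = {p, q, r}" "p \<in> parity_class b n" "q \<in> parity_class b n" "r \<in> parity_class (1 - b) n" "p < q" for b p q r
      using that S AB unfolding mixed3_def by blast
    have e: "A \<union> B = {x, z, y}" "A \<union> B = {y, z, x}" using xyz(1) by auto
    note m = mx[OF xyz(1)] mx[OF e(1)] mx[OF e(2)]
    show "S \<in> ?R"
    proof (cases "A \<union> B \<subseteq> parity_class 0 n \<or> A \<union> B \<subseteq> parity_class 1 n")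
      case True
      then show ?thesis using S AB by auto
    next
      case False
      then have "\<not> {x, y, z} \<subseteq> parity_class 0 n" "\<not> {x, y, z} \<subseteq> parity_class 1 n" using xyz(1) by auto
      then have "S \<in> mixed3 0 n cc \<or> S \<in> mixed3 1 n cc"
        using p m[of 0] m[of 1] xyz(2,3) by auto
      then show ?thesis by blast
    qed
  qed
qed (auto simp: mixed3_def)

text \<open>The codes 0, 1, 2, 3 stand for the four triangles of three points \<open>p\<close>, \<open>q\<close>, \<open>r\<close>, according to
which vertex, if any, has an exceptional sign.\<close>

definition flipped :: "'a \<Rightarrow> 'a \<Rightarrow> 'a \<Rightarrow> nat \<Rightarrow> 'a set" where
  "flipped p q r c = (if c = 0 then {} else if c = 1 then {r} else if c = 2 then {p} else {q})"

lemma flipped_simps [simp]: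
  "flipped p q r 0 = {}" "flipped p q r 1 = {r}" "flipped p q r (Suc 0) = {r}"
  "flipped p q r 2 = {p}" "flipped p q r 3 = {q}"
  by (simp_all add: flipped_def)

lemma flipped_inj:
  assumes "flipped p q r c = flipped p q r c'" "p \<noteq> q" "p \<noteq> r" "q \<noteq> r" "c < 4" "c' < 4"
  shows "c = c'"
proof -
  have "c = 0 \<or> c = 1 \<or> c = 2 \<or> c = 3" "c' = 0 \<or> c' = 1 \<or> c' = 2 \<or> c' = 3" using assms by linarith+
  then show ?thesis using assms(1-4) by (elim disjE) simp_all
qed

definition pattern :: "nat \<Rightarrow> (nat \<times> nat) \<times> (nat \<times> nat) \<Rightarrow> nat set \<times> nat set" where
  "pattern b = (\<lambda>((i, j), (k, c)). let p = 2 * i + b; q = 2 * j + b; r = 2 * k + (1 - b);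
     B = flipped p q r c in ({p, q, r} - B, B))"

text \<open>The list of the empty triangles with \<open>i\<close> and \<open>j\<close> in one class and \<open>k\<close> in the other one, as given by
\<open>mixed_empty_triangle_iff\<close>: for equal signs of \<open>i\<close> and \<open>j\<close> the third vertex is arbitrary, for
different signs it is the last or the first point.\<close>

definition patterns :: "nat \<Rightarrow> bool \<Rightarrow> nat chirotope \<Rightarrow> ((nat \<times> nat) \<times> (nat \<times> nat)) set" where
  "patterns m d cc = free_pairs d m cc \<times> ({..<m} \<times> {0}) \<union> free_pairs (\<not> d) m cc \<times> ({..<m} \<times> {1})
     \<union> wedge_pairs (\<not> d) m cc \<times> {(m - 1, 2)} \<union> wedge_pairs d m cc \<times> {(0, 3)}"

lemma patternsD:
  "((i, j), (k, c)) \<in> patterns m d cc \<Longrightarrow> i < j \<and> j < m \<and> k < m \<and> c < 4"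
  by (auto simp: patterns_def free_pairs_def wedge_pairs_def)

lemma card_patterns:
  "card (patterns m d cc) = card (free_pairs d m cc) * m + card (free_pairs (\<not> d) m cc) * m
     + card (wedge_pairs (\<not> d) m cc) + card (wedge_pairs d m cc)"
proof -
  let ?P1 = "free_pairs d m cc \<times> ({..<m} \<times> {0::nat})" and ?P2 = "free_pairs (\<not> d) m cc \<times> ({..<m} \<times> {1::nat})"
  let ?P3 = "wedge_pairs (\<not> d) m cc \<times> {(m - 1, 2::nat)}" and ?P4 = "wedge_pairs d m cc \<times> {(0::nat, 3::nat)}"
  have "card (patterns m d cc) = card (?P1 \<union> ?P2 \<union> ?P3) + card ?P4"
    unfolding patterns_def by (intro card_Un_disjoint) auto
  also have "card (?P1 \<union> ?P2 \<union> ?P3) = card (?P1 \<union> ?P2) + card ?P3" by (intro card_Un_disjoint) auto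
  also have "card (?P1 \<union> ?P2) = card ?P1 + card ?P2" by (intro card_Un_disjoint) auto
  finally show ?thesis by (simp add: card_cartesian_product)
qed

lemma other_parity_neq:
  assumes "b < 2" shows "2 * i + b \<noteq> 2 * k + (1 - b)" "2 * k + (1 - b) \<noteq> 2 * i + (b::nat)"
  using assms by (auto simp: less_2_cases_iff) presburger+

lemma pattern_union:
  "fst (pattern b ((i, j), (k, c))) \<union> snd (pattern b ((i, j), (k, c))) = {2 * i + b, 2 * j + b, 2 * k + (1 - b)}"
  by (auto simp: pattern_def Let_def flipped_def)

lemma pattern_inj:
  assumes b: "b < 2" shows "inj_on (pattern b) (patterns m d cc)"
proof (rule inj_onI)
  fix s s' assume s: "s \<in> patterns m d cc" "s' \<in> patterns m d cc" "pattern b s = pattern b s'"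
  obtain i j k c i' j' k' c' where ss: "s = ((i, j), (k, c))" "s' = ((i', j'), (k', c'))" by (metis surj_pair)
  then have 1: "((i, j), (k, c)) \<in> patterns m d cc" and 2: "((i', j'), (k', c')) \<in> patterns m d cc"
    and eq: "pattern b ((i, j), (k, c)) = pattern b ((i', j'), (k', c'))" using s by auto
  note D = patternsD[OF 1] patternsD[OF 2]
  have G: "{2 * i + b, 2 * j + b, 2 * k + (1 - b)} = {2 * i' + b, 2 * j' + b, 2 * k' + (1 - b)}"
    using eq pattern_union[of b i j k c] pattern_union[of b i' j' k' c'] by simp
  note ne = other_parity_neq[OF b]
  have m: "2 * i + b \<in> {2 * i' + b, 2 * j' + b, 2 * k' + (1 - b)}" "2 * j + b \<in> {2 * i' + b, 2 * j' + b, 2 * k' + (1 - b)}"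
     "2 * k + (1 - b) \<in> {2 * i' + b, 2 * j' + b, 2 * k' + (1 - b)}"
    unfolding G[symmetric] by auto
  have "i = i' \<or> i = j'" "j = i' \<or> j = j'" "k = k'" using m ne[of _ k'] ne(2)[of k] by auto
  then have e: "i = i'" "j = j'" "k = k'" using D by auto
  have "snd (pattern b ((i, j), (k, c))) = snd (pattern b ((i, j), (k, c')))" using eq e by simp
  then have "flipped (2 * i + b) (2 * j + b) (2 * k + (1 - b)) c = flipped (2 * i + b) (2 * j + b) (2 * k + (1 - b)) c'"
    by (simp add: pattern_def Let_def)
  then have "c = c'" by (rule flipped_inj) (use D ne[of i k] ne[of j k] in auto)
  then show "s = s'" using e ss by simp
qed

lemma pattern_hole_iff:
  assumes alt_n: "alternating {..<2 * m} cc" and sp: "interleaved True (2 * m) cc" and b: "b < 2"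
    and ijk: "i < j" "j < m" "k < m" "c < 4"
  shows "pattern b ((i, j), (k, c)) \<in> signed_holes 3 {..<2 * m} cc \<longleftrightarrow>
    ((i, j), (k, c)) \<in> patterns m (b = 0) (class_chirotope b cc)"
proof -
  interpret separated_classes "parity_class b (2 * m)" "parity_class (1 - b) (2 * m)" cc "True = (b = 0)" by (rule separated_parity_classes[OF alt_n sp b])
  have cl: "class_size b (2 * m) = m" "class_size (1 - b) (2 * m) = m" using b by (auto simp: class_size_def less_2_cases_iff)
  define p q r where "p = 2 * i + b" and "q = 2 * j + b" and "r = 2 * k + (1 - b)"
  have b': "1 - b < 2" by simp
  have mem: "p \<in> parity_class b (2 * m)" "q \<in> parity_class b (2 * m)" "r \<in> parity_class (1 - b) (2 * m)"
    unfolding parity_class_image[OF b] parity_class_image[OF b'] cl p_def q_def r_def using ijk by auto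
  have pq: "p < q" "p \<noteq> r" "q \<noteq> r" using ijk other_parity_neq[OF b] by (auto simp: p_def q_def r_def)
  obtain A B where AB: "pattern b ((i, j), (k, c)) = (A, B)" by (cases "pattern b ((i, j), (k, c))")
  have B: "B = flipped p q r c" and A: "A = {p, q, r} - B"
    using AB by (auto simp: pattern_def Let_def p_def q_def r_def)
  have first: "(\<forall>y\<in>parity_class (1 - b) (2 * m). r \<le> y) \<longleftrightarrow> k = 0"
    unfolding parity_class_image[OF b'] cl r_def using ijk by auto
  have last: "(\<forall>y\<in>parity_class (1 - b) (2 * m). y \<le> r) \<longleftrightarrow> k = m - 1"
    unfolding parity_class_image[OF b'] cl r_def using ijk by (auto dest!: bspec[of _ _ "m - 1"])
  have fs: "free_side d (parity_class b (2 * m)) cc p q \<longleftrightarrow> (i, j) \<in> free_pairs d m (class_chirotope b cc)" for d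
    using free_side_class[OF b, of d "2 * m" cc i j] ijk unfolding p_def q_def cl by (simp add: free_pairs_def)
  have fw: "free_wedge d (parity_class b (2 * m)) cc p q \<longleftrightarrow> (i, j) \<in> wedge_pairs d m (class_chirotope b cc)" for d
    using free_wedge_class[OF b, of d "2 * m" cc i j] ijk unfolding p_def q_def cl by (simp add: wedge_pairs_def)
  have "A \<union> B = {p, q, r}" "A \<inter> B = {}" unfolding A B by (auto simp: flipped_def split: if_splits)
  moreover have "{p, q, r} \<subseteq> {..<2 * m}" using mem by (auto simp: parity_class_def)
  ultimately have "(A, B) \<in> signed_holes 3 {..<2 * m} cc \<longleftrightarrow> empty_triangle {..<2 * m} cc (\<lambda>i. i \<in> A) p q r"
    using pq by (intro signed_holes_3_iff[OF alt_n]) auto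
  also have "\<dots> \<longleftrightarrow> ((i, j), (k, c)) \<in> patterns m (b = 0) (class_chirotope b cc)"
    unfolding parity_class_Un'(1)[OF b, symmetric] mixed_empty_triangle_iff[OF mem pq(1)] fs fw
  proof -
    consider "c = 0" | "c = 1" | "c = 2" | "c = 3" using ijk(4) by linarith
    then show "(if (p \<in> A) = (q \<in> A) then (i, j) \<in> free_pairs (((r \<in> A) = (p \<in> A)) = (True = (b = 0))) m (class_chirotope b cc)
       else (i, j) \<in> wedge_pairs (((r \<in> A) = (p \<in> A)) = (True = (b = 0))) m (class_chirotope b cc) \<and>
         (\<forall>y\<in>parity_class (1 - b) (2 * m). if (r \<in> A) = (p \<in> A) then r \<le> y else y \<le> r)) \<longleftrightarrow>
       ((i, j), (k, c)) \<in> patterns m (b = 0) (class_chirotope b cc)"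
      by cases (use pq first last ijk in \<open>auto simp: A B patterns_def\<close>)
  qed
  finally show ?thesis using AB by simp
qed

lemma mixed3_eq:
  assumes alt: "alternating {..<2 * m} cc" and sp: "interleaved True (2 * m) cc" and b: "b < 2"
  shows "mixed3 b (2 * m) cc = pattern b ` patterns m (b = 0) (class_chirotope b cc)"
proof (intro set_eqI iffI)
  have cl: "class_size b (2 * m) = m" "class_size (1 - b) (2 * m) = m" using b by (auto simp: class_size_def less_2_cases_iff)
  have b': "1 - b < 2" by simp
  fix S
  {
    assume "S \<in> mixed3 b (2 * m) cc"
    then obtain A B p q r where S: "S = (A, B)" "(A, B) \<in> signed_holes 3 {..<2 * m} cc" "card B \<le> 1"
        "p \<in> parity_class b (2 * m)" "q \<in> parity_class b (2 * m)" "r \<in> parity_class (1 - b) (2 * m)" "p < q" "A \<union> B = {p, q, r}"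
      unfolding mixed3_def holes3_def by blast
    obtain i j k where ijk: "p = 2 * i + b" "q = 2 * j + b" "r = 2 * k + (1 - b)" "i < m" "j < m" "k < m"
      using S(4-6) unfolding parity_class_image[OF b] parity_class_image[OF b'] cl by blast
    have disj: "A \<inter> B = {}" using S(2) by (auto simp: signed_holes_def)
    have "finite B" using S(8) by (metis finite.simps finite_Un)
    then have "B = {} \<or> (\<exists>x. B = {x})" using S(3) by (metis card_0_eq card_1_singletonE le_neq_implies_less less_one)
    moreover have "B \<subseteq> {p, q, r}" using S(8) by auto
    ultimately have "B = {} \<or> B = {r} \<or> B = {p} \<or> B = {q}" by auto
    moreover have "A = {p, q, r} - B" using S(8) disj by blast
    moreover have "\<exists>c<4. B = flipped p q r c"
      using calculation(1)
    proof (elim disjE)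
      assume "B = {}" then show ?thesis by (intro exI[of _ 0]) simp
    next
      assume "B = {r}" then show ?thesis by (intro exI[of _ 1]) simp
    next
      assume "B = {p}" then show ?thesis by (intro exI[of _ 2]) simp
    next
      assume "B = {q}" then show ?thesis by (intro exI[of _ 3]) simp
    qed
    ultimately have "\<exists>c<4. S = pattern b ((i, j), (k, c))"
      unfolding S(1) pattern_def Let_def prod.case ijk(1-3)[symmetric] by auto
    then obtain c where c: "c < 4" "S = pattern b ((i, j), (k, c))" by blast
    have "i < j" using S(7) ijk by simp
    then have "((i, j), (k, c)) \<in> patterns m (b = 0) (class_chirotope b cc)"
      using pattern_hole_iff[OF alt sp b, of i j k c] c S(1,2) ijk by simp
    then show "S \<in> pattern b ` patterns m (b = 0) (class_chirotope b cc)" using c by blast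
  next
    assume "S \<in> pattern b ` patterns m (b = 0) (class_chirotope b cc)"
    then obtain i j k c where c: "S = pattern b ((i, j), (k, c))" "((i, j), (k, c)) \<in> patterns m (b = 0) (class_chirotope b cc)"
      by auto
    note D = patternsD[OF c(2)]
    have h: "S \<in> signed_holes 3 {..<2 * m} cc" using pattern_hole_iff[OF alt sp b, of i j k c] c D by simp
    have mem: "2 * i + b \<in> parity_class b (2 * m)" "2 * j + b \<in> parity_class b (2 * m)" "2 * k + (1 - b) \<in> parity_class (1 - b) (2 * m)"
      unfolding parity_class_image[OF b] parity_class_image[OF b'] cl using D by auto
    have "card (snd S) \<le> 1" unfolding c(1) by (auto simp: pattern_def Let_def flipped_def)
    moreover have "fst S \<union> snd S = {2 * i + b, 2 * j + b, 2 * k + (1 - b)}" unfolding c(1) by (rule pattern_union)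
    moreover have "2 * i + b < 2 * j + b" using D by simp
    ultimately have "\<exists>p\<in>parity_class b (2 * m). \<exists>q\<in>parity_class b (2 * m). \<exists>r\<in>parity_class (1 - b) (2 * m). p < q \<and> fst S \<union> snd S = {p, q, r}"
      using mem by blast
    with \<open>card (snd S) \<le> 1\<close> h show "S \<in> mixed3 b (2 * m) cc"
      unfolding mixed3_def holes3_def by (cases S) simp
  }
qed

lemma vertical_pair: "vertical ({a, b}, {y}) \<longleftrightarrow> a < y \<and> y < b \<or> b < y \<and> y < a"
  by (auto simp: vertical_def doubleton_eq_iff)

text \<open>If the signs of the two points of one class differ, then the third vertex is at the end of its class
where it cannot make an exceptional vertex the middle one.\<close>

lemma pattern_vertical_iff:
  assumes b: "b < 2" and P: "((i, j), (k, c)) \<in> patterns m d cc"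
  shows "vertical (pattern b ((i, j), (k, c))) \<longleftrightarrow> c = 1 \<and> 2 * i + b < 2 * k + (1 - b) \<and> 2 * k + (1 - b) < 2 * j + b"
proof -
  define p q r where "p = 2 * i + b" and "q = 2 * j + b" and "r = 2 * k + (1 - b)"
  note D = patternsD[OF P]
  have pq: "p < q" "p \<noteq> r" "q \<noteq> r" using D other_parity_neq[OF b] by (auto simp: p_def q_def r_def)
  have pat: "pattern b ((i, j), (k, c)) = ({p, q, r} - flipped p q r c, flipped p q r c)"
    by (simp add: pattern_def Let_def p_def q_def r_def)
  have rest: "{p, q, r} - {r} = {p, q}" "{p, q, r} - {p} = {q, r}" "{p, q, r} - {q} = {p, r}" using pq by auto
  have "vertical (pattern b ((i, j), (k, c))) \<longleftrightarrow> c = 1 \<and> p < r \<and> r < q"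
  proof -
    consider "c = 0" | "c = 1" | "c = 2" | "c = 3" using D by linarith
    then show ?thesis
    proof cases
      case 1
      then show ?thesis unfolding pat by (simp add: vertical_def)
    next
      case 2
      then show ?thesis using pq(1) unfolding pat by (auto simp: rest vertical_pair)
    next
      case 3
      then have "k = m - 1" using P by (auto simp: patterns_def)
      then have "p < r" using D b by (auto simp: p_def r_def less_2_cases_iff)
      then show ?thesis using 3 pq(1) unfolding pat by (simp add: rest vertical_pair)
    next
      case 4
      then have "k = 0" using P by (auto simp: patterns_def)
      then have "r < q" using D b by (auto simp: q_def r_def less_2_cases_iff)
      then show ?thesis using 4 pq(1) unfolding pat by (simp add: rest vertical_pair)
    qed
  qed
  then show ?thesis unfolding p_def q_def r_def .
qed

text \<open>Between two points of one class there are as many points of the other class as their distance in the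
class.\<close>

lemma card_vertical_patterns:
  assumes b: "b < 2"
  shows "card {S \<in> pattern b ` patterns m (b = 0) cc. vertical S} = (\<Sum>(i, j)\<in>free_pairs (b \<noteq> 0) m cc. j - i)"
proof -
  define K where "K s = {k. 2 * fst s + b < 2 * k + (1 - b) \<and> 2 * k + (1 - b) < 2 * snd s + b}" for s :: "nat \<times> nat"
  define g where "g = (\<lambda>(s :: nat \<times> nat, k :: nat). (s, (k, 1 :: nat)))"
  have K: "K (i, j) = (if b = 0 then {i..<j} else {i<..j})" for i j
    using b by (auto simp: K_def less_2_cases_iff)
  have eq: "{S \<in> pattern b ` patterns m (b = 0) cc. vertical S} = pattern b ` g ` (SIGMA s:free_pairs (b \<noteq> 0) m cc. K s)"
  proof (intro set_eqI iffI)
    fix S assume "S \<in> {S \<in> pattern b ` patterns m (b = 0) cc. vertical S}"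
    then obtain i j k c where S: "S = pattern b ((i, j), (k, c))" "((i, j), (k, c)) \<in> patterns m (b = 0) cc" "vertical S"
      by auto
    then have c: "c = 1" "k \<in> K (i, j)" using pattern_vertical_iff[OF b S(2)] by (auto simp: K_def)
    then have "(i, j) \<in> free_pairs (b \<noteq> 0) m cc" using S(2) by (auto simp: patterns_def)
    then have "((i, j), k) \<in> (SIGMA s:free_pairs (b \<noteq> 0) m cc. K s)" using c by auto
    then have "g ((i, j), k) \<in> g ` (SIGMA s:free_pairs (b \<noteq> 0) m cc. K s)" by (rule imageI)
    then show "S \<in> pattern b ` g ` (SIGMA s:free_pairs (b \<noteq> 0) m cc. K s)"
      using S(1) c(1) by (auto simp: g_def)
  next
    fix S assume "S \<in> pattern b ` g ` (SIGMA s:free_pairs (b \<noteq> 0) m cc. K s)"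
    then obtain i j k where S: "S = pattern b ((i, j), (k, 1))" "(i, j) \<in> free_pairs (b \<noteq> 0) m cc" "k \<in> K (i, j)"
      by (auto simp: g_def)
    have "j < m" using S(2) by (auto simp: free_pairs_def)
    then have "k < m" using S(3) unfolding K by (auto split: if_splits)
    then have P: "((i, j), (k, 1)) \<in> patterns m (b = 0) cc" using S(2) by (auto simp: patterns_def)
    then show "S \<in> {S \<in> pattern b ` patterns m (b = 0) cc. vertical S}"
      using S pattern_vertical_iff[OF b P] by (auto simp: K_def)
  qed
  have sub: "g ` (SIGMA s:free_pairs (b \<noteq> 0) m cc. K s) \<subseteq> patterns m (b = 0) cc"
  proof -
    have "j < m" if "(i, j) \<in> free_pairs (b \<noteq> 0) m cc" for i j using that by (auto simp: free_pairs_def)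
    then show ?thesis by (fastforce simp: g_def patterns_def K split: if_splits)
  qed
  have "inj_on g (SIGMA s:free_pairs (b \<noteq> 0) m cc. K s)" by (auto simp: g_def inj_on_def)
  then have "card {S \<in> pattern b ` patterns m (b = 0) cc. vertical S} = card (SIGMA s:free_pairs (b \<noteq> 0) m cc. K s)"
    unfolding eq using inj_on_subset[OF pattern_inj[OF b] sub] by (simp add: card_image)
  also have "\<dots> = (\<Sum>s\<in>free_pairs (b \<noteq> 0) m cc. card (K s))"
    using K by (intro card_SigmaI) auto
  also have "\<dots> = (\<Sum>(i, j)\<in>free_pairs (b \<noteq> 0) m cc. j - i)"
    by (intro sum.cong refl) (auto simp: K)
  finally show ?thesis .
qed

lemma holes3_counts:
  assumes alt: "alternating {..<2 * m} cc" and sp: "interleaved True (2 * m) cc" and m: "0 < m"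
  defines "N \<equiv> \<lambda>b. {S \<in> holes3 m (class_chirotope b cc). \<not> vertical S}"
  shows "card (holes3 (2 * m) cc) = card (N 0) + card (N 1) +
      card (patterns m True (class_chirotope 0 cc)) + card (patterns m False (class_chirotope 1 cc))"
    and "card {S \<in> holes3 (2 * m) cc. vertical S} =
      (\<Sum>(i, j)\<in>free_pairs False m (class_chirotope 0 cc). j - i) + (\<Sum>(i, j)\<in>free_pairs True m (class_chirotope 1 cc). j - i)"
proof -
  have cl: "class_size 0 (2 * m) = m" "class_size 1 (2 * m) = m" by (auto simp: class_size_def)
  define Q where "Q b = {(A, B) \<in> holes3 (2 * m) cc. A \<union> B \<subseteq> parity_class b (2 * m)}" for b
  define X where "X b = mixed3 b (2 * m) cc" for b
  have n: "2 \<le> 2 * m" using m by simp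
  have Q: "Q 0 = double_pair 0 ` N 0" "Q 1 = double_pair 1 ` N 1"
    using holes3_same_class[OF alt sp _ n, of 0, unfolded cl] holes3_same_class[OF alt sp _ n, of 1, unfolded cl]
    by (simp_all add: Q_def N_def)
  have X: "X 0 = pattern 0 ` patterns m True (class_chirotope 0 cc)" "X 1 = pattern 1 ` patterns m False (class_chirotope 1 cc)"
    using mixed3_eq[OF alt sp, of 0] mixed3_eq[OF alt sp, of 1] by (simp_all add: X_def)
  have part: "holes3 (2 * m) cc = Q 0 \<union> Q 1 \<union> (X 0 \<union> X 1)"
    unfolding Q_def X_def by (rule holes3_partition)
  have d01: "parity_class 0 (2 * m) \<inter> parity_class 1 (2 * m) = {}" by (rule parity_class_Un(2))
  have fin: "finite (Q b)" "finite (X b)" for b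
    by (rule finite_subset[OF _ finite_holes3[of "2 * m" cc]]; auto simp: Q_def X_def mixed3_def)+
  have G: "card (fst S \<union> snd S) = 3" if "S \<in> holes3 (2 * m) cc" for S
    using that by (auto simp: holes3_def signed_holes_def)
  have dQ: "Q 0 \<inter> Q 1 = {}"
  proof (rule ccontr)
    assume "Q 0 \<inter> Q 1 \<noteq> {}"
    then obtain S where "S \<in> Q 0" "S \<in> Q 1" by blast
    then have "fst S \<union> snd S \<subseteq> parity_class 0 (2 * m) \<inter> parity_class 1 (2 * m)" "S \<in> holes3 (2 * m) cc" by (auto simp: Q_def)
    then have "fst S \<union> snd S = {}" "card (fst S \<union> snd S) = 3" using d01 G by auto
    then show False by simp
  qed
  have twoX: "\<exists>p\<in>parity_class b (2 * m). \<exists>q\<in>parity_class b (2 * m). \<exists>r\<in>parity_class (1 - b) (2 * m). p < q \<and> fst S \<union> snd S = {p, q, r}"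
    if "S \<in> X b" for S b
    using that unfolding X_def mixed3_def by (cases S) simp
  have dX: "X 0 \<inter> X 1 = {}"
  proof (rule ccontr)
    assume "X 0 \<inter> X 1 \<noteq> {}"
    then obtain S where S: "S \<in> X 0" "S \<in> X 1" by blast
    obtain p q r where 0: "p \<in> parity_class 0 (2 * m)" "q \<in> parity_class 0 (2 * m)" "r \<in> parity_class 1 (2 * m)" "p < q" "fst S \<union> snd S = {p, q, r}"
      using twoX[OF S(1)] by auto
    obtain p' q' r' where 1: "p' \<in> parity_class 1 (2 * m)" "q' \<in> parity_class 1 (2 * m)" "p' < q'" "fst S \<union> snd S = {p', q', r'}"
      using twoX[OF S(2)] by auto
    have "p' \<in> {p, q, r}" "q' \<in> {p, q, r}" using 0(5) 1(4) by auto
    then have "p' = r" "q' = r" using 0 1 d01 by auto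
    then show False using 1(3) by simp
  qed
  have dQX: "(Q 0 \<union> Q 1) \<inter> (X 0 \<union> X 1) = {}"
  proof (rule ccontr)
    assume "(Q 0 \<union> Q 1) \<inter> (X 0 \<union> X 1) \<noteq> {}"
    then obtain S b where S: "S \<in> Q 0 \<union> Q 1" "S \<in> X b" "b = 0 \<or> b = 1" by blast
    obtain p r where "p \<in> parity_class b (2 * m)" "r \<in> parity_class (1 - b) (2 * m)" "p \<in> fst S \<union> snd S" "r \<in> fst S \<union> snd S"
      using twoX[OF S(2)] by auto
    moreover have "fst S \<union> snd S \<subseteq> parity_class 0 (2 * m) \<or> fst S \<union> snd S \<subseteq> parity_class 1 (2 * m)" using S(1) by (auto simp: Q_def)
    ultimately show False using d01 S(3) by auto
  qed
  have "card (holes3 (2 * m) cc) = card (Q 0) + card (Q 1) + (card (X 0) + card (X 1))"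
    unfolding part using dQ dX dQX fin by (simp add: card_Un_disjoint)
  moreover have "card (Q 0) = card (N 0)" "card (Q 1) = card (N 1)"
    unfolding Q by (rule card_image, rule inj_on_subset[OF double_pair_inj], simp)+
  moreover have "card (X 0) = card (patterns m True (class_chirotope 0 cc))" "card (X 1) = card (patterns m False (class_chirotope 1 cc))"
    unfolding X by (rule card_image, rule pattern_inj, simp)+
  ultimately show "card (holes3 (2 * m) cc) = card (N 0) + card (N 1) +
      card (patterns m True (class_chirotope 0 cc)) + card (patterns m False (class_chirotope 1 cc))" by simp
  have "\<not> vertical S" if "S \<in> Q 0 \<union> Q 1" for S
    using that unfolding Q by (auto simp: N_def vertical_double_pair)
  then have "{S \<in> holes3 (2 * m) cc. vertical S} = {S \<in> X 0. vertical S} \<union> {S \<in> X 1. vertical S}"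
    unfolding part by blast
  also have "card \<dots> = card {S \<in> X 0. vertical S} + card {S \<in> X 1. vertical S}"
    using fin dX by (intro card_Un_disjoint) auto
  also have "\<dots> = (\<Sum>(i, j)\<in>free_pairs False m (class_chirotope 0 cc). j - i) + (\<Sum>(i, j)\<in>free_pairs True m (class_chirotope 1 cc). j - i)"
    unfolding X using card_vertical_patterns[of 0 m "class_chirotope 0 cc"] card_vertical_patterns[of 1 m "class_chirotope 1 cc"] by simp
  finally show "card {S \<in> holes3 (2 * m) cc. vertical S} =
      (\<Sum>(i, j)\<in>free_pairs False m (class_chirotope 0 cc). j - i) + (\<Sum>(i, j)\<in>free_pairs True m (class_chirotope 1 cc). j - i)" .
qed

text \<open>By \<open>holes3_counts\<close> the numbers \<open>t z\<close> of triangles and \<open>v z\<close> of vertical triangles for \<open>2 ^ z\<close> points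
satisfy \<open>t (z + 1) = 2 * (t z - v z) + 2 * x\<close>, where \<open>x\<close> is the number of patterns for one of the
classes, and \<open>v (z + 1)\<close> is the sum of all distances in free pairs on one side in each class.
Proving both formulas together by induction solves the recursion.\<close>

theorem canonical_holes3_count:
  assumes "horton_chirotope {True} (2 ^ Suc z) cc" "alternating {..<2 ^ Suc z} cc"
  shows "real (card (holes3 (2 ^ Suc z) cc)) = 4.25 * 2 ^ (2 * Suc z)
      + 2 ^ Suc z * (- (3 * (real (Suc z))\<^sup>2 / 2) - real (Suc z) / 2 - 5.5) - 4 * real (Suc z) + 2 \<and>
    real (card {S \<in> holes3 (2 ^ Suc z) cc. vertical S}) = (real z - 1) * 2 ^ Suc z + 2"
  using assms
proof (induction z arbitrary: cc)
  case 0
  have "holes3 2 cc = {}"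
  proof (rule ccontr)
    assume "holes3 2 cc \<noteq> {}"
    then obtain A B where "A \<union> B \<subseteq> {..<2::nat}" "card (A \<union> B) = 3" by (auto simp: holes3_def signed_holes_def)
    then have "3 \<le> card {..<2::nat}" by (metis card_mono finite_lessThan)
    then show False by simp
  qed
  then show ?case by (simp add: power2_eq_square)
next
  case (Suc z)
  define m where "m = (2::nat) ^ Suc z"
  have n: "(2::nat) ^ Suc (Suc z) = 2 * m" by (simp add: m_def)
  have alt: "alternating {..<2 * m} cc" and sp: "interleaved True (2 * m) cc"
    using Suc.prems canonical_interleaved(1)[OF Suc.prems(1)] unfolding n by auto
  have m: "0 < m" by (simp add: m_def)
  have h: "horton_chirotope {True} (2 ^ Suc z) (class_chirotope b cc)" "alternating {..<2 ^ Suc z} (class_chirotope b cc)" if "b < 2" for b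
    using canonical_interleaved(2)[OF Suc.prems(1) that] alternating_class_pow[OF Suc.prems(2) that] by auto
  note counts = holes3_counts[OF alt sp m]
  define P where "P = (2::real) ^ z"
  have rm: "real m = 2 * P" by (simp add: m_def P_def)
  have fp: "real (card (free_pairs d m (class_chirotope b cc))) = 4 * P - real z - 3"
    "real (\<Sum>(i, j)\<in>free_pairs d m (class_chirotope b cc). j - i) = 2 * P * real z + 1" if "b < 2" for d b
  proof -
    note c = canonical_free_pairs[OF h[OF that], of d, folded m_def]
    have "real (card (free_pairs d m (class_chirotope b cc)) + Suc z + 2) = real (2 ^ (Suc z + 1))" using c by metis
    then show "real (card (free_pairs d m (class_chirotope b cc))) = 4 * P - real z - 3" by (simp add: P_def)
    have "real ((\<Sum>(i, j)\<in>free_pairs d m (class_chirotope b cc). j - i) + m) = real (Suc z * m + 1)" using c by metis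
    then show "real (\<Sum>(i, j)\<in>free_pairs d m (class_chirotope b cc). j - i) = 2 * P * real z + 1"
      using rm by (simp add: algebra_simps del: of_nat_sum)
  qed
  have wp: "real (card (wedge_pairs True m (class_chirotope b cc))) + real (card (wedge_pairs False m (class_chirotope b cc)))
      = 2 * real z + 1 + P * P" if "b < 2" for b
  proof -
    have "real (card (wedge_pairs True m (class_chirotope b cc)) + card (wedge_pairs False m (class_chirotope b cc)))
      = real (2 * z + 1 + 2 ^ z * 2 ^ z)"
      using canonical_wedge_pairs[OF h[OF that], folded m_def] by metis
    then show ?thesis by (simp add: P_def)
  qed
  have pat: "real (card (patterns m d (class_chirotope b cc))) = 2 * (4 * P - real z - 3) * (2 * P) + 2 * real z + 1 + P * P"
    if "b < 2" for d b
    using wp[OF that] unfolding card_patterns of_nat_add of_nat_mult fp(1)[OF that] rm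
    by (cases d) (simp_all add: algebra_simps)
  have N: "real (card {S \<in> holes3 m (class_chirotope b cc). \<not> vertical S}) = real (card (holes3 m (class_chirotope b cc)))
      - real (card {S \<in> holes3 m (class_chirotope b cc). vertical S})" for b
  proof -
    have "card (holes3 m (class_chirotope b cc)) = card ({S \<in> holes3 m (class_chirotope b cc). vertical S} \<union> {S \<in> holes3 m (class_chirotope b cc). \<not> vertical S})"
      by (rule arg_cong[where f=card]) auto
    also have "\<dots> = card {S \<in> holes3 m (class_chirotope b cc). vertical S} + card {S \<in> holes3 m (class_chirotope b cc). \<not> vertical S}"
      by (intro card_Un_disjoint) auto
    finally show ?thesis by simp
  qed
  have PP: "2 ^ (2 * Suc z) = 4 * (P * P)" "2 ^ (2 * Suc (Suc z)) = 16 * (P * P)" "2 ^ Suc z = 2 * P" "2 ^ Suc (Suc z) = 4 * P"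
    by (simp_all add: P_def power_mult power2_eq_square power_mult_distrib[symmetric])
  have IH: "real (card (holes3 m (class_chirotope b cc))) = 4.25 * (4 * (P * P))
      + 2 * P * (- (3 * (real z + 1)\<^sup>2 / 2) - (real z + 1) / 2 - 5.5) - 4 * (real z + 1) + 2"
    "real (card {S \<in> holes3 m (class_chirotope b cc). vertical S}) = (real z - 1) * (2 * P) + 2" if "b < 2" for b
    using Suc.IH[OF h[OF that]] unfolding m_def[symmetric] PP by (simp_all add: add.commute)
  have "real (card (holes3 (2 * m) cc)) = 4.25 * (16 * (P * P))
      + 4 * P * (- (3 * (real z + 2)\<^sup>2 / 2) - (real z + 2) / 2 - 5.5) - 4 * (real z + 2) + 2"
    unfolding counts(1) of_nat_add N by (simp add: IH pat power2_eq_square field_simps)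
  moreover have "real (card {S \<in> holes3 (2 * m) cc. vertical S}) = real z * (4 * P) + 2"
    unfolding counts(2) of_nat_add
    using fp(2)[where b = 0 and d = False] fp(2)[where b = 1 and d = True]
    by (simp add: algebra_simps del: of_nat_sum)
  ultimately show ?case unfolding n PP by (simp add: add.commute)
qed

section \<open>From Horton sets to chirotopes\<close>

definition lift :: "real^2 \<Rightarrow> real^3" where "lift p = vector [p$1, p$2, 1]"

lemma lift_simps [simp]: "lift p $ 1 = p $ 1" "lift p $ 2 = p $ 2" "lift p $ 3 = 1"
  by (simp_all add: lift_def vector_3)

lemma det3_lift_line_height:
  assumes "a$1 \<noteq> b$1"
  shows "det3 (lift a) (lift b) (lift c) = (b$1 - a$1) * (c$2 - line_height a b (c$1))"
  using assms by (simp add: det3_expand line_height_def field_simps)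

lemma det3_lift_nz:
  assumes "a$1 \<noteq> b$1" "\<not> collinear {a, b, c}" shows "det3 (lift a) (lift b) (lift c) \<noteq> 0"
proof
  assume "det3 (lift a) (lift b) (lift c) = 0"
  then have h: "c$2 = line_height a b (c$1)" using assms(1) by (simp add: det3_lift_line_height)
  define u where "u = (c$1 - a$1) / (b$1 - a$1)"
  have "c$1 = a$1 + u * (b$1 - a$1)" "c$2 = a$2 + u * (b$2 - a$2)"
    using assms(1) by (simp_all add: u_def h line_height_def)
  then have "c = (1 - u) *\<^sub>R a + (1 - (1 - u)) *\<^sub>R b"
    by (simp add: vec_eq_iff forall_2 algebra_simps)
  then have "collinear {a, c, b}" unfolding collinear_3_expand by blast
  then show False using assms(2) by (simp add: insert_commute)
qed

definition enumerates :: "(nat \<Rightarrow> real^2) \<Rightarrow> nat \<Rightarrow> (real^2) set \<Rightarrow> bool" where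
  "enumerates e n H \<longleftrightarrow> e ` {..<n} = H \<and> (\<forall>i j. i < j \<longrightarrow> j < n \<longrightarrow> e i $ 1 < e j $ 1)"

definition orientation :: "(nat \<Rightarrow> real^2) \<Rightarrow> nat \<Rightarrow> nat \<Rightarrow> nat \<Rightarrow> bool" where
  "orientation e i j k \<longleftrightarrow> det3 (lift (e i)) (lift (e j)) (lift (e k)) > 0"

lemma enumerates_less_iff:
  assumes "enumerates e n H" "i < n" "j < n" shows "e i $ 1 < e j $ 1 \<longleftrightarrow> i < j"
  using assms unfolding enumerates_def by (metis linorder_neqE_nat order_less_asym order_less_irrefl)

lemma enumerates_inj: assumes "enumerates e n H" shows "inj_on e {..<n}"
proof (rule inj_onI)
  fix i j assume ij: "i \<in> {..<n}" "j \<in> {..<n}" "e i = e j"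
  then show "i = j"
    using enumerates_less_iff[OF assms, of i j] enumerates_less_iff[OF assms, of j i] by auto
qed

lemma enumerates_card: "enumerates e n H \<Longrightarrow> card H = n"
  using card_image[OF enumerates_inj[of e n H]] by (simp add: enumerates_def)

lemma enumeration_exists:
  assumes fin: "finite H" and inj: "inj_on (\<lambda>p::real^2. p$1) H"
  obtains e where "enumerates e (card H) H"
proof -
  define xs where "xs = sorted_list_of_set ((\<lambda>p. p$1) ` H)"
  define e where "e i = inv_into H (\<lambda>p. p$1) (xs ! i)" for i
  have xs: "set xs = (\<lambda>p. p$1) ` H" "length xs = card H" "sorted_wrt (<) xs"
    using fin card_image[OF inj] by (simp_all add: xs_def)
  have mem: "xs ! i \<in> (\<lambda>p. p$1) ` H" if "i < card H" for i using xs that by (metis nth_mem)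
  have e1: "e i $ 1 = xs ! i" "e i \<in> H" if "i < card H" for i
    unfolding e_def using f_inv_into_f[OF mem[OF that]] inv_into_into[OF mem[OF that]] by auto
  have "H \<subseteq> e ` {..<card H}"
  proof
    fix p assume p: "p \<in> H"
    then obtain i where i: "i < card H" "xs ! i = p$1" using xs by (metis imageI in_set_conv_nth)
    then have "e i = p" using inv_into_f_f[OF inj p] by (simp add: e_def)
    then show "p \<in> e ` {..<card H}" using i(1) by blast
  qed
  moreover have "e ` {..<card H} \<subseteq> H" using e1 by auto
  moreover have "e i $ 1 < e j $ 1" if "i < j" "j < card H" for i j
    using e1 that sorted_wrt_nth_less[OF xs(3), of i j] xs(2) by simp
  ultimately show ?thesis using that unfolding enumerates_def by blast
qed

lemma enumerates_halves:
  assumes e: "enumerates e n H"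
  shows "enumerates (\<lambda>i. e (2 * i + 0)) (class_size 0 n) (horton0 H)"
    and "enumerates (\<lambda>i. e (2 * i + 1)) (class_size 1 n) (horton1 H)"
    and "horton0 H = e ` parity_class 0 n" and "horton1 H = e ` parity_class 1 n"
proof -
  have H: "H = e ` {..<n}" using e by (simp add: enumerates_def)
  have rank: "card {q \<in> H. q$1 < e i $ 1} = i" if "i < n" for i
  proof -
    have "{q \<in> H. q$1 < e i $ 1} = e ` {..<i}"
      unfolding H using enumerates_less_iff[OF e] that by auto
    moreover have "inj_on e {..<i}" using enumerates_inj[OF e] by (rule inj_on_subset) (use that in auto)
    ultimately show ?thesis by (simp add: card_image)
  qed
  have "horton0 H = e ` {i. i < n \<and> even i}"
    unfolding horton0_def using rank by (auto simp: H)
  then show 0: "horton0 H = e ` parity_class 0 n" by (simp add: parity_class_def even_iff_mod_2_eq_zero)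
  have "horton1 H = e ` {i. i < n \<and> odd i}"
    unfolding horton1_def using rank by (auto simp: H)
  then show 1: "horton1 H = e ` parity_class 1 n" by (simp add: parity_class_def odd_iff_mod_2_eq_one)
  have less: "e (2 * i + b) $ 1 < e (2 * j + b) $ 1" if "i < j" "j < class_size b n" "b < 2" for i j b
    using e that parity_class_member[OF that(3,2)] unfolding enumerates_def by auto
  show "enumerates (\<lambda>i. e (2 * i + 0)) (class_size 0 n) (horton0 H)"
    unfolding enumerates_def 0 using less[of _ _ 0] by (simp add: parity_class_image image_image)
  show "enumerates (\<lambda>i. e (2 * i + 1)) (class_size 1 n) (horton1 H)"
    unfolding enumerates_def 1 using less[of _ _ 1] by (simp add: parity_class_image image_image)
qed

lemma deep_below_orientation:
  assumes e: "enumerates e n H" and d: "deep_below X Y"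
    and ij: "i < j" "j < n" "k < n"
  shows "e i \<in> X \<Longrightarrow> e j \<in> X \<Longrightarrow> e k \<in> Y \<Longrightarrow> orientation e i j k"
    and "e i \<in> Y \<Longrightarrow> e j \<in> Y \<Longrightarrow> e k \<in> X \<Longrightarrow> \<not> orientation e i j k"
proof -
  have x: "e i $ 1 < e j $ 1" using enumerates_less_iff[OF e] ij by simp
  then have det: "det3 (lift (e i)) (lift (e j)) (lift (e k)) =
      (e j $ 1 - e i $ 1) * (e k $ 2 - line_height (e i) (e j) (e k $ 1))"
    by (intro det3_lift_line_height) simp
  have ne: "e i \<noteq> e j" using x by auto
  show "orientation e i j k" if "e i \<in> X" "e j \<in> X" "e k \<in> Y"
  proof -
    have "e k $ 2 > line_height (e i) (e j) (e k $ 1)" using d that ne unfolding deep_below_def by blast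
    then show ?thesis using x by (simp add: orientation_def det)
  qed
  show "\<not> orientation e i j k" if "e i \<in> Y" "e j \<in> Y" "e k \<in> X"
  proof -
    have "e k $ 2 < line_height (e i) (e j) (e k $ 1)" using d that ne unfolding deep_below_def by blast
    then show ?thesis using x by (simp add: orientation_def det zero_less_mult_iff)
  qed
qed

lemma interleaved_orientation:
  assumes e: "enumerates e n H"
  shows "deep_below (horton0 H) (horton1 H) \<Longrightarrow> interleaved True n (orientation e)"
    and "deep_below (horton1 H) (horton0 H) \<Longrightarrow> interleaved False n (orientation e)"
proof -
  have mem: "even i \<Longrightarrow> e i \<in> horton0 H" "odd i \<Longrightarrow> e i \<in> horton1 H" if "i < n" for i
    using that unfolding enumerates_halves(3,4)[OF e] by (auto simp: parity_class_def odd_iff_mod_2_eq_one)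
  show "interleaved True n (orientation e)" if d: "deep_below (horton0 H) (horton1 H)"
    unfolding interleaved_def
  proof (intro allI impI)
    fix i j k assume h: "i < j" "j < n" "k < n" "even i = even j" "even k \<noteq> even i"
    show "orientation e i j k = (True = even i)"
      using deep_below_orientation[OF e d h(1-3)] mem[of i] mem[of j] mem[of k] h by (cases "even i") auto
  qed
  show "interleaved False n (orientation e)" if d: "deep_below (horton1 H) (horton0 H)"
    unfolding interleaved_def
  proof (intro allI impI)
    fix i j k assume h: "i < j" "j < n" "k < n" "even i = even j" "even k \<noteq> even i"
    show "orientation e i j k = (False = even i)"
      using deep_below_orientation[OF e d h(1-3)] mem[of i] mem[of j] mem[of k] h by (cases "even i") auto
  qed
qed

lemma class_chirotope_orientation: "class_chirotope b (orientation e) = orientation (\<lambda>i. e (2 * i + b))"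
  by (simp add: class_chirotope_def[abs_def] orientation_def[abs_def])

lemma horton_orientation: "horton H \<Longrightarrow> enumerates e n H \<Longrightarrow> horton_chirotope UNIV n (orientation e)"
proof (induction arbitrary: e n rule: horton.induct)
  case (1 H)
  then show ?case using enumerates_card[OF "1.prems"] by (intro chirotope_small) simp
next
  case (2 H)
  note e = "2.prems"
  obtain t where "interleaved t n (orientation e)"
    using interleaved_orientation[OF e] "2.hyps"(6) by blast
  then show ?case
  proof (rule chirotope_step[rotated 2])
    show "2 \<le> n" using enumerates_card[OF e] "2.hyps"(3) by simp
    show "horton_chirotope UNIV (class_size 0 n) (class_chirotope 0 (orientation e))" "horton_chirotope UNIV (class_size 1 n) (class_chirotope 1 (orientation e))"
      unfolding class_chirotope_orientation using "2.IH" enumerates_halves[OF e] by blast+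
  qed simp
qed

text \<open>No point is to the left of the leftmost one, so it belongs to \<^const>\<open>horton0\<close>; hence this class has to
be the lower one.\<close>

lemma canonical_horton_halves:
  assumes c: "canonical_horton H" and n: "2 \<le> card H"
  shows "deep_below (horton0 H) (horton1 H)" "canonical_horton (horton0 H)" "canonical_horton (horton1 H)"
proof -
  have h: "horton H" using c by (simp add: canonical_horton_def)
  have fin: "finite H" and hh: "horton (horton0 H)" "horton (horton1 H)"
    using h n by (cases rule: horton.cases; simp)+
  have "H \<noteq> {}" using n by auto
  then obtain p where p: "p \<in> H" "\<forall>q\<in>H. p$1 \<le> q$1"
    using fin arg_min_if_finite[of H "\<lambda>p. p$1"] by (metis linorder_not_less)
  then have "p \<in> horton_L H" using c n layers.intros(1) by (auto simp: canonical_horton_def)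
  moreover have "p \<notin> horton1 H"
  proof -
    have none: "{q \<in> H. q$1 < p$1} = {}" using p(2) by force
    have "card {q \<in> H. q$1 < p$1} = 0" unfolding none by simp
    then show ?thesis by (simp add: horton1_def)
  qed
  ultimately show d: "deep_below (horton0 H) (horton1 H)" by (auto simp: horton_L_def split: if_splits)
  have L: "horton0 H \<in> layers H" "horton1 H \<in> layers H"
    using layers.intros(2,3)[OF layers.intros(1) n] d by (simp_all add: horton_L_def horton_U_def)
  have sub: "layers X \<subseteq> layers H" if "X \<in> layers H" for X
  proof
    fix Y assume "Y \<in> layers X" then show "Y \<in> layers H"
      by induction (use that in \<open>auto intro: layers.intros\<close>)
  qed
  show "canonical_horton (horton0 H)" "canonical_horton (horton1 H)"
    using c hh sub[OF L(1)] sub[OF L(2)] unfolding canonical_horton_def by blast+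
qed

lemma canonical_horton_orientation:
  "canonical_horton H \<Longrightarrow> enumerates e n H \<Longrightarrow> horton_chirotope {True} n (orientation e)"
proof (induction n arbitrary: e H rule: less_induct)
  case (less n)
  note e = less.prems(2)
  show ?case
  proof (cases "n \<le> 1")
    case False
    then have n: "2 \<le> card H" "2 \<le> n" using enumerates_card[OF e] by auto
    note c = canonical_horton_halves[OF less.prems(1) n(1)]
    have lt: "class_size 0 n < n" "class_size 1 n < n" using n(2) by (auto simp: class_size_def)
    show ?thesis
    proof (rule chirotope_step[OF n(2)])
      show "interleaved True n (orientation e)" by (rule interleaved_orientation(1)[OF e c(1)])
      show "horton_chirotope {True} (class_size 0 n) (class_chirotope 0 (orientation e))" "horton_chirotope {True} (class_size 1 n) (class_chirotope 1 (orientation e))"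
        unfolding class_chirotope_orientation
        using less.IH[OF lt(1) c(2) enumerates_halves(1)[OF e]] less.IH[OF lt(2) c(3) enumerates_halves(2)[OF e]]
        by blast+
    qed simp
  qed (rule chirotope_small)
qed

lemma horton_enumeration:
  assumes "horton H" obtains e where "enumerates e (card H) H"
proof -
  have "finite H \<and> inj_on (\<lambda>p. p$1) H"
    using assms
  proof (cases rule: horton.cases)
    case 1
    then have "x = y" if "x \<in> H" "y \<in> H" for x y using that by (metis One_nat_def card_le_Suc0_iff_eq)
    then show ?thesis using 1 by (auto simp: inj_on_def)
  qed auto
  then show ?thesis using enumeration_exists that by blast
qed

lemma horton_configuration:
  assumes h: "horton H" and e: "enumerates e n H"
  shows "general_position {..<n} (\<lambda>i. lift (e i))"
proof
  have x: "e i $ 1 \<noteq> e j $ 1" if "i < n" "j < n" "i \<noteq> j" for i j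
    using enumerates_less_iff[OF e] that by (metis linorder_neqE_nat order_less_irrefl)
  have mem: "e i \<in> H" if "i < n" for i using e that by (auto simp: enumerates_def)
  show "finite {..<n}" by simp
  fix i j k assume i: "i \<in> {..<n}"
  show "lift (e i) \<noteq> 0" by (metis lift_simps(3) zero_index zero_neq_one)
  assume j: "j \<in> {..<n}"
  show "cross3 (lift (e i)) (lift (e j)) \<noteq> 0" if "i \<noteq> j"
  proof -
    have "cross3 (lift (e i)) (lift (e j)) $ 2 = e j $ 1 - e i $ 1" by (simp add: cross3_def vector_3)
    then show ?thesis using x[of i j] i j that by (metis eq_iff_diff_eq_0 lessThan_iff zero_index)
  qed
  show "det3 (lift (e i)) (lift (e j)) (lift (e k)) \<noteq> 0"
    if "k \<in> {..<n}" "i \<noteq> j" "i \<noteq> k" "j \<noteq> k"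
  proof -
    have "e i \<noteq> e j" "e i \<noteq> e k" "e j \<noteq> e k" using x i j that by (metis lessThan_iff)+
    then show ?thesis
      using horton_general_position[OF h mem mem mem] x[of i j] i j that by (intro det3_lift_nz) auto
  qed
qed

section \<open>Counting projective holes\<close>

context general_position
begin

lemma alternating_ccw: "alternating I ccw"
  unfolding alternating_def ccw_def
proof (intro ballI impI)
  fix i j k assume "i \<in> I" "j \<in> I" "k \<in> I" "i \<noteq> j" "i \<noteq> k" "j \<noteq> k"
  then have nz: "det3 (w i) (w j) (w k) \<noteq> 0" by (rule det_nz)
  have neg: "(0 < - r) = (\<not> 0 < r)" if "r \<noteq> 0" for r :: real using that by auto
  show "(0 < det3 (w j) (w i) (w k)) = (\<not> 0 < det3 (w i) (w j) (w k)) \<and>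
      (0 < det3 (w i) (w k) (w j)) = (\<not> 0 < det3 (w i) (w j) (w k))"
    unfolding det3_swap(1)[of "w j" "w i" "w k"] det3_swap(2)[of "w i" "w k" "w j"] neg[OF nz] by simp
qed

lemma signed_holes_swap:
  assumes "(A, B) \<in> signed_holes k I cc" shows "(B, A) \<in> signed_holes k I cc"
proof -
  have "empty_triangle I cc (\<lambda>i. i \<in> B) a b c = empty_triangle I cc (\<lambda>i. i \<in> A) a b c"
    if "a \<in> A \<union> B" "b \<in> A \<union> B" "c \<in> A \<union> B" for a b c
  proof -
    have "(x \<in> B) = (x \<notin> A)" if "x \<in> A \<union> B" for x using assms that by (auto simp: signed_holes_def)
    then have "(a \<in> B) = (a \<notin> A)" "(b \<in> B) = (b \<notin> A)" "(c \<in> B) = (c \<notin> A)" using that by auto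
    then show ?thesis by (auto simp: empty_triangle_def in_cell_def)
  qed
  then show ?thesis using assms unfolding signed_holes_def by (simp add: Un_commute Int_commute)
qed

lemma card_proj_holes_le:
  assumes "3 \<le> k" shows "card (proj_holes k points) \<le> card (signed_holes k I ccw)"
  unfolding proj_holes_eq_regions[OF assms] by (intro card_image_le finite_signed_holes finite_I)

end

lemma card_proj_holes_triangles:
  assumes "general_position {..<n} w"
  shows "card (proj_holes 3 (rp2_of ` w ` {..<n})) = card (holes3 n (general_position.ccw w))"
proof -
  interpret general_position "{..<n}" w by fact
  let ?H = "signed_holes 3 {..<n} ccw"
  have small: "card A \<le> 1 \<or> card B \<le> 1" "\<not> (card A \<le> 1 \<and> card B \<le> 1)" if "(A, B) \<in> ?H" for A B
  proof -
    have "card (A \<union> B) = 3" "A \<inter> B = {}" "finite A" "finite B"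
      using that finite_subset[of _ "{..<n}"] by (auto simp: signed_holes_def)
    then have "card A + card B = 3" by (simp add: card_Un_disjoint)
    then show "card A \<le> 1 \<or> card B \<le> 1" "\<not> (card A \<le> 1 \<and> card B \<le> 1)" by linarith+
  qed
  have sub: "holes3 n ccw \<subseteq> ?H" by (auto simp: holes3_def)
  have "region ` ?H = region ` holes3 n ccw"
  proof
    show "region ` ?H \<subseteq> region ` holes3 n ccw"
    proof (rule image_subsetI)
      fix S assume S: "S \<in> ?H"
      obtain A B where AB: "S = (A, B)" by (cases S)
      have disj: "A \<inter> B = {}" using S AB by (auto simp: signed_holes_def)
      consider "card B \<le> 1" | "card A \<le> 1" using small(1) S AB by blast
      then show "region S \<in> region ` holes3 n ccw"
      proof cases
        case 1
        then show ?thesis using S AB by (intro imageI) (simp add: holes3_def)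
      next
        case 2
        then have "(B, A) \<in> holes3 n ccw" using S AB signed_holes_swap by (simp add: holes3_def)
        then show ?thesis using region_swap[OF disj] AB by (metis imageI)
      qed
    qed
  qed (use sub in blast)
  moreover have "inj_on region (holes3 n ccw)"
  proof (rule inj_onI)
    fix S S' assume S: "S \<in> holes3 n ccw" "S' \<in> holes3 n ccw" "region S = region S'"
    obtain A B A' B' where AB: "S = (A, B)" "S' = (A', B')" by (metis surj_pair)
    then have "(A', B') = (A, B) \<or> (A', B') = (B, A)"
      using S sub by (intro region_eqD) auto
    moreover have "(A', B') \<noteq> (B, A)" using S AB small(2) by (auto simp: holes3_def)
    ultimately show "S = S'" unfolding AB by metis
  qed
  ultimately show ?thesis
    using proj_holes_eq_regions[of 3] by (simp add: card_image)
qed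

text \<open>Each fan hole has the point 1 among its positive vertices, and therefore two of them cannot be
the two encodings of one region.\<close>

lemma card_proj_holes_ge:
  assumes "general_position {..<n} w" "3 \<le> k"
    and F: "finite F" "\<And>S. S \<in> F \<Longrightarrow> fan_hole k n (general_position.ccw w) S"
  shows "card F \<le> card (proj_holes k (rp2_of ` w ` {..<n}))"
proof -
  interpret general_position "{..<n}" w by fact
  have sub: "F \<subseteq> signed_holes k {..<n} ccw"
  proof
    fix S assume S: "S \<in> F"
    obtain A B where AB: "S = (A, B)" by (cases S)
    note h = F(2)[OF S, unfolded AB fan_hole_def Let_def fst_conv snd_conv]
    have f: "A \<union> B \<subseteq> {..<n}" "A \<inter> B = {}" "card (A \<union> B) = k" "1 \<in> A \<union> B"
      "\<And>a b c. a \<in> A \<union> B \<Longrightarrow> b \<in> A \<union> B \<Longrightarrow> c \<in> A \<union> B \<Longrightarrow> distinct [a, b, c] \<Longrightarrow> 1 \<in> {a, b, c} \<Longrightarrow>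
         empty_triangle {..<n} ccw (\<lambda>i. i \<in> A) a b c"
      "\<And>a b c. a \<in> A \<union> B - {1} \<Longrightarrow> b \<in> A \<union> B - {1} \<Longrightarrow> c \<in> A \<union> B - {1} \<Longrightarrow> distinct [a, b, c] \<Longrightarrow>
         \<not> in_cell ccw (\<lambda>i. i \<in> A) a b c 1"
      using h by blast+
    have "empty_triangle {..<n} ccw (\<lambda>i. i \<in> A) a b c"
      if "a \<in> A \<union> B" "b \<in> A \<union> B" "c \<in> A \<union> B" "a \<noteq> b" "a \<noteq> c" "b \<noteq> c" for a b c
      by (rule empty_triangle_by_fan[OF f(1,4) f(5,6)]) (use that in auto)
    then show "S \<in> signed_holes k {..<n} ccw" unfolding AB signed_holes_def using f(1-3) by simp
  qed
  have "inj_on region F"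
  proof (rule inj_onI)
    fix S S' assume S: "S \<in> F" "S' \<in> F" "region S = region S'"
    obtain A B A' B' where AB: "S = (A, B)" "S' = (A', B')" by (metis surj_pair)
    then have "(A', B') = (A, B) \<or> (A', B') = (B, A)" using S sub by (intro region_eqD) auto
    moreover have "1 \<in> A" "1 \<in> A'" "A \<inter> B = {}"
      using F(2)[OF S(1)] F(2)[OF S(2)] AB by (auto simp: fan_hole_def Let_def)
    ultimately show "S = S'" using AB by blast
  qed
  then have "card F = card (region ` F)" by (simp add: card_image)
  also have "\<dots> \<le> card (proj_holes k (rp2_of ` w ` {..<n}))"
    unfolding proj_holes_eq_regions[OF assms(2)]
    using sub by (intro card_mono finite_imageI finite_signed_holes image_mono) auto
  finally show ?thesis .
qed

theorem proj_holes_quadratic: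
  assumes H: "horton H" and k: "3 \<le> k" "k \<le> 7" and n: "64 \<le> card H"
  shows "1 / 4096 * (real (card H))\<^sup>2 \<le> real (card (proj_holes k (rp2_embed ` H)))"
    and "real (card (proj_holes k (rp2_embed ` H))) \<le> 46656 * (real (card H))\<^sup>2"
proof -
  define n where "n = card H"
  obtain e where e: "enumerates e n H" using horton_enumeration[OF H] unfolding n_def by blast
  define w where "w = (\<lambda>i. lift (e i))"
  have gp: "general_position {..<n} w" unfolding w_def by (rule horton_configuration[OF H e])
  interpret general_position "{..<n}" w by (rule gp)
  have pts: "rp2_embed ` H = rp2_of ` w ` {..<n}"
    using e by (auto simp: enumerates_def w_def rp2_embed_def lift_def)
  have ccw: "ccw = orientation e" unfolding ccw_def[abs_def] orientation_def[abs_def] by (simp add: w_def)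
  have h: "horton_chirotope UNIV n ccw" unfolding ccw by (rule horton_orientation[OF H e])
  \<comment> \<open>Apart from the apex, the vertices are divided as evenly as possible between the signs; for
    \<open>k \<le> 7\<close> both groups have at most three vertices.\<close>
  define a b where "a = (k - 1) div 2" and "b = k - 1 - a"
  have ab: "1 \<le> a" "a \<le> 3" "1 \<le> b" "b \<le> 3" "1 + a + b = k" using k by (auto simp: a_def b_def)
  obtain F where F: "finite F" "card F = ((n - 24) div 16)\<^sup>2" "\<forall>S\<in>F. fan_hole k n ccw S"
    using many_fan_holes[OF h alternating_ccw _ ab(1-4)] n unfolding n_def[symmetric] ab(5) by blast
  have "((n - 24) div 16)\<^sup>2 \<le> card (proj_holes k (rp2_embed ` H))"
    unfolding pts F(2)[symmetric] using F by (intro card_proj_holes_ge[OF gp k(1)]) auto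
  moreover have "real n / 64 \<le> real ((n - 24) div 16)"
  proof -
    have "n - 24 = 16 * ((n - 24) div 16) + (n - 24) mod 16" "(n - 24) mod 16 < 16" by simp_all
    then have "n \<le> 64 * ((n - 24) div 16)" using n unfolding n_def[symmetric] by linarith
    then have "real n \<le> real (64 * ((n - 24) div 16))" by (rule of_nat_mono)
    then show ?thesis by simp
  qed
  then have "(real n / 64)\<^sup>2 \<le> (real ((n - 24) div 16))\<^sup>2" by (intro power_mono) auto
  ultimately have "(real n / 64)\<^sup>2 \<le> real (card (proj_holes k (rp2_embed ` H)))"
    by (metis (mono_tags, opaque_lifting) of_nat_le_iff of_nat_power order_trans)
  then show "1 / 4096 * (real (card H))\<^sup>2 \<le> real (card (proj_holes k (rp2_embed ` H)))"
    by (simp add: n_def power_divide)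
  have "card (proj_holes k (rp2_embed ` H)) \<le> 46656 * n\<^sup>2"
    unfolding pts using card_proj_holes_le[OF k(1)] card_signed_holes_le[OF h alternating_ccw, of k] k by simp
  then have "real (card (proj_holes k (rp2_embed ` H))) \<le> real (46656 * n\<^sup>2)" by (rule of_nat_mono)
  then show "real (card (proj_holes k (rp2_embed ` H))) \<le> 46656 * (real (card H))\<^sup>2" by (simp add: n_def)
qed

theorem canonical_triangles:
  assumes H: "canonical_horton H" "card H = 2 ^ z" "z > 0"
  shows "real (card (proj_holes 3 (rp2_embed ` H)))
    = 4.25 * 2 ^ (2 * z) + 2 ^ z * (- (3 * (real z)\<^sup>2 / 2) - real z / 2 - 5.5) - 4 * real z + 2"
proof -
  have ho: "horton H" using H by (simp add: canonical_horton_def)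
  obtain e where e: "enumerates e (2 ^ z) H" using horton_enumeration[OF ho] H(2) by metis
  define w where "w = (\<lambda>i. lift (e i))"
  have gp: "general_position {..<2 ^ z} w" unfolding w_def by (rule horton_configuration[OF ho e])
  interpret general_position "{..<2 ^ z}" w by (rule gp)
  have pts: "rp2_embed ` H = rp2_of ` w ` {..<2 ^ z}"
    using e by (auto simp: enumerates_def w_def rp2_embed_def lift_def)
  have ccw: "ccw = orientation e" unfolding ccw_def[abs_def] orientation_def[abs_def] by (simp add: w_def)
  have h: "horton_chirotope {True} (2 ^ z) ccw" unfolding ccw by (rule canonical_horton_orientation[OF H(1) e])
  obtain y where y: "z = Suc y" using H(3) gr0_conv_Suc by blast
  show ?thesis
    unfolding pts card_proj_holes_triangles[OF gp]
    using canonical_holes3_count[of y ccw] h alternating_ccw unfolding y by blast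
qed

lemma error_term_bigtheta:
  "(\<lambda>n::nat. 0.5 * (real n * log 2 (real n)) + 5.5 * real n + 4 * log 2 (real n) - 2) \<in> \<Theta>(\<lambda>n. real n * log 2 (real n))"
proof (rule bigthetaI)
  show "(\<lambda>n::nat. 0.5 * (real n * log 2 (real n)) + 5.5 * real n + 4 * log 2 (real n) - 2) \<in> O(\<lambda>n. real n * log 2 (real n))"
  proof (rule bigoI[of _ 10])
    show "\<forall>\<^sub>F n in at_top. norm (0.5 * (real n * log 2 (real n)) + 5.5 * real n + 4 * log 2 (real n) - 2)
        \<le> 10 * norm (real n * log 2 (real n))"
      using eventually_ge_at_top[of 2]
    proof eventually_elim
      case (elim n)
      have l: "1 \<le> log 2 (real n)" using elim by simp
      have "real n * 1 \<le> real n * log 2 (real n)" "1 * log 2 (real n) \<le> real n * log 2 (real n)"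
        using l elim by (intro mult_left_mono mult_right_mono; simp)+
      moreover have "2 \<le> real n" using elim by simp
      ultimately show ?case using l unfolding real_norm_def by linarith
    qed
  qed
  show "(\<lambda>n::nat. 0.5 * (real n * log 2 (real n)) + 5.5 * real n + 4 * log 2 (real n) - 2) \<in> \<Omega>(\<lambda>n. real n * log 2 (real n))"
  proof (rule landau_omega.bigI[of "0.5"])
    show "\<forall>\<^sub>F n in at_top. norm (0.5 * (real n * log 2 (real n)) + 5.5 * real n + 4 * log 2 (real n) - 2)
        \<ge> 0.5 * norm (real n * log 2 (real n))"
      using eventually_ge_at_top[of 2]
    proof eventually_elim
      case (elim n)
      have l: "1 \<le> log 2 (real n)" using elim by simp
      have "real n * 1 \<le> real n * log 2 (real n)" using l elim by (intro mult_left_mono) simp_all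
      moreover have "2 \<le> real n" using elim by simp
      ultimately show ?case using l unfolding real_norm_def by linarith
    qed
  qed simp
qed

theorem theorem3:
  shows
  "(\<forall>k\<in>{3..7::nat}. \<exists>c>0. \<exists>C>0. \<exists>N::nat. \<forall>H. horton H \<and> card H \<ge> N \<longrightarrow>
      c * (real (card H))\<^sup>2 \<le> real (card (proj_holes k (rp2_embed ` H))) \<and>
      real (card (proj_holes k (rp2_embed ` H))) \<le> C * (real (card H))\<^sup>2)
   \<and>
   (\<forall>z::nat. z > 0 \<longrightarrow> (\<forall>H. canonical_horton H \<and> card H = 2 ^ z \<longrightarrow>
      real (card (proj_holes 3 (rp2_embed ` H)))
        = 4.25 * 2 ^ (2 * z) + 2 ^ z * (- (3 * (real z)\<^sup>2 / 2) - real z / 2 - 5.5)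
          - 4 * real z + 2))
   \<and>
   (\<exists>g :: nat \<Rightarrow> real. g \<in> \<Theta>(\<lambda>n. real n * log 2 (real n)) \<and>
      (\<forall>z n::nat. z > 0 \<longrightarrow> n = 2 ^ z \<longrightarrow>
        4.25 * 2 ^ (2 * z) + 2 ^ z * (- (3 * (real z)\<^sup>2 / 2) - real z / 2 - 5.5)
          - 4 * real z + 2
        = 4.25 * (real n)\<^sup>2 - 1.5 * real n * (log 2 (real n))\<^sup>2 - g n))"
proof (intro conjI ballI allI impI)
  fix k :: nat assume "k \<in> {3..7}"
  then show "\<exists>c>0. \<exists>C>0. \<exists>N::nat. \<forall>H. horton H \<and> card H \<ge> N \<longrightarrow>
      c * (real (card H))\<^sup>2 \<le> real (card (proj_holes k (rp2_embed ` H))) \<and>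
      real (card (proj_holes k (rp2_embed ` H))) \<le> C * (real (card H))\<^sup>2"
    using proj_holes_quadratic
    by (intro exI[of _ "1 / 4096 :: real"] exI[of _ "46656 :: real"] exI[of _ "64 :: nat"] conjI allI impI) auto
next
  fix z :: nat and H assume "z > 0" "canonical_horton H \<and> card H = 2 ^ z"
  then show "real (card (proj_holes 3 (rp2_embed ` H)))
        = 4.25 * 2 ^ (2 * z) + 2 ^ z * (- (3 * (real z)\<^sup>2 / 2) - real z / 2 - 5.5) - 4 * real z + 2"
    using canonical_triangles by blast
next
  show "\<exists>g :: nat \<Rightarrow> real. g \<in> \<Theta>(\<lambda>n. real n * log 2 (real n)) \<and>
      (\<forall>z n::nat. z > 0 \<longrightarrow> n = 2 ^ z \<longrightarrow>
        4.25 * 2 ^ (2 * z) + 2 ^ z * (- (3 * (real z)\<^sup>2 / 2) - real z / 2 - 5.5)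
          - 4 * real z + 2
        = 4.25 * (real n)\<^sup>2 - 1.5 * real n * (log 2 (real n))\<^sup>2 - g n)"
  proof (intro exI conjI allI impI)
    show "(\<lambda>n::nat. 0.5 * (real n * log 2 (real n)) + 5.5 * real n + 4 * log 2 (real n) - 2)
        \<in> \<Theta>(\<lambda>n. real n * log 2 (real n))" by (rule error_term_bigtheta)
    fix z n :: nat assume "z > 0" "n = 2 ^ z"
    then have n: "real n = 2 ^ z" "log 2 (real n) = real z" by (simp_all add: log_nat_power)
    have p: "(2::real) ^ (2 * z) = (2 ^ z)\<^sup>2" by (simp add: power_mult[symmetric] mult.commute)
    show "4.25 * 2 ^ (2 * z) + 2 ^ z * (- (3 * (real z)\<^sup>2 / 2) - real z / 2 - 5.5) - 4 * real z + 2
        = 4.25 * (real n)\<^sup>2 - 1.5 * real n * (log 2 (real n))\<^sup>2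
          - (0.5 * (real n * log 2 (real n)) + 5.5 * real n + 4 * log 2 (real n) - 2)"
      unfolding n p by (simp add: field_simps)
  qed
qed

end
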